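(* Let $(M^{2m+1},g,\xi)$ be a spin Sasakian manifold. (a) The space of $-\frac12$-Killing spinors in $\Sigma_0M$ coincides with that of $(-\frac{m+1}{2},0)$-transversal Killing spinors in $\Sigma_0M$. In particular, a section $\psi_0$ of $\Sigma_0M$ is an $(\alpha,0)$-transversal Killing spinor on $(M^{2m+1},g,\xi)$ for some $\alpha<0$ if and only if there exists a $\mathcal{D}$-homothetic deformation $\overline{g}_t$ of $g$ for which the corresponding spinor field $\overline{\psi_0}^t$ is a $-\frac12$-Killing spinor. (b) The space of $\frac{(-1)^m}{2}$-Killing spinors in $\Sigma_mM$ coincides with that of $((-1)^m\frac{m+1}{2},0)$-transversal Killing spinors in $\Sigma_mM$. In particular, a section $\psi_m$ of $\Sigma_mM$ is an $(\alpha,0)$-transversal Killing spinor on $(M^{2m+1},g,\xi)$ for some $\alpha$ such that $(-1)^m\alpha>0$ if and only if there exists a $\mathcal{D}$-homothetic deformation $\overline{g}_t$ of $g$ for which the corresponding spinor field $\overline{\psi_m}^t$ is a $\frac{(-1)^m}{2}$-Killing spinor.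
   Context: A Riemannian flow is a Riemannian manifold $(M^{n+1},g)$ with a smooth unit vector field $\xi$ such that $(\mathcal{L}_\xi g)(Z,W)=0$ for all $Z,W\perp\xi$. Put $Q=\xi^\perp$, $h(Z)=\nabla^M_Z\xi$ for $Z\in Q$, $\kappa=\nabla^M_\xi\xi$, $\Omega(Z,W)=g(h(Z),W)$ on $Q$ extended by $\Omega(\xi,\cdot)=0$. The connection $\nabla$ on $Q$ is $\nabla_\xi Z=[\xi,Z]^Q$, $\nabla_XZ=(\nabla^M_XZ)^Q$ for $X\in\Gamma(Q)$. A Sasakian manifold is a Riemannian flow with $\kappa=0$, $h^2=-\mathrm{Id}_Q$, $\nabla h=0$ (so $n=2m$). On the spinor bundle $\Sigma M$ of a spin Sasakian manifold, with Clifford multiplication "$\cdot$" ($X\cdot X=-|X|^2$; $e_i\wedge e_j$ acts as $e_i\cdot e_j\cdot$), the transversal connection is $\nabla_\xi\varphi=\nabla^M_\xi\varphi-\frac12\Omega\cdot\varphi$, $\nabla_Z\varphi=\nabla^M_Z\varphi-\frac12\xi\cdot h(Z)\cdot\varphi$ for $Z\in\Gamma(Q)$. An $(\alpha,\beta)$-transversal Killing spinor is a smooth section $\psi$ with $\nabla_\xi\psi=\alpha\,\xi\cdot\psi$ and $\nabla_Z\psi=\beta\,\xi\cdot Z\cdot\psi$ for all $Z\in\Gamma(Q)$. A $\lambda$-Killing spinor on $M$ is a section $\psi$ with $\nabla^M_X\psi=\lambda X\cdot\psi$ for all $X\in\Gamma(TM)$. There is an orthogonal $\nabla$-parallel decomposition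 $\Sigma M=\bigoplus_{r=0}^m\Sigma_rM$, where $\Sigma_rM$ is the eigenbundle of the Clifford action of $\Omega$ for the eigenvalue $i(2r-m)$; Clifford multiplication is normalized so that $i\xi\cdot=(-1)^r\mathrm{Id}$ on $\Sigma_rM$. A $\mathcal{D}$-homothetic deformation of $g$ is a metric $\overline{g}_t=t^2g|_{\mathbb{R}\xi}+t\,g|_Q$ (with $\mathbb{R}\xi\perp Q$), $t>0$; with $\overline{\xi}^t=\frac1t\xi$ it is again Sasakian. There is a unitary isomorphism $\Sigma_gM\to\Sigma_{\overline{g}_t}M$, $\varphi\mapsto\overline{\varphi}^t$, with $\overline{\xi\cdot\varphi}^t=\overline{\xi}^t\,\overline{\cdot}\,\overline{\varphi}^t$, $\overline{Z\cdot\varphi}^t=\frac{1}{\sqrt t}Z\,\overline{\cdot}\,\overline{\varphi}^t$ for $Z\in\Gamma(Q)$, and $\overline{\nabla}^t_X\overline{\varphi}^t=\overline{\nabla_X\varphi}^t$ for $X\in\Gamma(TM)$ ($\overline{\cdot}$, $\overline{\nabla}^t$ being Clifford multiplication and transversal connection for $(\overline{g}_t,\overline{\xi}^t)$). *)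

theory Defs
  imports "HOL-Analysis.Analysis" "HOL-Library.Function_Algebras"
begin

instantiation "fun" :: (type, real_vector) real_vector
begin

definition scaleR_fun :: "real \<Rightarrow> ('a \<Rightarrow> 'b) \<Rightarrow> 'a \<Rightarrow> 'b"
  where "scaleR_fun c f = (\<lambda>x. c *\<^sub>R f x)"

instance
  by standard (auto simp: scaleR_fun_def fun_eq_iff scaleR_add_right scaleR_add_left)

end

section \<open>Smooth manifolds\<close>

text \<open>The set argument of \<open>Ck_on\<close> and \<open>Cinf_on\<close> is meant to be open.\<close>

primrec Ck_on :: "nat \<Rightarrow> 'e::euclidean_space set \<Rightarrow> ('e \<Rightarrow> 'b::real_normed_vector) \<Rightarrow> bool" where
  "Ck_on 0 W f \<longleftrightarrow> continuous_on W f"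
| "Ck_on (Suc k) W f \<longleftrightarrow> (\<forall>x\<in>W. f differentiable (at x)) \<and>
     (\<forall>v. Ck_on k W (\<lambda>x. frechet_derivative f (at x) v))"

definition Cinf_on :: "'e::euclidean_space set \<Rightarrow> ('e \<Rightarrow> 'b::real_normed_vector) \<Rightarrow> bool"
  where "Cinf_on W f \<longleftrightarrow> (\<forall>k. Ck_on k W f)"

text \<open>A manifold is a whole (Hausdorff, second countable) type together with an atlas, a set of
  pairs of a chart domain and a chart map; charts are only relevant on their domains. The
  dimension is that of the Euclidean model space.\<close>

type_synonym ('a, 'e) atlas = "('a set \<times> ('a \<Rightarrow> 'e)) set"

definition smooth_atlas ::
  "('a::{t2_space,second_countable_topology}, 'e::euclidean_space) atlas \<Rightarrow> bool"
  where "smooth_atlas A \<longleftrightarrow>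
    (\<Union>(U, \<phi>)\<in>A. U) = UNIV \<and>
    (\<forall>(U, \<phi>)\<in>A. open U \<and> open (\<phi> ` U) \<and> homeomorphism U (\<phi> ` U) \<phi> (inv_into U \<phi>)) \<and>
    (\<forall>(U, \<phi>)\<in>A. \<forall>(V, \<theta>)\<in>A. Cinf_on (\<phi> ` (U \<inter> V)) (\<theta> \<circ> inv_into U \<phi>))"

definition smooth_fun :: "('a::topological_space, 'e::euclidean_space) atlas \<Rightarrow> 'a set \<Rightarrow> ('a \<Rightarrow> real) \<Rightarrow> bool"
  where "smooth_fun A W f \<longleftrightarrow> (\<forall>(U, \<phi>)\<in>A. Cinf_on (\<phi> ` (U \<inter> W)) (f \<circ> inv_into U \<phi>))"

definition smooth_near :: "('a::topological_space, 'e::euclidean_space) atlas \<Rightarrow> 'a \<Rightarrow> ('a \<Rightarrow> real) \<Rightarrow> bool"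
  where "smooth_near A p f \<longleftrightarrow> (\<exists>W. open W \<and> p \<in> W \<and> smooth_fun A W f)"

text \<open>A tangent vector at \<open>p\<close> is a derivation of the functions that are smooth near \<open>p\<close>. Such a
  derivation automatically depends only on germs; it is set to 0 on all other functions.\<close>

type_synonym 'a tvec = "('a \<Rightarrow> real) \<Rightarrow> real"
type_synonym 'a vfield = "'a \<Rightarrow> 'a tvec"
type_synonym 'a metric = "'a \<Rightarrow> 'a tvec \<Rightarrow> 'a tvec \<Rightarrow> real"

definition tangent :: "('a::topological_space, 'e::euclidean_space) atlas \<Rightarrow> 'a \<Rightarrow> 'a tvec set"
  where "tangent A p = {v.
    (\<forall>f. \<not> smooth_near A p f \<longrightarrow> v f = 0) \<and>
    (\<forall>f k c. smooth_near A p f \<longrightarrow> smooth_near A p k \<longrightarrow>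
       v (\<lambda>q. f q + k q) = v f + v k \<and>
       v (\<lambda>q. c * f q) = c * v f \<and>
       v (\<lambda>q. f q * k q) = v f * k p + f p * v k)}"

definition smooth_vf :: "('a::topological_space, 'e::euclidean_space) atlas \<Rightarrow> 'a set \<Rightarrow> 'a vfield \<Rightarrow> bool"
  where "smooth_vf A W X \<longleftrightarrow> (\<forall>p\<in>W. X p \<in> tangent A p) \<and>
    (\<forall>V f. open V \<longrightarrow> V \<subseteq> W \<longrightarrow> smooth_fun A V f \<longrightarrow> smooth_fun A V (\<lambda>p. X p f))"

definition lie_bracket ::
  "('a::topological_space, 'e::euclidean_space) atlas \<Rightarrow> 'a vfield \<Rightarrow> 'a vfield \<Rightarrow> 'a vfield"
  where "lie_bracket A X Y p =
    (\<lambda>f. if smooth_near A p f then X p (\<lambda>q. Y q f) - Y p (\<lambda>q. X q f) else 0)"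

section \<open>Riemannian metrics and the Levi-Civita connection\<close>

definition riemannian_metric :: "('a::topological_space, 'e::euclidean_space) atlas \<Rightarrow> 'a metric \<Rightarrow> bool"
  where "riemannian_metric A g \<longleftrightarrow>
    (\<forall>p. \<forall>u\<in>tangent A p. \<forall>v\<in>tangent A p. \<forall>w\<in>tangent A p. \<forall>c.
       g p (u + v) w = g p u w + g p v w \<and> g p (c *\<^sub>R u) w = c * g p u w \<and> g p u v = g p v u) \<and>
    (\<forall>p. \<forall>v\<in>tangent A p. v \<noteq> 0 \<longrightarrow> g p v v > 0) \<and>
    (\<forall>W X Y. open W \<longrightarrow> smooth_vf A W X \<longrightarrow> smooth_vf A W Y \<longrightarrow>
       smooth_fun A W (\<lambda>p. g p (X p) (Y p)))"

text \<open>\<open>D p v Y\<close> is the derivative at \<open>p\<close>, in the direction of the tangent vector \<open>v\<close> at \<open>p\<close>, of a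
  vector field \<open>Y\<close> that is smooth on some open set containing \<open>p\<close>.\<close>

definition levi_civita ::
  "('a::topological_space, 'e::euclidean_space) atlas \<Rightarrow> 'a metric \<Rightarrow>
   ('a \<Rightarrow> 'a tvec \<Rightarrow> 'a vfield \<Rightarrow> 'a tvec) \<Rightarrow> bool"
  where "levi_civita A g D \<longleftrightarrow>
    (\<forall>W X Y Z f. open W \<longrightarrow> smooth_vf A W X \<longrightarrow> smooth_vf A W Y \<longrightarrow> smooth_vf A W Z \<longrightarrow>
       smooth_fun A W f \<longrightarrow>
       smooth_vf A W (\<lambda>p. D p (X p) Y) \<and>
       (\<forall>p\<in>W. D p (X p) Y - D p (Y p) X = lie_bracket A X Y p) \<and>
       (\<forall>p\<in>W. \<forall>v\<in>tangent A p. \<forall>w\<in>tangent A p. \<forall>c.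
          D p v Y \<in> tangent A p \<and>
          D p (v + w) Y = D p v Y + D p w Y \<and>
          D p (c *\<^sub>R v) Y = c *\<^sub>R D p v Y \<and>
          D p v (\<lambda>q. Y q + Z q) = D p v Y + D p v Z \<and>
          D p v (\<lambda>q. f q *\<^sub>R Y q) = v f *\<^sub>R Y p + f p *\<^sub>R D p v Y \<and>
          v (\<lambda>q. g q (Y q) (Z q)) = g p (D p v Y) (Z p) + g p (Y p) (D p v Z)))"

definition nabla ::
  "('a::topological_space, 'e::euclidean_space) atlas \<Rightarrow> 'a metric \<Rightarrow> 'a \<Rightarrow> 'a tvec \<Rightarrow> 'a vfield \<Rightarrow> 'a tvec"
  where "nabla A g = (SOME D. levi_civita A g D)"

section \<open>Riemannian flows and Sasakian manifolds\<close>

definition horiz :: "'a metric \<Rightarrow> 'a vfield \<Rightarrow> 'a \<Rightarrow> 'a tvec \<Rightarrow> 'a tvec"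
  where "horiz g \<xi> p v = v - g p v (\<xi> p) *\<^sub>R \<xi> p"

definition Qspace ::
  "('a::topological_space, 'e::euclidean_space) atlas \<Rightarrow> 'a metric \<Rightarrow> 'a vfield \<Rightarrow> 'a \<Rightarrow> 'a tvec set"
  where "Qspace A g \<xi> p = {v \<in> tangent A p. g p v (\<xi> p) = 0}"

definition Qsection ::
  "('a::topological_space, 'e::euclidean_space) atlas \<Rightarrow> 'a metric \<Rightarrow> 'a vfield \<Rightarrow> 'a set \<Rightarrow> 'a vfield \<Rightarrow> bool"
  where "Qsection A g \<xi> W Z \<longleftrightarrow> smooth_vf A W Z \<and> (\<forall>p\<in>W. Z p \<in> Qspace A g \<xi> p)"

definition lie_deriv_metric ::
  "('a::topological_space, 'e::euclidean_space) atlas \<Rightarrow> 'a vfield \<Rightarrow> 'a metric \<Rightarrow> 'a vfield \<Rightarrow> 'a vfield \<Rightarrow> 'a \<Rightarrow> real"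
  where "lie_deriv_metric A \<xi> g Z Y p = \<xi> p (\<lambda>q. g q (Z q) (Y q))
    - g p (lie_bracket A \<xi> Z p) (Y p) - g p (Z p) (lie_bracket A \<xi> Y p)"

definition riemannian_flow ::
  "('a::{t2_space,second_countable_topology}, 'e::euclidean_space) atlas \<Rightarrow> 'a metric \<Rightarrow> 'a vfield \<Rightarrow> bool"
  where "riemannian_flow A g \<xi> \<longleftrightarrow>
    smooth_atlas A \<and> riemannian_metric A g \<and>
    smooth_vf A UNIV \<xi> \<and> (\<forall>p. g p (\<xi> p) (\<xi> p) = 1) \<and>
    (\<forall>W Z Y. open W \<longrightarrow> Qsection A g \<xi> W Z \<longrightarrow> Qsection A g \<xi> W Y \<longrightarrow>
       (\<forall>p\<in>W. lie_deriv_metric A \<xi> g Z Y p = 0))"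

definition flow_h ::
  "('a::topological_space, 'e::euclidean_space) atlas \<Rightarrow> 'a metric \<Rightarrow> 'a vfield \<Rightarrow> 'a \<Rightarrow> 'a tvec \<Rightarrow> 'a tvec"
  where "flow_h A g \<xi> p Z = nabla A g p Z \<xi>"

definition flow_kappa ::
  "('a::topological_space, 'e::euclidean_space) atlas \<Rightarrow> 'a metric \<Rightarrow> 'a vfield \<Rightarrow> 'a vfield"
  where "flow_kappa A g \<xi> p = nabla A g p (\<xi> p) \<xi>"

definition flow_Omega ::
  "('a::topological_space, 'e::euclidean_space) atlas \<Rightarrow> 'a metric \<Rightarrow> 'a vfield \<Rightarrow> 'a metric"
  where "flow_Omega A g \<xi> p v w = g p (flow_h A g \<xi> p (horiz g \<xi> p v)) (horiz g \<xi> p w)"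

text \<open>The transversal connection on \<open>Q\<close>, extended linearly to all directions \<open>v\<close>.\<close>

definition trans_conn ::
  "('a::topological_space, 'e::euclidean_space) atlas \<Rightarrow> 'a metric \<Rightarrow> 'a vfield \<Rightarrow> 'a \<Rightarrow> 'a tvec \<Rightarrow> 'a vfield \<Rightarrow> 'a tvec"
  where "trans_conn A g \<xi> p v Z =
    horiz g \<xi> p (nabla A g p (horiz g \<xi> p v) Z) +
    g p v (\<xi> p) *\<^sub>R horiz g \<xi> p (lie_bracket A \<xi> Z p)"

definition sasakian ::
  "('a::{t2_space,second_countable_topology}, 'e::euclidean_space) atlas \<Rightarrow> 'a metric \<Rightarrow> 'a vfield \<Rightarrow> bool"
  where "sasakian A g \<xi> \<longleftrightarrow>
    riemannian_flow A g \<xi> \<and>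
    (\<forall>p. flow_kappa A g \<xi> p = 0) \<and>
    (\<forall>p. \<forall>v\<in>Qspace A g \<xi> p. flow_h A g \<xi> p (flow_h A g \<xi> p v) = - v) \<and>
    (\<forall>W Z. open W \<longrightarrow> Qsection A g \<xi> W Z \<longrightarrow> (\<forall>p\<in>W. \<forall>v\<in>tangent A p.
       trans_conn A g \<xi> p v (\<lambda>q. flow_h A g \<xi> q (Z q)) =
       flow_h A g \<xi> p (trans_conn A g \<xi> p v Z)))"

section \<open>Spin structures and spinor fields\<close>

definition clifford_rep :: "('e::euclidean_space \<Rightarrow> complex^'s^'s) \<Rightarrow> bool"
  where "clifford_rep \<gamma> \<longleftrightarrow> linear \<gamma> \<and>
    (\<forall>x. \<gamma> x ** \<gamma> x = mat (- of_real ((norm x)\<^sup>2))) \<and>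
    (\<forall>x i j. \<gamma> x $ i $ j = - cnj (\<gamma> x $ j $ i))"

text \<open>The image of the spin group under the spinor representation. In odd dimension \<open>2m+1\<close> a
  Clifford module of complex dimension \<open>2 ^ m\<close> is irreducible and faithful on the even part of
  the Clifford algebra, so this is a copy of the spin group itself.\<close>

inductive_set spin_group :: "('e::euclidean_space \<Rightarrow> complex^'s^'s) \<Rightarrow> (complex^'s^'s) set"
  for \<gamma> :: "'e::euclidean_space \<Rightarrow> complex^'s^'s" where
  one: "mat 1 \<in> spin_group \<gamma>"
| mult: "\<gamma> x ** \<gamma> y ** s \<in> spin_group \<gamma>"
    if "s \<in> spin_group \<gamma>" "norm x = 1" "norm y = 1"

text \<open>A spin structure is given by a cover with smooth orthonormal frames, regarded as isometries
  from the Euclidean model space onto the tangent spaces, and a spin-valued cocycle lifting the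
  transition functions of these frames.\<close>

record ('j, 'a, 'e, 's::finite) spin_data =
  patch :: "'j \<Rightarrow> 'a set"
  frame :: "'j \<Rightarrow> 'a \<Rightarrow> 'e \<Rightarrow> 'a tvec"
  trans_fun :: "'j \<Rightarrow> 'j \<Rightarrow> 'a \<Rightarrow> complex^'s^'s"

definition spin_structure ::
  "('a::topological_space, 'e::euclidean_space) atlas \<Rightarrow> 'a metric \<Rightarrow> ('e \<Rightarrow> complex^'s^'s) \<Rightarrow>
   ('j, 'a, 'e, 's::finite) spin_data \<Rightarrow> bool"
  where "spin_structure A g \<gamma> S \<longleftrightarrow>
    (\<forall>a. open (patch S a)) \<and> (\<Union>a. patch S a) = UNIV \<and>
    (\<forall>a x. smooth_vf A (patch S a) (\<lambda>p. frame S a p x)) \<and>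
    (\<forall>a. \<forall>p\<in>patch S a. linear (frame S a p) \<and> range (frame S a p) = tangent A p \<and>
       (\<forall>x y. g p (frame S a p x) (frame S a p y) = x \<bullet> y)) \<and>
    (\<forall>a b i j. smooth_fun A (patch S a \<inter> patch S b) (\<lambda>p. Re (trans_fun S a b p $ i $ j)) \<and>
       smooth_fun A (patch S a \<inter> patch S b) (\<lambda>p. Im (trans_fun S a b p $ i $ j))) \<and>
    (\<forall>a b. \<forall>p\<in>patch S a \<inter> patch S b. trans_fun S a b p \<in> spin_group \<gamma> \<and>
       (\<forall>x y. frame S a p x = frame S b p y \<longrightarrow>
          \<gamma> x ** trans_fun S a b p = trans_fun S a b p ** \<gamma> y)) \<and>
    (\<forall>a b c. \<forall>p\<in>patch S a \<inter> patch S b \<inter> patch S c.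
       trans_fun S a b p ** trans_fun S b c p = trans_fun S a c p)"

text \<open>A spinor field is represented by its components with respect to the local trivializations.\<close>

type_synonym ('j, 'a, 's) spinor = "'j \<Rightarrow> 'a \<Rightarrow> complex^'s"

definition spinor_field ::
  "('a::topological_space, 'e::euclidean_space) atlas \<Rightarrow> ('j, 'a, 'e, 's::finite) spin_data \<Rightarrow>
   ('j, 'a, 's) spinor \<Rightarrow> bool"
  where "spinor_field A S \<psi> \<longleftrightarrow>
    (\<forall>a k. smooth_fun A (patch S a) (\<lambda>p. Re (\<psi> a p $ k)) \<and>
       smooth_fun A (patch S a) (\<lambda>p. Im (\<psi> a p $ k))) \<and>
    (\<forall>a b. \<forall>p\<in>patch S a \<inter> patch S b. \<psi> a p = trans_fun S a b p *v \<psi> b p)"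

definition cliff ::
  "('e::euclidean_space \<Rightarrow> complex^'s^'s) \<Rightarrow> ('j, 'a, 'e, 's::finite) spin_data \<Rightarrow>
   'j \<Rightarrow> 'a \<Rightarrow> 'a tvec \<Rightarrow> complex^'s \<Rightarrow> complex^'s"
  where "cliff \<gamma> S a p v \<phi> = \<gamma> (inv (frame S a p) v) *v \<phi>"

text \<open>A 2-form \<open>\<omega> = (1/2) (\<Sum>i j. \<omega>(e\<^sub>i, e\<^sub>j) e\<^sub>i \<and> e\<^sub>j)\<close> acts with \<open>e\<^sub>i \<and> e\<^sub>j\<close> replaced by
  \<open>e\<^sub>i \<cdot> e\<^sub>j\<close> (for \<open>i = j\<close> the coefficient vanishes).\<close>

definition cliff2 ::
  "('e::euclidean_space \<Rightarrow> complex^'s^'s) \<Rightarrow> ('j, 'a, 'e, 's::finite) spin_data \<Rightarrow>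
   'j \<Rightarrow> 'a \<Rightarrow> ('a tvec \<Rightarrow> 'a tvec \<Rightarrow> real) \<Rightarrow> complex^'s \<Rightarrow> complex^'s"
  where "cliff2 \<gamma> S a p \<omega> \<phi> = (1/2) *\<^sub>R (\<Sum>i\<in>Basis. \<Sum>j\<in>Basis.
    \<omega> (frame S a p i) (frame S a p j) *\<^sub>R
      cliff \<gamma> S a p (frame S a p i) (cliff \<gamma> S a p (frame S a p j) \<phi>))"

definition cderiv :: "'a tvec \<Rightarrow> ('a \<Rightarrow> complex^'s) \<Rightarrow> complex^'s"
  where "cderiv v f = (\<chi> k. Complex (v (\<lambda>q. Re (f q $ k))) (v (\<lambda>q. Im (f q $ k))))"

text \<open>The lift of the Levi-Civita connection:
  \<open>X(\<psi>) + (1/4) (\<Sum>i j. g(\<nabla>\<^sub>X e\<^sub>i, e\<^sub>j) e\<^sub>i \<cdot> e\<^sub>j \<cdot> \<psi>)\<close> in the local trivialization.\<close>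

definition spin_conn ::
  "('a::topological_space, 'e::euclidean_space) atlas \<Rightarrow> 'a metric \<Rightarrow> ('e \<Rightarrow> complex^'s^'s) \<Rightarrow>
   ('j, 'a, 'e, 's::finite) spin_data \<Rightarrow> 'j \<Rightarrow> 'a \<Rightarrow> 'a tvec \<Rightarrow> ('j, 'a, 's) spinor \<Rightarrow> complex^'s"
  where "spin_conn A g \<gamma> S a p v \<psi> = cderiv v (\<psi> a) +
    (1/4) *\<^sub>R (\<Sum>i\<in>Basis. \<Sum>j\<in>Basis.
      g p (nabla A g p v (\<lambda>q. frame S a q i)) (frame S a p j) *\<^sub>R
        cliff \<gamma> S a p (frame S a p i) (cliff \<gamma> S a p (frame S a p j) (\<psi> a p)))"

definition killing_spinor ::
  "('a::topological_space, 'e::euclidean_space) atlas \<Rightarrow> 'a metric \<Rightarrow> ('e \<Rightarrow> complex^'s^'s) \<Rightarrow>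
   ('j, 'a, 'e, 's::finite) spin_data \<Rightarrow> complex \<Rightarrow> ('j, 'a, 's) spinor \<Rightarrow> bool"
  where "killing_spinor A g \<gamma> S \<mu> \<psi> \<longleftrightarrow> spinor_field A S \<psi> \<and>
    (\<forall>a. \<forall>p\<in>patch S a. \<forall>v\<in>tangent A p.
       spin_conn A g \<gamma> S a p v \<psi> = \<mu> *s cliff \<gamma> S a p v (\<psi> a p))"

section \<open>Transversal Killing spinors\<close>

definition trans_spin_conn_xi ::
  "('a::topological_space, 'e::euclidean_space) atlas \<Rightarrow> 'a metric \<Rightarrow> 'a vfield \<Rightarrow>
   ('e \<Rightarrow> complex^'s^'s) \<Rightarrow> ('j, 'a, 'e, 's::finite) spin_data \<Rightarrow> 'j \<Rightarrow> 'a \<Rightarrow> ('j, 'a, 's) spinor \<Rightarrow> complex^'s"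
  where "trans_spin_conn_xi A g \<xi> \<gamma> S a p \<psi> = spin_conn A g \<gamma> S a p (\<xi> p) \<psi> -
    (1/2) *\<^sub>R cliff2 \<gamma> S a p (flow_Omega A g \<xi> p) (\<psi> a p)"

definition trans_spin_conn_Q ::
  "('a::topological_space, 'e::euclidean_space) atlas \<Rightarrow> 'a metric \<Rightarrow> 'a vfield \<Rightarrow>
   ('e \<Rightarrow> complex^'s^'s) \<Rightarrow> ('j, 'a, 'e, 's::finite) spin_data \<Rightarrow> 'j \<Rightarrow> 'a \<Rightarrow> 'a tvec \<Rightarrow>
   ('j, 'a, 's) spinor \<Rightarrow> complex^'s"
  where "trans_spin_conn_Q A g \<xi> \<gamma> S a p Z \<psi> = spin_conn A g \<gamma> S a p Z \<psi> -
    (1/2) *\<^sub>R cliff \<gamma> S a p (\<xi> p) (cliff \<gamma> S a p (flow_h A g \<xi> p Z) (\<psi> a p))"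

definition transversal_killing ::
  "('a::topological_space, 'e::euclidean_space) atlas \<Rightarrow> 'a metric \<Rightarrow> 'a vfield \<Rightarrow>
   ('e \<Rightarrow> complex^'s^'s) \<Rightarrow> ('j, 'a, 'e, 's::finite) spin_data \<Rightarrow> complex \<Rightarrow> complex \<Rightarrow>
   ('j, 'a, 's) spinor \<Rightarrow> bool"
  where "transversal_killing A g \<xi> \<gamma> S \<alpha> \<beta> \<psi> \<longleftrightarrow> spinor_field A S \<psi> \<and>
    (\<forall>a. \<forall>p\<in>patch S a.
       trans_spin_conn_xi A g \<xi> \<gamma> S a p \<psi> = \<alpha> *s cliff \<gamma> S a p (\<xi> p) (\<psi> a p) \<and>
       (\<forall>Z\<in>Qspace A g \<xi> p. trans_spin_conn_Q A g \<xi> \<gamma> S a p Z \<psi> =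
          \<beta> *s cliff \<gamma> S a p (\<xi> p) (cliff \<gamma> S a p Z (\<psi> a p))))"

text \<open>The fibre of the eigenbundle \<open>\<Sigma>\<^sub>r M\<close> in the trivialization \<open>a\<close>, and the smooth sections.\<close>

definition Sigma_fibre ::
  "('a::topological_space, 'e::euclidean_space) atlas \<Rightarrow> 'a metric \<Rightarrow> 'a vfield \<Rightarrow>
   ('e \<Rightarrow> complex^'s^'s) \<Rightarrow> ('j, 'a, 'e, 's::finite) spin_data \<Rightarrow> nat \<Rightarrow> nat \<Rightarrow> 'j \<Rightarrow> 'a \<Rightarrow> (complex^'s) set"
  where "Sigma_fibre A g \<xi> \<gamma> S m r a p =
    {\<phi>. cliff2 \<gamma> S a p (flow_Omega A g \<xi> p) \<phi> = (\<i> * (2 * of_nat r - of_nat m)) *s \<phi>}"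

definition Sigma_sections ::
  "('a::topological_space, 'e::euclidean_space) atlas \<Rightarrow> 'a metric \<Rightarrow> 'a vfield \<Rightarrow>
   ('e \<Rightarrow> complex^'s^'s) \<Rightarrow> ('j, 'a, 'e, 's::finite) spin_data \<Rightarrow> nat \<Rightarrow> nat \<Rightarrow> ('j, 'a, 's) spinor set"
  where "Sigma_sections A g \<xi> \<gamma> S m r =
    {\<psi>. spinor_field A S \<psi> \<and> (\<forall>a. \<forall>p\<in>patch S a. \<psi> a p \<in> Sigma_fibre A g \<xi> \<gamma> S m r a p)}"

text \<open>The last conjunct is the normalization of Clifford multiplication. It selects one of the
  two inequivalent spinor representations in odd dimension, relative to the orientation of the
  frames.\<close>

definition spin_sasakian ::
  "('a::{t2_space,second_countable_topology}, 'e::euclidean_space) atlas \<Rightarrow> 'a metric \<Rightarrow> 'a vfield \<Rightarrow>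
   ('e \<Rightarrow> complex^'s^'s) \<Rightarrow> ('j, 'a, 'e, 's::finite) spin_data \<Rightarrow> nat \<Rightarrow> bool"
  where "spin_sasakian A g \<xi> \<gamma> S m \<longleftrightarrow>
    DIM('e) = 2 * m + 1 \<and> CARD('s) = 2 ^ m \<and>
    sasakian A g \<xi> \<and> clifford_rep \<gamma> \<and> spin_structure A g \<gamma> S \<and>
    (\<forall>r\<le>m. \<forall>a. \<forall>p\<in>patch S a. \<forall>\<phi>\<in>Sigma_fibre A g \<xi> \<gamma> S m r a p.
       \<i> *s cliff \<gamma> S a p (\<xi> p) \<phi> = (-1) ^ r *s \<phi>)"

section \<open>D-homothetic deformations\<close>

definition dhom_metric :: "'a metric \<Rightarrow> 'a vfield \<Rightarrow> real \<Rightarrow> 'a metric"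
  where "dhom_metric g \<xi> t p v w =
    t\<^sup>2 * (g p v (\<xi> p) * g p w (\<xi> p)) + t * g p (horiz g \<xi> p v) (horiz g \<xi> p w)"

definition dhom_field :: "'a vfield \<Rightarrow> real \<Rightarrow> 'a vfield"
  where "dhom_field \<xi> t p = (1 / t) *\<^sub>R \<xi> p"

text \<open>The isometry from \<open>(TM, g)\<close> onto \<open>(TM, dhom_metric g \<xi> t)\<close> with \<open>\<xi> \<mapsto> \<xi> / t\<close> and
  \<open>Z \<mapsto> Z / \<surd>t\<close> on \<open>Q\<close>. Composing the frames with it leaves their transition functions, hence the
  spin cocycle, unchanged.\<close>

definition dhom_isom :: "'a metric \<Rightarrow> 'a vfield \<Rightarrow> real \<Rightarrow> 'a \<Rightarrow> 'a tvec \<Rightarrow> 'a tvec"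
  where "dhom_isom g \<xi> t p v =
    g p v (\<xi> p) *\<^sub>R dhom_field \<xi> t p + (1 / sqrt t) *\<^sub>R horiz g \<xi> p v"

definition dhom_spin ::
  "'a metric \<Rightarrow> 'a vfield \<Rightarrow> real \<Rightarrow> ('j, 'a, 'e, 's::finite) spin_data \<Rightarrow> ('j, 'a, 'e, 's) spin_data"
  where "dhom_spin g \<xi> t S = S\<lparr>frame := \<lambda>a p x. dhom_isom g \<xi> t p (frame S a p x)\<rparr>"

text \<open>Since the cocycle is unchanged, the unitary isomorphism of the spinor bundles
  is the one which preserves the components with respect to corresponding frames. Its
  compatibility with Clifford multiplication is verified below.\<close>

definition dhom_spinor :: "real \<Rightarrow> ('j, 'a, 's) spinor \<Rightarrow> ('j, 'a, 's) spinor"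
  where "dhom_spinor t \<psi> = \<psi>"

lemma dhom_isom_xi:
  assumes "g p (\<xi> p) (\<xi> p) = 1"
  shows "dhom_isom g \<xi> t p (\<xi> p) = dhom_field \<xi> t p"
  using assms by (simp add: dhom_isom_def horiz_def)

lemma dhom_isom_Q:
  assumes "g p Z (\<xi> p) = 0"
  shows "dhom_isom g \<xi> t p Z = (1 / sqrt t) *\<^sub>R Z"
  using assms by (simp add: dhom_isom_def horiz_def)

context
  fixes A :: "('a::{t2_space,second_countable_topology}, 'e::euclidean_space) atlas"
    and g :: "'a metric" and \<xi> :: "'a vfield" and \<gamma> :: "'e \<Rightarrow> complex^'s^'s"
    and S :: "('j, 'a, 'e, 's::finite) spin_data" and t :: real and a :: 'j and p :: 'a
  assumes flow: "riemannian_flow A g \<xi>" and spin: "spin_structure A g \<gamma> S"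
    and t: "t > 0" and p: "p \<in> patch S a"
begin

lemma dhom_frame_isometry:
  "dhom_metric g \<xi> t p (frame (dhom_spin g \<xi> t S) a p x) (frame (dhom_spin g \<xi> t S) a p y) = x \<bullet> y"
proof -
  have lin: "linear (frame S a p)" and rg: "range (frame S a p) = tangent A p"
    and iso: "\<And>x y. g p (frame S a p x) (frame S a p y) = x \<bullet> y"
    using spin p by (auto simp: spin_structure_def)
  have "\<xi> p \<in> tangent A p" and unit: "g p (\<xi> p) (\<xi> p) = 1"
    using flow by (auto simp: riemannian_flow_def smooth_vf_def)
  then obtain z where z: "\<xi> p = frame S a p z" using rg by auto
  have zz: "z \<bullet> z = 1" using unit iso z by simp
  have b: "frame (dhom_spin g \<xi> t S) a p x =
      frame S a p (((x \<bullet> z) / t) *\<^sub>R z + (1 / sqrt t) *\<^sub>R (x - (x \<bullet> z) *\<^sub>R z))" for x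
    by (simp add: dhom_spin_def dhom_isom_def dhom_field_def horiz_def z iso
        linear_add[OF lin] linear_diff[OF lin] linear_scale[OF lin])
  have hz: "horiz g \<xi> p (frame S a p x) = frame S a p (x - (x \<bullet> z) *\<^sub>R z)" for x
    by (simp add: horiz_def z iso linear_diff[OF lin] linear_scale[OF lin])
  have s: "sqrt t * sqrt t = t" "t \<noteq> 0" "sqrt t \<noteq> 0" using t by auto
  have vert: "(((x \<bullet> z) / t) *\<^sub>R z + (1 / sqrt t) *\<^sub>R (x - (x \<bullet> z) *\<^sub>R z)) \<bullet> z = (x \<bullet> z) / t" for x
    using zz by (simp add: inner_add_left inner_diff_left)
  have hor: "(((x \<bullet> z) / t) *\<^sub>R z + (1 / sqrt t) *\<^sub>R (x - (x \<bullet> z) *\<^sub>R z)) - ((x \<bullet> z) / t) *\<^sub>R z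
      = (1 / sqrt t) *\<^sub>R (x - (x \<bullet> z) *\<^sub>R z)" for x by simp
  have "(x - (x \<bullet> z) *\<^sub>R z) \<bullet> (y - (y \<bullet> z) *\<^sub>R z) = x \<bullet> y - (x \<bullet> z) * (y \<bullet> z)"
    using zz by (simp add: inner_diff_left inner_diff_right inner_commute)
  moreover have "t * (((1 / sqrt t) *\<^sub>R u) \<bullet> ((1 / sqrt t) *\<^sub>R w)) = u \<bullet> w" for u w :: 'e
    using s by (simp add: field_simps)
  ultimately show ?thesis
    unfolding dhom_metric_def b hz unfolding z iso vert hor
    using s by (simp add: power2_eq_square)
qed

lemma dhom_cliff:
  assumes v: "v \<in> tangent A p"
  shows "cliff \<gamma> (dhom_spin g \<xi> t S) a p (dhom_isom g \<xi> t p v) \<phi> = cliff \<gamma> S a p v \<phi>"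
proof -
  have rg: "range (frame S a p) = tangent A p"
    and iso: "\<And>x y. g p (frame S a p x) (frame S a p y) = x \<bullet> y"
    using spin p by (auto simp: spin_structure_def)
  obtain x where x: "v = frame S a p x" using v rg by auto
  have "inj (frame S a p)"
    by (rule injI) (metis iso inner_commute vector_eq_rdot)
  moreover have "inj (frame (dhom_spin g \<xi> t S) a p)"
    by (rule injI) (metis dhom_frame_isometry inner_commute vector_eq_rdot)
  moreover have "dhom_isom g \<xi> t p v = frame (dhom_spin g \<xi> t S) a p x"
    by (simp add: dhom_spin_def x)
  ultimately show ?thesis by (simp add: cliff_def x)
qed

lemma dhom_spinor_cliff_xi:
  "cliff \<gamma> (dhom_spin g \<xi> t S) a p (dhom_field \<xi> t p) (dhom_spinor t \<psi> a p) =
   cliff \<gamma> S a p (\<xi> p) (\<psi> a p)"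
proof -
  have "\<xi> p \<in> tangent A p" "g p (\<xi> p) (\<xi> p) = 1"
    using flow by (auto simp: riemannian_flow_def smooth_vf_def)
  then show ?thesis using dhom_cliff[of "\<xi> p"] by (simp add: dhom_isom_xi dhom_spinor_def)
qed

lemma dhom_spinor_cliff_Q:
  assumes "Z \<in> Qspace A g \<xi> p"
  shows "cliff \<gamma> (dhom_spin g \<xi> t S) a p ((1 / sqrt t) *\<^sub>R Z) (dhom_spinor t \<psi> a p) =
    cliff \<gamma> S a p Z (\<psi> a p)"
  using assms dhom_cliff[of Z] by (simp add: dhom_isom_Q dhom_spinor_def Qspace_def)

end

end

theory Submission
  imports Defs
begin

text \<open>
  For the deformed metric \<open>\<nabla>\<close> changes by \<open>(t - 1) (\<eta>(X) h Y + \<eta>(Y) h X)\<close>, where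
  \<open>\<eta> = g(\<xi>, \<cdot>)\<close>, so the spin connection changes by
  \<open>(t - 1)/2 \<eta>(X) \<Omega>\<cdot> + (\<surd>t - 1)/2 \<xi>\<cdot>h X\<cdot>\<close>. On the two extreme eigenbundles
  \<open>\<Omega>\<cdot>\<psi> = -2 \<mu> m \<xi>\<cdot>\<psi>\<close> and \<open>\<xi>\<cdot>h Z\<cdot>\<psi> = 2 \<mu> Z\<cdot>\<psi>\<close> for \<open>Z \<in> Q\<close>, where \<open>\<mu>\<close> is the
  Killing number in question; the second identity holds because \<open>\<Omega>\<close> has no eigenvalue beyond
  \<open>\<plusminus>\<i> m\<close>. Hence \<open>\<psi>\<close> is \<open>\<mu>\<close>-Killing for the metric with parameter \<open>t\<close> if and only if it is
  \<open>(\<mu> t (m + 1), 0)\<close>-transversal Killing for \<open>g\<close>. This presupposes that a Levi-Civita connection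
  exists, which is obtained from the Koszul formula in the local orthonormal frames of the spin
  structure.
\<close>

section \<open>Smooth functions and derivations\<close>

text \<open>The factor m + 1 has two sources: the Killing equation in the direction \<xi>
  contributes \<mu>, and the correction - \<Omega>/2 in the transversal connection contributes \<mu>
  m. In a direction Z of Q the Killing term \<mu> Z and the correction - \<xi> h Z / 2 cancel.

  \<open>nabla\<close> is obtained by choice, so it is arbitrary until some Levi-Civita connection
  has been exhibited, and its values for the deformed metric can only be found by comparing it with
  an explicit connection. Existence and uniqueness are therefore both needed. Uniqueness is proved
  at a single point, where it also identifies the connections that come from overlapping frames.

  Tangent vectors are derivations of functions that need to be smooth only near the point.
  Identities between coefficient functions usually hold on a neighbourhood only, and they reach a
  tangent vector through the germ of the function.

  The eigenvalue that would contradict the identity for \<xi> h Z is excluded by an operator norm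
  estimate.\<close>

text \<open>On an open set the Frechet derivative depends only on the values there, so equality on
  \<open>W\<close> passes to derivatives of every order.\<close>

lemma Ck_on_cong:
  assumes "open W" "\<And>x. x \<in> W \<Longrightarrow> f x = g x" "Ck_on k W f"
  shows "Ck_on k W g"
  using assms(2,3)
proof (induction k arbitrary: f g)
  case 0
  then show ?case by (simp cong: continuous_on_cong)
next
  case (Suc k)
  have d: "f differentiable (at x)" if "x \<in> W" for x using Suc.prems(2) that by simp
  have g: "(g has_derivative frechet_derivative f (at x)) (at x)" if "x \<in> W" for x
    using d[OF that] Suc.prems(1) assms(1) that frechet_derivative_works
      has_derivative_transform_within_open by blast
  then have e: "frechet_derivative g (at x) = frechet_derivative f (at x)" if "x \<in> W" for x
    using that frechet_derivative_at by metis
  show ?case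
    using g Suc.IH[of "\<lambda>x. frechet_derivative f (at x) v" "\<lambda>x. frechet_derivative g (at x) v" for v]
      Suc.prems(2) e by (auto simp: differentiable_def)
qed

lemma Ck_on_subset: "Ck_on k W f \<Longrightarrow> V \<subseteq> W \<Longrightarrow> Ck_on k V f"
  by (induction k arbitrary: f) (auto intro: continuous_on_subset)

lemma Ck_on_Suc_imp: "Ck_on (Suc k) W f \<Longrightarrow> Ck_on k W f"
  by (induction k arbitrary: f)
    (auto simp: continuous_on_eq_continuous_at intro!: continuous_at_imp_continuous_on
      differentiable_imp_continuous_within)

lemma Ck_on_const: "Ck_on k W (\<lambda>x. c)"
  by (induction k arbitrary: c) auto

lemma Ck_on_add:
  assumes "open W" "Ck_on k W f" "Ck_on k W g"
  shows "Ck_on k W (\<lambda>x. f x + g x)"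
  using assms(2,3)
proof (induction k arbitrary: f g)
  case 0
  then show ?case by (auto intro: continuous_intros)
next
  case (Suc k)
  have e: "frechet_derivative (\<lambda>x. f x + g x) (at x) v =
      frechet_derivative f (at x) v + frechet_derivative g (at x) v" if "x \<in> W" for x v
  proof -
    have "(f has_derivative frechet_derivative f (at x)) (at x)"
      "(g has_derivative frechet_derivative g (at x)) (at x)"
      using Suc.prems that by (auto simp: frechet_derivative_works)
    from frechet_derivative_at[OF has_derivative_add[OF this]] show ?thesis
      by (simp add: fun_eq_iff)
  qed
  have "Ck_on k W (\<lambda>x. frechet_derivative f (at x) v + frechet_derivative g (at x) v)" for v
    using Suc by auto
  then have "Ck_on k W (\<lambda>x. frechet_derivative (\<lambda>x. f x + g x) (at x) v)" for v
    by (rule Ck_on_cong[OF assms(1), rotated]) (simp add: e)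
  then show ?case using Suc.prems by auto
qed

lemma Ck_on_mult:
  fixes f g :: "'e::euclidean_space \<Rightarrow> real"
  assumes "open W" "Ck_on k W f" "Ck_on k W g"
  shows "Ck_on k W (\<lambda>x. f x * g x)"
  using assms(2,3)
proof (induction k arbitrary: f g)
  case 0
  then show ?case by (auto intro: continuous_intros)
next
  case (Suc k)
  have e: "frechet_derivative (\<lambda>x. f x * g x) (at x) v =
      f x * frechet_derivative g (at x) v + frechet_derivative f (at x) v * g x" if "x \<in> W" for x v
  proof -
    have "(f has_derivative frechet_derivative f (at x)) (at x)"
      "(g has_derivative frechet_derivative g (at x)) (at x)"
      using Suc.prems that by (auto simp: frechet_derivative_works)
    from frechet_derivative_at[OF has_derivative_mult[OF this]] show ?thesis
      by (simp add: fun_eq_iff)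
  qed
  \<comment> \<open>The product rule pairs a derivative with an undifferentiated factor, so the
    induction hypothesis is also applied to the factors themselves, one order below what is assumed
    of them.\<close>
  have "Ck_on k W (\<lambda>x. f x * frechet_derivative g (at x) v + frechet_derivative f (at x) v * g x)" for v
    using Suc.prems Ck_on_Suc_imp[OF Suc.prems(1)] Ck_on_Suc_imp[OF Suc.prems(2)]
    by (intro Ck_on_add[OF assms(1)] Suc.IH) simp_all
  then have "Ck_on k W (\<lambda>x. frechet_derivative (\<lambda>x. f x * g x) (at x) v)" for v
    by (rule Ck_on_cong[OF assms(1), rotated]) (simp add: e)
  then show ?case using Suc.prems by auto
qed

lemma Ck_on_local:
  assumes "\<And>x. x \<in> W \<Longrightarrow> \<exists>V. open V \<and> x \<in> V \<and> Ck_on k V f"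
  shows "Ck_on k W f"
  using assms
proof (induction k arbitrary: f)
  case 0
  then show ?case
    by (metis Ck_on.simps(1) continuous_at_imp_continuous_on continuous_on_eq_continuous_at)
next
  case (Suc k)
  then show ?case unfolding Ck_on.simps by meson
qed

lemma sum_tvec_apply: "(\<Sum>i\<in>I. f i) x = (\<Sum>i\<in>I. f i x :: real)"
  by (induction I rule: infinite_finite_induct) auto

lemma scaleR_tvec_apply: "(c *\<^sub>R v) f = c * v f" for v :: "'a tvec"
  by (simp add: scaleR_fun_def)

section \<open>Smooth functions in charts\<close>

locale smooth_manifold =
  fixes A :: "('a::{t2_space,second_countable_topology}, 'e::euclidean_space) atlas"
  assumes atlas: "smooth_atlas A"
begin

text \<open>Smoothness on \<open>W\<close> is tested on the chart image of U \<inter> W, and the C^k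
  rules require an open domain there.\<close>

lemma open_chart_image:
  assumes "(U, \<phi>) \<in> A" "open W" shows "open (\<phi> ` (U \<inter> W))"
proof -
  have h: "open U" "open (\<phi> ` U)" "homeomorphism U (\<phi> ` U) \<phi> (inv_into U \<phi>)"
    using atlas assms(1) unfolding smooth_atlas_def by auto
  have "openin (top_of_set U) (U \<inter> W)" using assms(2) by (auto simp: openin_open)
  from homeomorphism_imp_open_map[OF h(3) this] show ?thesis
    using h(2) openin_open_eq by blast
qed

lemma chart_inv:
  assumes "(U, \<phi>) \<in> A" "q \<in> U" shows "inv_into U \<phi> (\<phi> q) = q"
proof -
  have "homeomorphism U (\<phi> ` U) \<phi> (inv_into U \<phi>)"
    using atlas assms(1) unfolding smooth_atlas_def by auto
  then show ?thesis using assms(2) homeomorphism_apply1 by metis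
qed

lemma smooth_fun_cong:
  assumes "open W" "\<And>x. x \<in> W \<Longrightarrow> f x = k x" "smooth_fun A W f"
  shows "smooth_fun A W k"
  unfolding smooth_fun_def Cinf_on_def
proof (clarify)
  fix U \<phi> n assume U: "(U, \<phi>) \<in> A"
  show "Ck_on n (\<phi> ` (U \<inter> W)) (k \<circ> inv_into U \<phi>)"
    by (rule Ck_on_cong[OF open_chart_image[OF U assms(1)], where f="f \<circ> inv_into U \<phi>"])
      (use assms U in \<open>auto simp: chart_inv[OF U] smooth_fun_def Cinf_on_def\<close>)
qed

lemma smooth_fun_subset: "smooth_fun A W f \<Longrightarrow> V \<subseteq> W \<Longrightarrow> smooth_fun A V f"
  unfolding smooth_fun_def Cinf_on_def by (fastforce intro: Ck_on_subset)

lemma smooth_fun_const: "smooth_fun A W (\<lambda>q. c)"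
  unfolding smooth_fun_def Cinf_on_def by (auto simp: o_def Ck_on_const)

lemma smooth_fun_add:
  assumes "open W" "smooth_fun A W f" "smooth_fun A W k"
  shows "smooth_fun A W (\<lambda>q. f q + k q)"
  using assms unfolding smooth_fun_def Cinf_on_def o_def
  by (auto intro!: Ck_on_add open_chart_image)

lemma smooth_fun_mult:
  assumes "open W" "smooth_fun A W f" "smooth_fun A W k"
  shows "smooth_fun A W (\<lambda>q. f q * k q)"
  using assms unfolding smooth_fun_def Cinf_on_def o_def
  by (auto intro!: Ck_on_mult open_chart_image)

lemma smooth_fun_diff:
  assumes "open W" "smooth_fun A W f" "smooth_fun A W k"
  shows "smooth_fun A W (\<lambda>q. f q - k q)"
  using smooth_fun_add[OF assms(1,2) smooth_fun_mult[OF assms(1) smooth_fun_const[of W "-1"] assms(3)]]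
  by simp

lemma smooth_fun_sum:
  assumes "open W" "\<And>i. i \<in> I \<Longrightarrow> smooth_fun A W (f i)"
  shows "smooth_fun A W (\<lambda>q. \<Sum>i\<in>I. f i q)"
  using assms(2)
proof (induction I rule: infinite_finite_induct)
  case (insert i I)
  then show ?case by (simp add: smooth_fun_add[OF assms(1)])
qed (simp_all add: smooth_fun_const)

text \<open>In each chart this is \<open>Ck_on_local\<close>. It permits a different frame around
  every point when the smoothness of a global object is checked.\<close>

lemma smooth_fun_local:
  assumes "\<And>p. p \<in> W \<Longrightarrow> \<exists>V. open V \<and> p \<in> V \<and> smooth_fun A V f"
  shows "smooth_fun A W f"
  unfolding smooth_fun_def Cinf_on_def
proof (clarify)
  fix U \<phi> n assume U: "(U, \<phi>) \<in> A"
  show "Ck_on n (\<phi> ` (U \<inter> W)) (f \<circ> inv_into U \<phi>)"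
  proof (rule Ck_on_local, clarify)
    fix q assume q: "q \<in> U" "q \<in> W"
    then obtain V where V: "open V" "q \<in> V" "smooth_fun A V f" using assms by blast
    show "\<exists>V. open V \<and> \<phi> q \<in> V \<and> Ck_on n V (f \<circ> inv_into U \<phi>)"
      by (rule exI[of _ "\<phi> ` (U \<inter> V)"])
        (use U V q in \<open>auto simp: smooth_fun_def Cinf_on_def intro: open_chart_image\<close>)
  qed
qed

section \<open>Functions smooth near a point, and tangent vectors as derivations\<close>

lemma smooth_nearI: "open W \<Longrightarrow> p \<in> W \<Longrightarrow> smooth_fun A W f \<Longrightarrow> smooth_near A p f"
  unfolding smooth_near_def by blast

lemma smooth_near_const: "smooth_near A p (\<lambda>q. c)"
  using smooth_fun_const smooth_nearI by blast

lemma smooth_near_add: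
  assumes "smooth_near A p f" "smooth_near A p k"
  shows "smooth_near A p (\<lambda>q. f q + k q)"
proof -
  obtain V W where "open V" "p \<in> V" "smooth_fun A V f" "open W" "p \<in> W" "smooth_fun A W k"
    using assms unfolding smooth_near_def by blast
  then show ?thesis
    by (intro smooth_nearI[of "V \<inter> W"] smooth_fun_add) (auto intro: smooth_fun_subset)
qed

lemma smooth_near_mult:
  assumes "smooth_near A p f" "smooth_near A p k"
  shows "smooth_near A p (\<lambda>q. f q * k q)"
proof -
  obtain V W where "open V" "p \<in> V" "smooth_fun A V f" "open W" "p \<in> W" "smooth_fun A W k"
    using assms unfolding smooth_near_def by blast
  then show ?thesis
    by (intro smooth_nearI[of "V \<inter> W"] smooth_fun_mult) (auto intro: smooth_fun_subset)
qed

lemma smooth_near_sum: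
  assumes "\<And>i. i \<in> I \<Longrightarrow> smooth_near A p (f i)"
  shows "smooth_near A p (\<lambda>q. \<Sum>i\<in>I. f i q)"
  using assms
  by (induction I rule: infinite_finite_induct) (simp_all add: smooth_near_add smooth_near_const)

lemma smooth_near_cong:
  assumes "open W" "p \<in> W" "\<And>q. q \<in> W \<Longrightarrow> f q = k q" "smooth_near A p f"
  shows "smooth_near A p k"
proof -
  obtain V where "open V" "p \<in> V" "smooth_fun A V f"
    using assms(4) unfolding smooth_near_def by blast
  with assms show ?thesis
    by (intro smooth_nearI[of "V \<inter> W"] smooth_fun_cong[of "V \<inter> W" f k])
      (auto intro: smooth_fun_subset)
qed

lemma tangent_add: "v \<in> tangent A p \<Longrightarrow> smooth_near A p f \<Longrightarrow> smooth_near A p k \<Longrightarrow>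
    v (\<lambda>q. f q + k q) = v f + v k"
  and tangent_cmul: "v \<in> tangent A p \<Longrightarrow> smooth_near A p f \<Longrightarrow> v (\<lambda>q. c * f q) = c * v f"
  and tangent_mult: "v \<in> tangent A p \<Longrightarrow> smooth_near A p f \<Longrightarrow> smooth_near A p k \<Longrightarrow>
    v (\<lambda>q. f q * k q) = v f * k p + f p * v k"
  and tangent_nonsmooth: "v \<in> tangent A p \<Longrightarrow> \<not> smooth_near A p f \<Longrightarrow> v f = 0"
  unfolding tangent_def by blast+

text \<open>The indicator is idempotent and equals 1 at \<open>p\<close>, so the Leibniz rule says
  that its derivative is twice itself.\<close>

lemma tangent_indicator:
  assumes "v \<in> tangent A p" "open W" "p \<in> W"
  shows "smooth_near A p (indicator W)" "v (indicator W) = 0"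
proof -
  show s: "smooth_near A p (indicator W)"
    by (rule smooth_near_cong[OF assms(2,3) _ smooth_near_const[of p 1]]) simp
  have "v (\<lambda>q. indicator W q * indicator W q) = v (indicator W) * 1 + 1 * v (indicator W)"
    using tangent_mult[OF assms(1) s s] assms(3) by simp
  moreover have "(\<lambda>q. indicator W q * indicator W q) = (indicator W :: 'a \<Rightarrow> real)"
    by (auto simp: indicator_def)
  ultimately show "v (indicator W) = 0" by simp
qed

text \<open>The indicator function of an open set replaces a bump function: smoothness near a point says
  nothing about the values away from it.\<close>

lemma tangent_germ:
  assumes "v \<in> tangent A p" "open W" "p \<in> W" "\<And>q. q \<in> W \<Longrightarrow> f q = k q"
  shows "v f = v k"
proof (cases "smooth_near A p f")
  case True
  have k: "smooth_near A p k" using smooth_near_cong[OF assms(2-4) True] .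
  have "v (\<lambda>q. indicator W q * f q) = v f" "v (\<lambda>q. indicator W q * k q) = v k"
    using tangent_mult[OF assms(1) tangent_indicator(1)[OF assms(1-3)]] True k
      tangent_indicator(2)[OF assms(1-3)] assms(3) by simp_all
  moreover have "(\<lambda>q. indicator W q * f q) = (\<lambda>q. indicator W q * k q)"
    using assms(4) by (auto simp: indicator_def)
  ultimately show ?thesis by simp
next
  case False
  then have "\<not> smooth_near A p k" using smooth_near_cong[OF assms(2,3)] assms(4) by metis
  with False show ?thesis using tangent_nonsmooth[OF assms(1)] by simp
qed

lemma tangent_const: assumes "v \<in> tangent A p" shows "v (\<lambda>q. c) = 0"
proof -
  have "v (\<lambda>q. 1) = 0"
    using tangent_indicator(2)[OF assms open_UNIV] by (simp add: indicator_def[abs_def])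
  then show ?thesis using tangent_cmul[OF assms smooth_near_const[of p 1], of c] by simp
qed

lemma tangent_sum:
  assumes "v \<in> tangent A p" "\<And>i. i \<in> I \<Longrightarrow> smooth_near A p (f i)"
  shows "v (\<lambda>q. \<Sum>i\<in>I. f i q) = (\<Sum>i\<in>I. v (f i))"
  using assms(2)
proof (induction I rule: infinite_finite_induct)
  case (insert i I)
  then show ?case
    by (simp add: tangent_add[OF assms(1)] smooth_near_sum)
qed (simp_all add: tangent_const[OF assms(1)])

lemma tangent_plus_closed: "v \<in> tangent A p \<Longrightarrow> w \<in> tangent A p \<Longrightarrow> v + w \<in> tangent A p"
  unfolding tangent_def by (auto simp: algebra_simps)

lemma tangent_scale_closed: "v \<in> tangent A p \<Longrightarrow> c *\<^sub>R v \<in> tangent A p"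
  unfolding tangent_def by (auto simp: algebra_simps scaleR_fun_def)

lemma tangent_zero: "0 \<in> tangent A p"
  unfolding tangent_def by auto

lemma subspace_tangent: "subspace (tangent A p)"
  unfolding subspace_def using tangent_zero tangent_plus_closed tangent_scale_closed by blast

lemma tangent_minus_closed: "v \<in> tangent A p \<Longrightarrow> w \<in> tangent A p \<Longrightarrow> v - w \<in> tangent A p"
  using subspace_diff[OF subspace_tangent] .

lemma tangent_sum_closed: "(\<And>i. i \<in> I \<Longrightarrow> f i \<in> tangent A p) \<Longrightarrow> sum f I \<in> tangent A p"
  using subspace_sum[OF subspace_tangent] .

section \<open>Smooth vector fields\<close>

lemma smooth_vf_tangent: "smooth_vf A W X \<Longrightarrow> p \<in> W \<Longrightarrow> X p \<in> tangent A p"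
  unfolding smooth_vf_def by blast

lemma smooth_vf_fun: "smooth_vf A W X \<Longrightarrow> open V \<Longrightarrow> V \<subseteq> W \<Longrightarrow> smooth_fun A V f \<Longrightarrow>
    smooth_fun A V (\<lambda>p. X p f)"
  unfolding smooth_vf_def by blast

lemma smooth_vf_subset: "smooth_vf A W X \<Longrightarrow> V \<subseteq> W \<Longrightarrow> smooth_vf A V X"
  unfolding smooth_vf_def by (meson order_trans subsetD)

lemma smooth_vf_near:
  assumes "smooth_vf A W X" "open W" "p \<in> W" "smooth_near A p f"
  shows "smooth_near A p (\<lambda>q. X q f)"
proof -
  obtain V where V: "open V" "p \<in> V" "smooth_fun A V f"
    using assms(4) unfolding smooth_near_def by blast
  have "smooth_fun A (V \<inter> W) (\<lambda>q. X q f)"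
    by (rule smooth_vf_fun[OF assms(1) open_Int[OF V(1) assms(2)] Int_lower2
        smooth_fun_subset[OF V(3) Int_lower1]])
  from smooth_nearI[OF open_Int[OF V(1) assms(2)] IntI[OF V(2) assms(3)] this] show ?thesis .
qed

lemma smooth_vf_add:
  assumes "smooth_vf A W X" "smooth_vf A W Y"
  shows "smooth_vf A W (\<lambda>q. X q + Y q)"
proof (unfold smooth_vf_def, intro conjI ballI allI impI)
  fix p assume "p \<in> W"
  then show "X p + Y p \<in> tangent A p"
    by (intro tangent_plus_closed smooth_vf_tangent[OF assms(1)] smooth_vf_tangent[OF assms(2)])
next
  fix V f assume V: "open V" "V \<subseteq> W" "smooth_fun A V f"
  from smooth_fun_add[OF V(1) smooth_vf_fun[OF assms(1) V] smooth_vf_fun[OF assms(2) V]]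
  show "smooth_fun A V (\<lambda>p. (X p + Y p) f)" by simp
qed

lemma smooth_vf_scale:
  assumes "smooth_fun A W f" "smooth_vf A W Y"
  shows "smooth_vf A W (\<lambda>q. f q *\<^sub>R Y q)"
proof (unfold smooth_vf_def, intro conjI ballI allI impI)
  fix p assume "p \<in> W"
  then show "f p *\<^sub>R Y p \<in> tangent A p"
    by (intro tangent_scale_closed smooth_vf_tangent[OF assms(2)])
next
  fix V k assume V: "open V" "V \<subseteq> W" "smooth_fun A V k"
  from smooth_fun_mult[OF V(1) smooth_fun_subset[OF assms(1) V(2)] smooth_vf_fun[OF assms(2) V]]
  show "smooth_fun A V (\<lambda>p. (f p *\<^sub>R Y p) k)" by (simp add: scaleR_fun_def)
qed

lemma smooth_vf_diff:
  assumes "smooth_vf A W X" "smooth_vf A W Y"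
  shows "smooth_vf A W (\<lambda>q. X q - Y q)"
  using smooth_vf_add[OF assms(1) smooth_vf_scale[OF smooth_fun_const[of W "-1"] assms(2)]] by simp

lemma smooth_vf_zero: "smooth_vf A W (\<lambda>q. 0)"
  unfolding smooth_vf_def by (simp add: tangent_zero smooth_fun_const)

lemma smooth_vf_sum:
  assumes "\<And>i. i \<in> I \<Longrightarrow> smooth_vf A W (f i)"
  shows "smooth_vf A W (\<lambda>q. \<Sum>i\<in>I. f i q)"
  using assms
  by (induction I rule: infinite_finite_induct) (simp_all add: smooth_vf_add smooth_vf_zero)

lemma smooth_vf_cong:
  assumes "smooth_vf A W X" "\<And>q. q \<in> W \<Longrightarrow> X q = Y q"
  shows "smooth_vf A W Y"
  unfolding smooth_vf_def
proof (intro conjI ballI allI impI)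
  fix p assume "p \<in> W"
  then show "Y p \<in> tangent A p" using smooth_vf_tangent[OF assms(1)] assms(2) by metis
next
  fix V f assume V: "open V" "V \<subseteq> W" "smooth_fun A V f"
  show "smooth_fun A V (\<lambda>p. Y p f)"
    by (rule smooth_fun_cong[OF V(1) _ smooth_vf_fun[OF assms(1) V]]) (use V assms(2) in auto)
qed

lemma smooth_vf_local:
  assumes "\<And>p. p \<in> W \<Longrightarrow> \<exists>V. open V \<and> p \<in> V \<and> smooth_vf A V X"
  shows "smooth_vf A W X"
  unfolding smooth_vf_def
proof (intro conjI ballI allI impI)
  fix p assume "p \<in> W"
  then show "X p \<in> tangent A p" using assms smooth_vf_tangent by blast
next
  fix V f assume V: "open V" "V \<subseteq> W" "smooth_fun A V f"
  show "smooth_fun A V (\<lambda>p. X p f)"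
  proof (rule smooth_fun_local)
    fix p assume "p \<in> V"
    with assms V obtain U where U: "open U" "p \<in> U" "smooth_vf A U X" by blast
    have "smooth_fun A (V \<inter> U) (\<lambda>p. X p f)"
      by (rule smooth_vf_fun[OF U(3) open_Int[OF V(1) U(1)] Int_lower2
          smooth_fun_subset[OF V(3) Int_lower1]])
    with open_Int[OF V(1) U(1)] IntI[OF \<open>p \<in> V\<close> U(2)]
    show "\<exists>V. open V \<and> p \<in> V \<and> smooth_fun A V (\<lambda>p. X p f)" by blast
  qed
qed

section \<open>The Lie bracket of smooth vector fields\<close>

text \<open>Applied to a product f k, the iterated derivative X Y fails to be a derivation by the
  mixed terms X f * Y k and Y f * X k. Their sum is symmetric in X and Y and drops out of the
  commutator.\<close>

lemma lie_bracket_tangent: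
  assumes "open W" "p \<in> W" "smooth_vf A W X" "smooth_vf A W Y"
  shows "lie_bracket A X Y p \<in> tangent A p"
proof -
  note t = smooth_vf_tangent[OF assms(3)] smooth_vf_tangent[OF assms(4)]
  note n = smooth_vf_near[OF assms(3,1)] smooth_vf_near[OF assms(4,1)]
  \<comment> \<open>Smoothness near a point is an open condition, so the inner field obeys the
    derivation rules at all points of a neighbourhood and not only at \<open>p\<close>.\<close>
  have near_W: "\<exists>U. open U \<and> p \<in> U \<and> U \<subseteq> W \<and> (\<forall>q\<in>U. smooth_near A q f)"
    if f: "smooth_near A p f" for f
  proof -
    obtain V where V: "open V" "p \<in> V" "smooth_fun A V f"
      using f unfolding smooth_near_def by blast
    show ?thesis
      by (rule exI[of _ "V \<inter> W"]) (use V assms(1,2) in \<open>auto simp: smooth_near_def\<close>)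
  qed
  have *: "R p (\<lambda>q. T q (\<lambda>r. f r + k r)) = R p (\<lambda>q. T q f) + R p (\<lambda>q. T q k)"
      "R p (\<lambda>q. T q (\<lambda>r. c * f r)) = c * R p (\<lambda>q. T q f)"
      "R p (\<lambda>q. T q (\<lambda>r. f r * k r)) = R p (\<lambda>q. T q f) * k p + T p f * R p k
         + R p f * T p k + f p * R p (\<lambda>q. T q k)"
    if R: "smooth_vf A W R" and T: "smooth_vf A W T" and f: "smooth_near A p f"
      and k: "smooth_near A p k" for R T f k c
  proof -
    have Rp: "R p \<in> tangent A p" and Tq: "\<And>q. q \<in> W \<Longrightarrow> T q \<in> tangent A q"
      using R T assms(2) smooth_vf_tangent by blast+
    have s: "smooth_near A p (\<lambda>q. T q f)" "smooth_near A p (\<lambda>q. T q k)"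
      using smooth_vf_near[OF T assms(1,2)] f k by blast+
    obtain U1 U2 where U1: "open U1" "p \<in> U1" "U1 \<subseteq> W" "\<forall>q\<in>U1. smooth_near A q f"
      and U2: "open U2" "p \<in> U2" "U2 \<subseteq> W" "\<forall>q\<in>U2. smooth_near A q k"
      using near_W f k by meson
    have U: "open (U1 \<inter> U2)" "p \<in> U1 \<inter> U2" "U1 \<inter> U2 \<subseteq> W" using U1 U2 by auto
    \<comment> \<open>\<open>R p\<close> depends on germs only, so it suffices to apply the rules
      for \<open>T q\<close> at the points of U1 \<inter> U2.\<close>
    have "R p (\<lambda>q. T q (\<lambda>r. f r + k r)) = R p (\<lambda>q. T q f + T q k)"
      by (rule tangent_germ[OF Rp U(1,2)]) (use U1 U2 in \<open>auto intro!: tangent_add[of _ p for p] Tq\<close>)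
    then show "R p (\<lambda>q. T q (\<lambda>r. f r + k r)) = R p (\<lambda>q. T q f) + R p (\<lambda>q. T q k)"
      using tangent_add[OF Rp s] by simp
    have "R p (\<lambda>q. T q (\<lambda>r. c * f r)) = R p (\<lambda>q. c * T q f)"
      by (rule tangent_germ[OF Rp U(1,2)]) (use U1 U2 in \<open>auto intro!: tangent_cmul[of _ p for p] Tq\<close>)
    then show "R p (\<lambda>q. T q (\<lambda>r. c * f r)) = c * R p (\<lambda>q. T q f)"
      using tangent_cmul[OF Rp s(1)] by simp
    have "R p (\<lambda>q. T q (\<lambda>r. f r * k r)) = R p (\<lambda>q. T q f * k q + f q * T q k)"
      by (rule tangent_germ[OF Rp U(1,2)]) (use U1 U2 in \<open>auto intro!: tangent_mult[of _ p for p] Tq\<close>)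
    then show "R p (\<lambda>q. T q (\<lambda>r. f r * k r)) = R p (\<lambda>q. T q f) * k p + T p f * R p k
         + R p f * T p k + f p * R p (\<lambda>q. T q k)"
      using f k s by (simp add: tangent_add[OF Rp] smooth_near_mult tangent_mult[OF Rp])
  qed
  show ?thesis
    unfolding tangent_def lie_bracket_def
  proof (intro CollectI conjI allI impI)
    fix f k c assume f: "smooth_near A p f" and k: "smooth_near A p k"
    note XY = *[OF assms(3,4) f k] and YX = *[OF assms(4,3) f k]
    have fk: "smooth_near A p (\<lambda>q. f q + k q)" "smooth_near A p (\<lambda>q. c * f q)"
      "smooth_near A p (\<lambda>q. f q * k q)"
      using f k by (simp_all add: smooth_near_add smooth_near_mult smooth_near_const)
    show "(if smooth_near A p (\<lambda>q. f q + k q)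
        then X p (\<lambda>q. Y q (\<lambda>q. f q + k q)) - Y p (\<lambda>q. X q (\<lambda>q. f q + k q)) else 0) =
       (if smooth_near A p f then X p (\<lambda>q. Y q f) - Y p (\<lambda>q. X q f) else 0) +
       (if smooth_near A p k then X p (\<lambda>q. Y q k) - Y p (\<lambda>q. X q k) else 0)"
      "(if smooth_near A p (\<lambda>q. c * f q)
        then X p (\<lambda>q. Y q (\<lambda>q. c * f q)) - Y p (\<lambda>q. X q (\<lambda>q. c * f q)) else 0) =
       c * (if smooth_near A p f then X p (\<lambda>q. Y q f) - Y p (\<lambda>q. X q f) else 0)"
      "(if smooth_near A p (\<lambda>q. f q * k q)
        then X p (\<lambda>q. Y q (\<lambda>q. f q * k q)) - Y p (\<lambda>q. X q (\<lambda>q. f q * k q)) else 0) =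
       (if smooth_near A p f then X p (\<lambda>q. Y q f) - Y p (\<lambda>q. X q f) else 0) * k p +
       f p * (if smooth_near A p k then X p (\<lambda>q. Y q k) - Y p (\<lambda>q. X q k) else 0)"
      using fk f k XY YX by (simp_all add: algebra_simps)
  qed simp
qed

lemma lie_bracket_smooth:
  assumes "open W" "smooth_vf A W X" "smooth_vf A W Y"
  shows "smooth_vf A W (lie_bracket A X Y)"
  unfolding smooth_vf_def
proof (intro conjI ballI allI impI)
  fix p assume "p \<in> W"
  then show "lie_bracket A X Y p \<in> tangent A p" using assms by (intro lie_bracket_tangent)
next
  fix V f assume V: "open V" "V \<subseteq> W" "smooth_fun A V f"
  have "smooth_fun A V (\<lambda>p. X p (\<lambda>q. Y q f) - Y p (\<lambda>q. X q f))"
    by (rule smooth_fun_diff[OF V(1) smooth_vf_fun[OF assms(2) V(1,2) smooth_vf_fun[OF assms(3) V]]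
        smooth_vf_fun[OF assms(3) V(1,2) smooth_vf_fun[OF assms(2) V]]])
  \<comment> \<open>At points of \<open>V\<close> the test function is smooth near the point, so the
    default value 0 in \<open>lie_bracket\<close> does not occur.\<close>
  then show "smooth_fun A V (\<lambda>p. lie_bracket A X Y p f)"
    by (rule smooth_fun_cong[OF V(1), rotated])
      (use V in \<open>auto simp: lie_bracket_def smooth_near_def\<close>)
qed

lemma lie_bracket_minus: "lie_bracket A Y X p = - lie_bracket A X Y p"
  by (auto simp: lie_bracket_def fun_eq_iff)

end

section \<open>The Levi-Civita connection\<close>

text \<open>What one patch of a spin structure supplies once the spinors are forgotten.\<close>

definition orthonormal_frame ::
  "('a::topological_space, 'e::euclidean_space) atlas \<Rightarrow> 'a metric \<Rightarrow> 'a set \<Rightarrow> ('a \<Rightarrow> 'e \<Rightarrow> 'a tvec) \<Rightarrow> bool"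
  where "orthonormal_frame A g P e \<longleftrightarrow>
    open P \<and> (\<forall>x. smooth_vf A P (\<lambda>p. e p x)) \<and>
    (\<forall>p\<in>P. linear (e p) \<and> range (e p) = tangent A p \<and> (\<forall>x y. g p (e p x) (e p y) = x \<bullet> y))"

text \<open>The axioms at one point, without smooth dependence on that point. In this form a
  connection can be built and compared inside a single frame, before anything is glued.\<close>

definition levi_civita_at ::
  "('a::topological_space, 'e::euclidean_space) atlas \<Rightarrow> 'a metric \<Rightarrow> 'a \<Rightarrow>
   ('a tvec \<Rightarrow> 'a vfield \<Rightarrow> 'a tvec) \<Rightarrow> bool"
  where "levi_civita_at A g p D \<longleftrightarrow>
    (\<forall>W X Y Z f. open W \<longrightarrow> p \<in> W \<longrightarrow> smooth_vf A W X \<longrightarrow> smooth_vf A W Y \<longrightarrow> smooth_vf A W Z \<longrightarrow>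
       smooth_fun A W f \<longrightarrow>
       D (X p) Y - D (Y p) X = lie_bracket A X Y p \<and>
       (\<forall>v\<in>tangent A p. \<forall>w\<in>tangent A p. \<forall>c.
          D v Y \<in> tangent A p \<and>
          D (v + w) Y = D v Y + D w Y \<and>
          D (c *\<^sub>R v) Y = c *\<^sub>R D v Y \<and>
          D v (\<lambda>q. Y q + Z q) = D v Y + D v Z \<and>
          D v (\<lambda>q. f q *\<^sub>R Y q) = v f *\<^sub>R Y p + f p *\<^sub>R D v Y \<and>
          v (\<lambda>q. g q (Y q) (Z q)) = g p (D v Y) (Z p) + g p (Y p) (D v Z)))"

context smooth_manifold
begin

lemma levi_civita_iff:
  "levi_civita A g D \<longleftrightarrow> (\<forall>p. levi_civita_at A g p (D p)) \<and>
    (\<forall>W X Y. open W \<longrightarrow> smooth_vf A W X \<longrightarrow> smooth_vf A W Y \<longrightarrow> smooth_vf A W (\<lambda>p. D p (X p) Y))"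
proof
  assume L: "levi_civita A g D"
  show "(\<forall>p. levi_civita_at A g p (D p)) \<and>
    (\<forall>W X Y. open W \<longrightarrow> smooth_vf A W X \<longrightarrow> smooth_vf A W Y \<longrightarrow> smooth_vf A W (\<lambda>p. D p (X p) Y))"
  proof (intro conjI allI impI)
    fix p show "levi_civita_at A g p (D p)"
      using L unfolding levi_civita_def levi_civita_at_def by meson
  next
    fix W X Y assume "open W" "smooth_vf A W X" "smooth_vf A W Y"
    \<comment> \<open>\<open>levi_civita\<close> quantifies over a scalar function as well; the zero
      function serves as a placeholder.\<close>
    then show "smooth_vf A W (\<lambda>p. D p (X p) Y)"
      using L smooth_fun_const[of W 0] unfolding levi_civita_def by meson
  qed
next
  assume R: "(\<forall>p. levi_civita_at A g p (D p)) \<and>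
    (\<forall>W X Y. open W \<longrightarrow> smooth_vf A W X \<longrightarrow> smooth_vf A W Y \<longrightarrow> smooth_vf A W (\<lambda>p. D p (X p) Y))"
  then show "levi_civita A g D"
    unfolding levi_civita_def levi_civita_at_def by meson
qed

lemma levi_civita_at_bracket:
  assumes "levi_civita_at A g p D" "open W" "p \<in> W" "smooth_vf A W X" "smooth_vf A W Y"
  shows "D (X p) Y - D (Y p) X = lie_bracket A X Y p"
  using assms smooth_fun_const[of W 0] unfolding levi_civita_at_def by blast

lemma
  assumes "levi_civita_at A g p D" "open W" "p \<in> W" "smooth_vf A W Y" "v \<in> tangent A p"
  shows levi_civita_at_tangent: "D v Y \<in> tangent A p"
    and levi_civita_at_add: "w \<in> tangent A p \<Longrightarrow> D (v + w) Y = D v Y + D w Y"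
    and levi_civita_at_scale: "D (c *\<^sub>R v) Y = c *\<^sub>R D v Y"
    and levi_civita_at_add_field: "smooth_vf A W Z \<Longrightarrow> D v (\<lambda>q. Y q + Z q) = D v Y + D v Z"
    and levi_civita_at_Leibniz: "smooth_fun A W f \<Longrightarrow>
      D v (\<lambda>q. f q *\<^sub>R Y q) = v f *\<^sub>R Y p + f p *\<^sub>R D v Y"
    and levi_civita_at_metric: "smooth_vf A W Z \<Longrightarrow>
      v (\<lambda>q. g q (Y q) (Z q)) = g p (D v Y) (Z p) + g p (Y p) (D v Z)"
proof -
  note L = assms(1)[unfolded levi_civita_at_def, rule_format, OF assms(2,3,4,4) _ _ ,
      THEN conjunct2, rule_format, OF _ _ assms(5)]
  note L1 = L[OF assms(4) smooth_fun_const[of W 0] assms(5)]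
  show "D v Y \<in> tangent A p" "D (c *\<^sub>R v) Y = c *\<^sub>R D v Y"
    by (simp_all add: L1)
  show "D (v + w) Y = D v Y + D w Y" if "w \<in> tangent A p"
    by (simp add: L[OF assms(4) smooth_fun_const[of W 0] that])
  show "D v (\<lambda>q. Y q + Z q) = D v Y + D v Z"
    "v (\<lambda>q. g q (Y q) (Z q)) = g p (D v Y) (Z p) + g p (Y p) (D v Z)" if "smooth_vf A W Z"
    using L[OF that smooth_fun_const[of W 0] assms(5)] by simp_all
  show "D v (\<lambda>q. f q *\<^sub>R Y q) = v f *\<^sub>R Y p + f p *\<^sub>R D v Y" if "smooth_fun A W f"
    using L[OF assms(4) that assms(5)] by simp
qed

end

section \<open>Algebra of the metric and uniqueness of the connection\<close>

locale riemannian_manifold = smooth_manifold A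
  for A :: "('a::{t2_space,second_countable_topology}, 'e::euclidean_space) atlas" +
  fixes g :: "'a metric"
  assumes riem: "riemannian_metric A g"
begin

lemma
  assumes "u \<in> tangent A p" "v \<in> tangent A p"
  shows g_sym: "g p u v = g p v u"
    and g_scale_left: "g p (c *\<^sub>R u) v = c * g p u v"
    and g_add_left: "w \<in> tangent A p \<Longrightarrow> g p (u + w) v = g p u v + g p w v"
proof -
  note R = conjunct1[OF riem[unfolded riemannian_metric_def], rule_format]
  show "g p u v = g p v u" "g p (c *\<^sub>R u) v = c * g p u v"
    using R[OF assms assms(2)] R[OF assms(1,1,2)] by blast+
  show "g p (u + w) v = g p u v + g p w v" if "w \<in> tangent A p"
    using R[OF assms(1) that assms(2)] by blast
qed

lemma
  assumes "u \<in> tangent A p" "v \<in> tangent A p"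
  shows g_scale_right: "g p u (c *\<^sub>R v) = c * g p u v"
    and g_add_right: "w \<in> tangent A p \<Longrightarrow> g p u (v + w) = g p u v + g p u w"
    and g_diff_left: "w \<in> tangent A p \<Longrightarrow> g p (u - w) v = g p u v - g p w v"
    and g_diff_right: "w \<in> tangent A p \<Longrightarrow> g p u (v - w) = g p u v - g p u w"
proof -
  show c: "g p u (c *\<^sub>R v) = c * g p u v" for c
    using assms g_sym[of u p] g_scale_left tangent_scale_closed by metis
  show a: "w \<in> tangent A p \<Longrightarrow> g p u (v + w) = g p u v + g p u w"
    using assms g_sym[of u p] g_add_left tangent_plus_closed by metis
  show "w \<in> tangent A p \<Longrightarrow> g p (u - w) v = g p u v - g p w v"
    using assms g_add_left[of u p v "(-1) *\<^sub>R w"] g_scale_left[of w p v "-1"]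
      tangent_scale_closed[of w p "-1"] by simp
  show "w \<in> tangent A p \<Longrightarrow> g p u (v - w) = g p u v - g p u w"
    using assms g_add_left[of v p u "(-1) *\<^sub>R w"] g_scale_left[of w p u "-1"]
      tangent_scale_closed[of w p "-1"] g_sym[of u p] tangent_minus_closed by simp
qed

lemma g_zero_left: "v \<in> tangent A p \<Longrightarrow> g p 0 v = 0"
  using g_scale_left[of v p v 0] by simp

lemma g_sum_left:
  assumes "\<And>i. i \<in> I \<Longrightarrow> f i \<in> tangent A p" "v \<in> tangent A p"
  shows "g p (\<Sum>i\<in>I. f i) v = (\<Sum>i\<in>I. g p (f i) v)"
  using assms(1)
  by (induction I rule: infinite_finite_induct)
    (simp_all add: g_zero_left[OF assms(2)] g_add_left[OF _ assms(2)] tangent_sum_closed)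

lemma g_eqI:
  assumes "u \<in> tangent A p" "v \<in> tangent A p" "\<And>w. w \<in> tangent A p \<Longrightarrow> g p u w = g p v w"
  shows "u = v"
proof -
  have t: "u - v \<in> tangent A p" using assms(1,2) by (rule tangent_minus_closed)
  have "g p (u - v) (u - v) = 0"
    using g_diff_left[OF assms(1) t assms(2)] assms(3)[OF t] by simp
  then show ?thesis
    using t riem unfolding riemannian_metric_def by fastforce
qed

lemma g_smooth:
  assumes "open W" "smooth_vf A W X" "smooth_vf A W Y"
  shows "smooth_fun A W (\<lambda>q. g q (X q) (Y q))"
  using riem assms unfolding riemannian_metric_def by blast

text \<open>The difference \<open>b\<close> of two Levi-Civita connections is symmetric in its first two arguments and
  skew in its last two, hence zero.\<close>

lemma levi_civita_at_unique:
  assumes ext: "\<And>v. v \<in> tangent A p \<Longrightarrow> \<exists>P X. open P \<and> p \<in> P \<and> smooth_vf A P X \<and> X p = v"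
    and D: "levi_civita_at A g p D" and D': "levi_civita_at A g p D'"
    and W: "open W" "p \<in> W" "smooth_vf A W Y" and v: "v \<in> tangent A p"
  shows "D v Y = D' v Y"
proof (rule g_eqI[of _ p])
  show "D v Y \<in> tangent A p" "D' v Y \<in> tangent A p"
    using levi_civita_at_tangent[OF D W v] levi_civita_at_tangent[OF D' W v] .
next
  fix w assume w: "w \<in> tangent A p"
  \<comment> \<open>The symmetry exchanges the direction with the differentiated field, so the
    vectors \<open>v\<close> and \<open>w\<close> first have to be extended to fields.\<close>
  obtain P X where P: "open P" "p \<in> P" "smooth_vf A P X" "X p = v" using ext v by blast
  obtain R Z where R: "open R" "p \<in> R" "smooth_vf A R Z" "Z p = w" using ext w by blast
  define V where "V = W \<inter> P \<inter> R"
  have V: "open V" "p \<in> V" "V \<subseteq> W" "V \<subseteq> P" "V \<subseteq> R" using W P R by (auto simp: V_def)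
  have X: "smooth_vf A V X" and Y: "smooth_vf A V Y" and Z: "smooth_vf A V Z"
    using smooth_vf_subset V W P R by blast+
  define b where "b = (\<lambda>F G H. g p (D (F p) G - D' (F p) G) (H p))"
  have 1: "b F G H = b G F H" and 2: "b F G H = - b F H G"
    if s: "smooth_vf A V F" "smooth_vf A V G" "smooth_vf A V H" for F G H
  proof -
    have tp: "F p \<in> tangent A p" "G p \<in> tangent A p" "H p \<in> tangent A p"
      using s V(2) smooth_vf_tangent by blast+
    note t = tp levi_civita_at_tangent[OF D V(1,2)] levi_civita_at_tangent[OF D' V(1,2)]
    have "D (F p) G - D (G p) F = D' (F p) G - D' (G p) F"
      using levi_civita_at_bracket[OF D V(1,2) s(1,2)] levi_civita_at_bracket[OF D' V(1,2) s(1,2)]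
      by simp
    then have "D (F p) G - D' (F p) G = D (G p) F - D' (G p) F" by (simp add: algebra_simps)
    then show "b F G H = b G F H" by (simp add: b_def)
    have "g p (D (F p) G) (H p) + g p (G p) (D (F p) H) =
        g p (D' (F p) G) (H p) + g p (G p) (D' (F p) H)"
      using levi_civita_at_metric[OF D V(1,2) s(2) tp(1) s(3)]
        levi_civita_at_metric[OF D' V(1,2) s(2) tp(1) s(3)] by simp
    moreover have "b F G H = g p (D (F p) G) (H p) - g p (D' (F p) G) (H p)"
      using s by (simp add: b_def g_diff_left t)
    moreover have "b F H G = g p (G p) (D (F p) H) - g p (G p) (D' (F p) H)"
      using s by (simp add: b_def g_diff_left t g_sym[OF tp(2)])
    ultimately show "b F G H = - b F H G" by simp
  qed
  \<comment> \<open>Three skew and three symmetric exchanges in alternation lead back to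
    \<open>b X Y Z\<close> with a minus sign.\<close>
  have "b X Y Z = - b X Z Y" "b X Z Y = b Z X Y" "b Z X Y = - b Z Y X" "b Z Y X = b Y Z X"
    "b Y Z X = - b Y X Z" "b Y X Z = b X Y Z"
    by (rule 1 2; rule X Y Z)+
  then have "b X Y Z = 0" by simp
  then show "g p (D v Y) w = g p (D' v Y) w"
    using g_diff_left[OF levi_civita_at_tangent[OF D W v] w levi_civita_at_tangent[OF D' W v]]
    by (simp add: b_def P R)
qed

section \<open>The connection defined by a local orthonormal frame\<close>

definition bracket_coeff :: "('a \<Rightarrow> 'e \<Rightarrow> 'a tvec) \<Rightarrow> 'e \<Rightarrow> 'e \<Rightarrow> 'e \<Rightarrow> 'a \<Rightarrow> real"
  where "bracket_coeff e i j k p = g p (lie_bracket A (\<lambda>q. e q i) (\<lambda>q. e q j) p) (e p k)"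

text \<open>The Koszul formula for an orthonormal frame.\<close>

definition christoffel :: "('a \<Rightarrow> 'e \<Rightarrow> 'a tvec) \<Rightarrow> 'e \<Rightarrow> 'e \<Rightarrow> 'e \<Rightarrow> 'a \<Rightarrow> real"
  where "christoffel e i j k p =
    (bracket_coeff e i j k p - bracket_coeff e j k i p + bracket_coeff e k i j p) / 2"

text \<open>\<open>christoffel e i j k p\<close> plays the part of the \<open>e p k\<close>
  component of the derivative of the j-th frame field along the i-th. The formula is the Leibniz
  rule for a field expanded in the frame.\<close>

definition frame_conn :: "('a \<Rightarrow> 'e \<Rightarrow> 'a tvec) \<Rightarrow> 'a \<Rightarrow> 'a tvec \<Rightarrow> 'a vfield \<Rightarrow> 'a tvec"
  where "frame_conn e p v Y = (\<Sum>k\<in>Basis. (v (\<lambda>q. g q (Y q) (e q k)) +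
    (\<Sum>i\<in>Basis. \<Sum>j\<in>Basis. g p v (e p i) * g p (Y p) (e p j) * christoffel e i j k p)) *\<^sub>R e p k)"

context
  fixes P :: "'a set" and e :: "'a \<Rightarrow> 'e \<Rightarrow> 'a tvec"
  assumes fr: "orthonormal_frame A g P e"
begin

lemma frame_open: "open P"
  and frame_smooth: "smooth_vf A P (\<lambda>q. e q x)"
  and frame_inner: "p \<in> P \<Longrightarrow> g p (e p x) (e p y) = x \<bullet> y"
  and frame_linear: "p \<in> P \<Longrightarrow> linear (e p)"
  and frame_tangent: "p \<in> P \<Longrightarrow> e p x \<in> tangent A p"
  and frame_range: "p \<in> P \<Longrightarrow> range (e p) = tangent A p"
proof -
  note F = fr[unfolded orthonormal_frame_def]
  show "open P" "smooth_vf A P (\<lambda>q. e q x)" using F by blast+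
  assume "p \<in> P"
  with F show "g p (e p x) (e p y) = x \<bullet> y" "linear (e p)" "range (e p) = tangent A p" by blast+
  then show "e p x \<in> tangent A p" by blast
qed

lemma frame_expand:
  assumes "p \<in> P" "v \<in> tangent A p"
  shows "(\<Sum>i\<in>Basis. g p v (e p i) *\<^sub>R e p i) = v"
proof -
  obtain x where x: "v = e p x" using assms frame_range by blast
  have "(\<Sum>i\<in>Basis. g p v (e p i) *\<^sub>R e p i) = e p (\<Sum>i\<in>Basis. (x \<bullet> i) *\<^sub>R i)"
    by (simp add: x frame_inner[OF assms(1)] linear_sum[OF frame_linear[OF assms(1)]]
        linear_scale[OF frame_linear[OF assms(1)]])
  then show ?thesis by (simp add: x euclidean_representation)
qed

lemma frame_inner_expand:
  assumes "p \<in> P" "u \<in> tangent A p" "v \<in> tangent A p"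
  shows "g p u v = (\<Sum>i\<in>Basis. g p u (e p i) * g p v (e p i))"
proof -
  have "g p u v = g p (\<Sum>i\<in>Basis. g p u (e p i) *\<^sub>R e p i) v"
    using frame_expand[OF assms(1,2)] by simp
  also have "\<dots> = (\<Sum>i\<in>Basis. g p u (e p i) * g p v (e p i))"
    using assms frame_tangent
    by (subst g_sum_left) (auto simp: tangent_scale_closed g_scale_left g_sym[of v p])
  finally show ?thesis .
qed

lemma frame_coeff:
  assumes "p \<in> P" "l \<in> Basis"
  shows "g p (\<Sum>k\<in>Basis. c k *\<^sub>R e p k) (e p l) = c l"
  using assms frame_tangent
  by (subst g_sum_left)
    (auto simp: tangent_scale_closed g_scale_left frame_inner inner_Basis if_distrib cong: if_cong)

lemma frame_coeff_smooth:
  assumes "open W" "W \<subseteq> P" "smooth_vf A W Y"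
  shows "smooth_fun A W (\<lambda>q. g q (Y q) (e q k))"
  by (rule g_smooth[OF assms(1,3) smooth_vf_subset[OF frame_smooth assms(2)]])

lemma frame_coeff_near:
  assumes "open W" "p \<in> W" "p \<in> P" "smooth_vf A W Y"
  shows "smooth_near A p (\<lambda>q. g q (Y q) (e q k))"
  using smooth_nearI[OF _ _ frame_coeff_smooth[of "W \<inter> P" Y k]] assms frame_open
    smooth_vf_subset[OF assms(4), of "W \<inter> P"] by auto

lemma bracket_coeff_minus:
  assumes "p \<in> P"
  shows "bracket_coeff e j i k p = - bracket_coeff e i j k p"
proof -
  have "lie_bracket A (\<lambda>q. e q i) (\<lambda>q. e q j) p \<in> tangent A p"
    by (rule lie_bracket_tangent[OF frame_open assms frame_smooth frame_smooth])
  from g_scale_left[OF this frame_tangent[OF assms], of "-1" k] show ?thesis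
    unfolding bracket_coeff_def lie_bracket_minus[of "\<lambda>q. e q j"] by simp
qed

text \<open>Source of metric compatibility. Bracket coefficients are skew in their first two
  indices, so exchanging j and k turns the three terms into their negatives in another
  order.\<close>

lemma christoffel_skew: "p \<in> P \<Longrightarrow> christoffel e i k j p = - christoffel e i j k p"
  unfolding christoffel_def
  using bracket_coeff_minus[of p i k j] bracket_coeff_minus[of p k j i] bracket_coeff_minus[of p j i k]
  by (simp add: field_simps)

text \<open>Source of vanishing torsion. The last two bracket terms together are symmetric in i and
  j and cancel, while the first one is doubled.\<close>

lemma christoffel_torsion:
  "p \<in> P \<Longrightarrow> christoffel e i j k p - christoffel e j i k p = bracket_coeff e i j k p"
  unfolding christoffel_def
  using bracket_coeff_minus[of p i k j] bracket_coeff_minus[of p k j i] bracket_coeff_minus[of p j i k]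
  by (simp add: field_simps)

lemma christoffel_smooth: "smooth_fun A P (christoffel e i j k)"
proof -
  have b: "smooth_fun A P (bracket_coeff e i j k)" for i j k
    unfolding bracket_coeff_def[abs_def]
    by (rule g_smooth[OF frame_open lie_bracket_smooth[OF frame_open frame_smooth frame_smooth]
        frame_smooth])
  have "smooth_fun A P (\<lambda>p. (1/2) *
      ((bracket_coeff e i j k p - bracket_coeff e j k i p) + bracket_coeff e k i j p))"
    by (intro smooth_fun_mult smooth_fun_const smooth_fun_add smooth_fun_diff frame_open b)
  then show ?thesis by (simp add: christoffel_def[abs_def])
qed

text \<open>Both fields are expanded in the frame and the product rule is applied. The remaining
  second derivatives have the same products of coefficients, so they combine to brackets of frame
  fields. This reduces the torsion of arbitrary fields to that of the frame.\<close>

lemma lie_bracket_frame: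
  assumes W: "open W" "p \<in> W" "p \<in> P" and X: "smooth_vf A W X" and Y: "smooth_vf A W Y"
  shows "lie_bracket A X Y p =
    (\<Sum>k\<in>Basis. (X p (\<lambda>q. g q (Y q) (e q k)) - Y p (\<lambda>q. g q (X q) (e q k))) *\<^sub>R e p k) +
    (\<Sum>i\<in>Basis. \<Sum>j\<in>Basis. (g p (X p) (e p i) * g p (Y p) (e p j)) *\<^sub>R
      lie_bracket A (\<lambda>q. e q i) (\<lambda>q. e q j) p)"
    (is "?l = ?r")
proof
  fix f
  have V: "open (W \<inter> P)" "p \<in> W \<inter> P" using W frame_open by auto
  show "?l f = ?r f"
  proof (cases "smooth_near A p f")
    case f: True
    have ex: "R p (\<lambda>q. T q f) = (\<Sum>k\<in>Basis. R p (\<lambda>q. g q (T q) (e q k)) * e p k f) +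
        (\<Sum>i\<in>Basis. \<Sum>k\<in>Basis. g p (R p) (e p i) * g p (T p) (e p k) * e p i (\<lambda>q. e q k f))"
      if R: "smooth_vf A W R" and T: "smooth_vf A W T" for R T
    proof -
      have Rp: "R p \<in> tangent A p" using smooth_vf_tangent[OF R W(2)] .
      have n1: "smooth_near A p (\<lambda>q. g q (T q) (e q k))" for k
        using frame_coeff_near[OF W T] .
      have n2: "smooth_near A p (\<lambda>q. e q k f)" for k
        using smooth_vf_near[OF frame_smooth frame_open W(3) f] .
      have "T q f = (\<Sum>k\<in>Basis. g q (T q) (e q k) * e q k f)" if "q \<in> W \<inter> P" for q
      proof -
        have "T q f = (\<Sum>k\<in>Basis. g q (T q) (e q k) *\<^sub>R e q k) f"
          using frame_expand[of q "T q"] smooth_vf_tangent[OF T] that by simp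
        then show ?thesis by (simp add: sum_tvec_apply scaleR_fun_def)
      qed
      then have "R p (\<lambda>q. T q f) = R p (\<lambda>q. \<Sum>k\<in>Basis. g q (T q) (e q k) * e q k f)"
        by (rule tangent_germ[OF Rp V])
      also have "\<dots> = (\<Sum>k\<in>Basis. R p (\<lambda>q. g q (T q) (e q k)) * e p k f +
          g p (T p) (e p k) * R p (\<lambda>q. e q k f))"
        using n1 n2 by (simp add: tangent_sum[OF Rp] smooth_near_mult tangent_mult[OF Rp])
      also have "\<dots> = (\<Sum>k\<in>Basis. R p (\<lambda>q. g q (T q) (e q k)) * e p k f) +
          (\<Sum>k\<in>Basis. \<Sum>i\<in>Basis. g p (R p) (e p i) * g p (T p) (e p k) * e p i (\<lambda>q. e q k f))"
      proof -
        have "R p h = (\<Sum>i\<in>Basis. g p (R p) (e p i) * e p i h)" for h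
        proof -
          have "R p h = (\<Sum>i\<in>Basis. g p (R p) (e p i) *\<^sub>R e p i) h"
            using frame_expand[OF W(3) Rp] by simp
          then show ?thesis by (simp add: sum_tvec_apply scaleR_fun_def)
        qed
        from this[of "\<lambda>q. e q k f" for k] show ?thesis
          by (simp add: sum.distrib sum_distrib_left mult_ac)
      qed
      also have "(\<Sum>k\<in>Basis. \<Sum>i\<in>Basis. g p (R p) (e p i) * g p (T p) (e p k) * e p i (\<lambda>q. e q k f))
          = (\<Sum>i\<in>Basis. \<Sum>k\<in>Basis. g p (R p) (e p i) * g p (T p) (e p k) * e p i (\<lambda>q. e q k f))"
        by (rule sum.swap)
      finally show ?thesis .
    qed
    have sw: "(\<Sum>i\<in>Basis. \<Sum>k\<in>Basis. g p (Y p) (e p i) * g p (X p) (e p k) * e p i (\<lambda>q. e q k f))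
       = (\<Sum>i\<in>Basis. \<Sum>k\<in>Basis. g p (X p) (e p i) * g p (Y p) (e p k) * e p k (\<lambda>q. e q i f))"
      by (subst sum.swap) (simp add: mult_ac)
    show ?thesis
      using f
      by (simp add: lie_bracket_def ex[OF X Y] ex[OF Y X] sw sum_tvec_apply scaleR_fun_def
          sum_subtractf left_diff_distrib right_diff_distrib)
  next
    \<comment> \<open>On functions that are not smooth near \<open>p\<close> every tangent vector
      and the bracket are 0 by convention.\<close>
    case False
    then show ?thesis
      using tangent_nonsmooth[OF frame_tangent[OF W(3)] False]
      by (simp add: lie_bracket_def sum_tvec_apply scaleR_fun_def)
  qed
qed

text \<open>Vanishing torsion combines \<open>lie_bracket_frame\<close> with
  \<open>christoffel_torsion\<close>, and metric compatibility rests on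
  \<open>christoffel_skew\<close>. The other axioms are rules for the coefficient functions.\<close>

lemma frame_conn_levi_civita_at:
  assumes p: "p \<in> P"
  shows "levi_civita_at A g p (frame_conn e p)"
  unfolding levi_civita_at_def
proof (intro allI impI)
  fix W X Y Z f
  assume W: "open W" "p \<in> W" and X: "smooth_vf A W X" and Y: "smooth_vf A W Y"
    and Z: "smooth_vf A W Z" and f: "smooth_fun A W f"
  note et = frame_tangent[OF p]
  have V: "open (W \<inter> P)" "p \<in> W \<inter> P" using W p frame_open by auto
  have Xp: "X p \<in> tangent A p" and Yp: "Y p \<in> tangent A p" and Zp: "Z p \<in> tangent A p"
    using smooth_vf_tangent[OF _ W(2)] X Y Z by auto
  have Yn: "smooth_near A p (\<lambda>q. g q (Y q) (e q k))" and Zn: "smooth_near A p (\<lambda>q. g q (Z q) (e q k))"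
    and fn: "smooth_near A p f" for k
    using frame_coeff_near[OF W p] Y Z smooth_nearI[OF W f] by auto
  have Yq: "q \<in> W \<Longrightarrow> Y q \<in> tangent A q" and Zq: "q \<in> W \<Longrightarrow> Z q \<in> tangent A q" for q
    using smooth_vf_tangent Y Z by blast+
  have tors: "frame_conn e p (X p) Y - frame_conn e p (Y p) X = lie_bracket A X Y p"
  proof -
    define x where "x i = g p (X p) (e p i)" for i
    define y where "y i = g p (Y p) (e p i)" for i
    have br: "lie_bracket A (\<lambda>q. e q i) (\<lambda>q. e q j) p =
        (\<Sum>k\<in>Basis. bracket_coeff e i j k p *\<^sub>R e p k)" for i j
      unfolding bracket_coeff_def
      using frame_expand[OF p lie_bracket_tangent[OF frame_open p frame_smooth frame_smooth]] by simp
    have sw: "(\<Sum>i\<in>Basis. \<Sum>j\<in>Basis. y i * x j * christoffel e i j k p) =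
        (\<Sum>i\<in>Basis. \<Sum>j\<in>Basis. x i * y j * christoffel e j i k p)" for k
      by (subst sum.swap) (simp add: mult_ac)
    have "(\<Sum>i\<in>Basis. \<Sum>j\<in>Basis. (x i * y j) *\<^sub>R lie_bracket A (\<lambda>q. e q i) (\<lambda>q. e q j) p)
      = (\<Sum>k\<in>Basis. (\<Sum>i\<in>Basis. \<Sum>j\<in>Basis. x i * y j * bracket_coeff e i j k p) *\<^sub>R e p k)"
      unfolding br scaleR_sum_right scaleR_scaleR scaleR_sum_left
      by (subst (2) sum.swap, subst (1) sum.swap, rule refl)
    also have "\<dots> = (\<Sum>k\<in>Basis. ((\<Sum>i\<in>Basis. \<Sum>j\<in>Basis. x i * y j * christoffel e i j k p) -
        (\<Sum>i\<in>Basis. \<Sum>j\<in>Basis. y i * x j * christoffel e i j k p)) *\<^sub>R e p k)"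
      unfolding sw christoffel_torsion[OF p, symmetric] sum_subtractf[symmetric] right_diff_distrib ..
    finally have 1: "(\<Sum>i\<in>Basis. \<Sum>j\<in>Basis. (x i * y j) *\<^sub>R lie_bracket A (\<lambda>q. e q i) (\<lambda>q. e q j) p) =
      (\<Sum>k\<in>Basis. ((\<Sum>i\<in>Basis. \<Sum>j\<in>Basis. x i * y j * christoffel e i j k p) -
        (\<Sum>i\<in>Basis. \<Sum>j\<in>Basis. y i * x j * christoffel e i j k p)) *\<^sub>R e p k)" .
    show ?thesis
      unfolding lie_bracket_frame[OF W p X Y] frame_conn_def x_def[symmetric] y_def[symmetric] 1
        sum.distrib[symmetric] sum_subtractf[symmetric] scaleR_left_distrib[symmetric]
        scaleR_left_diff_distrib[symmetric]
      by (rule sum.cong) (simp_all add: algebra_simps sum_subtractf)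
  qed
  show "frame_conn e p (X p) Y - frame_conn e p (Y p) X = lie_bracket A X Y p \<and>
    (\<forall>v\<in>tangent A p. \<forall>w\<in>tangent A p. \<forall>c.
      frame_conn e p v Y \<in> tangent A p \<and>
      frame_conn e p (v + w) Y = frame_conn e p v Y + frame_conn e p w Y \<and>
      frame_conn e p (c *\<^sub>R v) Y = c *\<^sub>R frame_conn e p v Y \<and>
      frame_conn e p v (\<lambda>q. Y q + Z q) = frame_conn e p v Y + frame_conn e p v Z \<and>
      frame_conn e p v (\<lambda>q. f q *\<^sub>R Y q) = v f *\<^sub>R Y p + f p *\<^sub>R frame_conn e p v Y \<and>
      v (\<lambda>q. g q (Y q) (Z q)) = g p (frame_conn e p v Y) (Z p) + g p (Y p) (frame_conn e p v Z))"
  proof (intro conjI tors ballI allI)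
    fix v w c assume v: "v \<in> tangent A p" and w: "w \<in> tangent A p"
    have tg: "frame_conn e p v Y \<in> tangent A p" for Y
      unfolding frame_conn_def by (intro tangent_sum_closed tangent_scale_closed et)
    then show "frame_conn e p v Y \<in> tangent A p" .
    show "frame_conn e p (v + w) Y = frame_conn e p v Y + frame_conn e p w Y"
      unfolding frame_conn_def sum.distrib[symmetric] scaleR_left_distrib[symmetric]
      by (rule sum.cong) (simp_all add: g_add_left[OF v et w] algebra_simps sum.distrib)
    show "frame_conn e p (c *\<^sub>R v) Y = c *\<^sub>R frame_conn e p v Y"
      unfolding frame_conn_def scaleR_sum_right scaleR_scaleR
      by (rule sum.cong)
        (simp_all add: g_scale_left[OF v et] scaleR_tvec_apply algebra_simps sum_distrib_left)
    have 1: "v (\<lambda>q. g q (Y q + Z q) (e q k)) =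
        v (\<lambda>q. g q (Y q) (e q k)) + v (\<lambda>q. g q (Z q) (e q k))" for k
    proof -
      \<comment> \<open>\<open>g\<close> is additive on tangent vectors only, so the coefficient
        functions agree on W \<inter> P and \<open>v\<close> is applied to germs.\<close>
      have "v (\<lambda>q. g q (Y q + Z q) (e q k)) = v (\<lambda>q. g q (Y q) (e q k) + g q (Z q) (e q k))"
        by (rule tangent_germ[OF v V]) (auto intro!: g_add_left Yq Zq frame_tangent)
      then show ?thesis using tangent_add[OF v Yn Zn] by simp
    qed
    show "frame_conn e p v (\<lambda>q. Y q + Z q) = frame_conn e p v Y + frame_conn e p v Z"
      unfolding frame_conn_def sum.distrib[symmetric] scaleR_left_distrib[symmetric]
      by (rule sum.cong) (simp_all add: 1 g_add_left[OF Yp et Zp] algebra_simps sum.distrib)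
    have 2: "v (\<lambda>q. g q (f q *\<^sub>R Y q) (e q k)) =
        v f * g p (Y p) (e p k) + f p * v (\<lambda>q. g q (Y q) (e q k))" for k
    proof -
      have "v (\<lambda>q. g q (f q *\<^sub>R Y q) (e q k)) = v (\<lambda>q. f q * g q (Y q) (e q k))"
        by (rule tangent_germ[OF v V]) (auto intro!: g_scale_left Yq frame_tangent)
      then show ?thesis using tangent_mult[OF v fn Yn] by simp
    qed
    have "frame_conn e p v (\<lambda>q. f q *\<^sub>R Y q) =
        v f *\<^sub>R (\<Sum>k\<in>Basis. g p (Y p) (e p k) *\<^sub>R e p k) + f p *\<^sub>R frame_conn e p v Y"
      unfolding frame_conn_def scaleR_sum_right scaleR_scaleR sum.distrib[symmetric]
        scaleR_left_distrib[symmetric]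
      by (rule sum.cong)
        (simp_all add: 2 g_scale_left[OF Yp et] algebra_simps sum_distrib_left)
    then show "frame_conn e p v (\<lambda>q. f q *\<^sub>R Y q) = v f *\<^sub>R Y p + f p *\<^sub>R frame_conn e p v Y"
      unfolding frame_expand[OF p Yp] .
    have gc: "g p (frame_conn e p v T) (e p k) = v (\<lambda>q. g q (T q) (e q k)) +
        (\<Sum>i\<in>Basis. \<Sum>j\<in>Basis. g p v (e p i) * g p (T p) (e p j) * christoffel e i j k p)"
      if "k \<in> Basis" for T k
      unfolding frame_conn_def using frame_coeff[OF p that] by simp
    have "v (\<lambda>q. g q (Y q) (Z q)) = v (\<lambda>q. \<Sum>k\<in>Basis. g q (Y q) (e q k) * g q (Z q) (e q k))"
      by (rule tangent_germ[OF v V]) (auto intro!: frame_inner_expand Yq Zq)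
    also have "\<dots> = (\<Sum>k\<in>Basis. v (\<lambda>q. g q (Y q) (e q k)) * g p (Z p) (e p k) +
        g p (Y p) (e p k) * v (\<lambda>q. g q (Z q) (e q k)))"
      by (simp add: tangent_sum[OF v] smooth_near_mult Yn Zn tangent_mult[OF v])
    finally have 3: "v (\<lambda>q. g q (Y q) (Z q)) = \<dots>" .
    define y where "y i = g p (Y p) (e p i)" for i
    define z where "z i = g p (Z p) (e p i)" for i
    define u where "u i = g p v (e p i)" for i
    \<comment> \<open>Exchanging the names j and k and using skewness of the Christoffel symbols
      shows that the two Christoffel contributions to the derivative of g(Y, Z) cancel.\<close>
    have c1: "(\<Sum>k\<in>Basis. y k * (\<Sum>i\<in>Basis. \<Sum>j\<in>Basis. u i * z j * christoffel e i j k p))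
      = (\<Sum>k\<in>Basis. \<Sum>i\<in>Basis. \<Sum>j\<in>Basis. u i * y k * z j * christoffel e i j k p)"
      by (simp add: sum_distrib_left mult_ac)
    also have "\<dots> = (\<Sum>i\<in>Basis. \<Sum>k\<in>Basis. \<Sum>j\<in>Basis. u i * y k * z j * christoffel e i j k p)"
      by (rule sum.swap)
    also have "\<dots> = (\<Sum>i\<in>Basis. \<Sum>k\<in>Basis. \<Sum>j\<in>Basis. - (u i * y j * z k * christoffel e i j k p))"
      by (rule sum.cong[OF refl], subst sum.swap, intro sum.cong refl, subst christoffel_skew[OF p], simp)
    also have "\<dots> = - (\<Sum>i\<in>Basis. \<Sum>k\<in>Basis. \<Sum>j\<in>Basis. u i * y j * z k * christoffel e i j k p)"
      by (simp add: sum_negf)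
    also have "\<dots> = - (\<Sum>k\<in>Basis. z k * (\<Sum>i\<in>Basis. \<Sum>j\<in>Basis. u i * y j * christoffel e i j k p))"
      by (subst sum.swap) (simp add: sum_distrib_left mult_ac)
    finally have 4: "(\<Sum>k\<in>Basis. z k * (\<Sum>i\<in>Basis. \<Sum>j\<in>Basis. u i * y j * christoffel e i j k p)) +
      (\<Sum>k\<in>Basis. y k * (\<Sum>i\<in>Basis. \<Sum>j\<in>Basis. u i * z j * christoffel e i j k p)) = 0" by simp
    have 5: "g p (frame_conn e p v Y) (Z p) = (\<Sum>k\<in>Basis. (v (\<lambda>q. g q (Y q) (e q k)) +
        (\<Sum>i\<in>Basis. \<Sum>j\<in>Basis. u i * y j * christoffel e i j k p)) * z k)"
      unfolding frame_inner_expand[OF p tg Zp] u_def y_def z_def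
      by (rule sum.cong) (simp_all add: gc)
    have 6: "g p (Y p) (frame_conn e p v Z) = (\<Sum>k\<in>Basis. y k * (v (\<lambda>q. g q (Z q) (e q k)) +
        (\<Sum>i\<in>Basis. \<Sum>j\<in>Basis. u i * z j * christoffel e i j k p)))"
      unfolding frame_inner_expand[OF p Yp tg] u_def y_def z_def
      by (rule sum.cong) (simp_all add: gc)
    show "v (\<lambda>q. g q (Y q) (Z q)) = g p (frame_conn e p v Y) (Z p) + g p (Y p) (frame_conn e p v Z)"
      using 4 unfolding 3 5 6 y_def[symmetric] z_def[symmetric]
      by (simp add: sum.distrib distrib_left distrib_right mult_ac)
  qed
qed

lemma frame_conn_smooth:
  assumes "open W" "W \<subseteq> P" "smooth_vf A W X" "smooth_vf A W Y"
  shows "smooth_vf A W (\<lambda>p. frame_conn e p (X p) Y)"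
  unfolding frame_conn_def
  by (intro smooth_vf_sum smooth_vf_scale smooth_fun_add smooth_fun_sum smooth_fun_mult assms(1)
      smooth_vf_subset[OF frame_smooth assms(2)] smooth_fun_subset[OF christoffel_smooth assms(2)]
      frame_coeff_smooth[OF assms(1-3)] frame_coeff_smooth[OF assms(1,2,4)]
      smooth_vf_fun[OF assms(3,1) subset_refl])

lemma frame_extend:
  assumes "p \<in> P" "v \<in> tangent A p"
  shows "\<exists>X. smooth_vf A P X \<and> X p = v"
proof -
  obtain x where "v = e p x" using frame_range[OF assms(1)] assms(2) by blast
  then show ?thesis using frame_smooth[of x] by (intro exI[of _ "\<lambda>q. e q x"]) simp
qed

end

end

section \<open>Gluing the frame connections\<close>

locale framed_manifold = riemannian_manifold A g
  for A :: "('a::{t2_space,second_countable_topology}, 'e::euclidean_space) atlas" and g +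
  assumes frames: "\<And>p. \<exists>P e. p \<in> P \<and> orthonormal_frame A g P e"
begin

lemma extend:
  assumes "v \<in> tangent A p"
  shows "\<exists>P X. open P \<and> p \<in> P \<and> smooth_vf A P X \<and> X p = v"
  using frames frame_extend frame_open assms by meson

text \<open>\<open>D\<close> uses at each point the frame chosen for that point, so neighbouring
  values come from unrelated frames. Uniqueness replaces them near \<open>p\<close> by the
  connection of the one frame chosen at \<open>p\<close>, which is smooth.\<close>

lemma levi_civita_exists: "\<exists>D. levi_civita A g D"
proof -
  obtain P E where PE: "\<And>p. p \<in> P p" "\<And>p. orthonormal_frame A g (P p) (E p)"
    using frames by metis
  define D where "D p = frame_conn (E p) p" for p
  have D: "levi_civita_at A g p (D p)" for p
    unfolding D_def using frame_conn_levi_civita_at[OF PE(2,1)] .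
  have "smooth_vf A W (\<lambda>p. D p (X p) Y)"
    if W: "open W" "smooth_vf A W X" "smooth_vf A W Y" for W X Y
  proof (rule smooth_vf_local)
    fix p assume p: "p \<in> W"
    let ?V = "W \<inter> P p"
    have V: "open ?V" "p \<in> ?V" using W p PE(1) frame_open[OF PE(2)] by auto
    have s: "smooth_vf A ?V X" "smooth_vf A ?V Y" using W smooth_vf_subset by blast+
    have "smooth_vf A ?V (\<lambda>q. D q (X q) Y)"
    proof (rule smooth_vf_cong[OF frame_conn_smooth[OF PE(2) V(1) Int_lower2 s]])
      fix q assume q: "q \<in> ?V"
      show "frame_conn (E p) q (X q) Y = D q (X q) Y"
        by (rule levi_civita_at_unique[OF extend frame_conn_levi_civita_at[OF PE(2)] D V(1) q s(2)])
          (use q smooth_vf_tangent[OF s(1)] in auto)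
    qed
    with V show "\<exists>V. open V \<and> p \<in> V \<and> smooth_vf A V (\<lambda>q. D q (X q) Y)" by blast
  qed
  with D show ?thesis unfolding levi_civita_iff by blast
qed

lemma nabla_levi_civita: "levi_civita A g (nabla A g)"
  unfolding nabla_def using someI_ex[OF levi_civita_exists] .

end

section \<open>Sasakian manifolds and their D-homothetic deformations\<close>

locale sasakian_manifold = framed_manifold A g
  for A :: "('a::{t2_space,second_countable_topology}, 'e::euclidean_space) atlas" and g +
  fixes \<xi> :: "'a vfield"
  assumes sasakian: "sasakian A g \<xi>"
begin

section \<open>The endomorphism h on the whole tangent space\<close>

abbreviation "h \<equiv> flow_h A g \<xi>"

lemma xi_smooth: "smooth_vf A UNIV \<xi>"
  and xi_unit: "g p (\<xi> p) (\<xi> p) = 1"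
  using conjunct1[OF sasakian[unfolded sasakian_def]] unfolding riemannian_flow_def by simp_all

lemma xi_tangent: "\<xi> p \<in> tangent A p"
  using smooth_vf_tangent[OF xi_smooth] by simp

lemma nabla_at: "levi_civita_at A g p (nabla A g p)"
  using nabla_levi_civita unfolding levi_civita_iff by blast

lemma nabla_smooth: "open W \<Longrightarrow> smooth_vf A W X \<Longrightarrow> smooth_vf A W Y \<Longrightarrow>
    smooth_vf A W (\<lambda>p. nabla A g p (X p) Y)"
  using nabla_levi_civita unfolding levi_civita_iff by blast

lemma h_tangent: "v \<in> tangent A p \<Longrightarrow> h p v \<in> tangent A p"
  unfolding flow_h_def by (rule levi_civita_at_tangent[OF nabla_at open_UNIV UNIV_I xi_smooth])

lemma h_add: "v \<in> tangent A p \<Longrightarrow> w \<in> tangent A p \<Longrightarrow> h p (v + w) = h p v + h p w"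
  unfolding flow_h_def by (rule levi_civita_at_add[OF nabla_at open_UNIV UNIV_I xi_smooth])

lemma h_scale: "v \<in> tangent A p \<Longrightarrow> h p (c *\<^sub>R v) = c *\<^sub>R h p v"
  unfolding flow_h_def by (rule levi_civita_at_scale[OF nabla_at open_UNIV UNIV_I xi_smooth])

lemma h_xi: "h p (\<xi> p) = 0"
  using sasakian unfolding sasakian_def flow_kappa_def flow_h_def by simp

lemma h_perp:
  assumes "v \<in> tangent A p"
  shows "g p (h p v) (\<xi> p) = 0" "g p (\<xi> p) (h p v) = 0"
proof -
  have "v (\<lambda>q. g q (\<xi> q) (\<xi> q)) = g p (h p v) (\<xi> p) + g p (\<xi> p) (h p v)"
    unfolding flow_h_def
    by (rule levi_civita_at_metric[OF nabla_at open_UNIV UNIV_I xi_smooth assms xi_smooth])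
  then have "g p (h p v) (\<xi> p) + g p (\<xi> p) (h p v) = 0"
    by (simp add: xi_unit tangent_const[OF assms])
  then show "g p (h p v) (\<xi> p) = 0" "g p (\<xi> p) (h p v) = 0"
    using g_sym[OF h_tangent[OF assms] xi_tangent] by simp_all
qed

lemma horiz_tangent: "v \<in> tangent A p \<Longrightarrow> horiz g \<xi> p v \<in> tangent A p"
  unfolding horiz_def by (intro tangent_minus_closed tangent_scale_closed xi_tangent)

lemma horiz_perp: "v \<in> tangent A p \<Longrightarrow> g p (horiz g \<xi> p v) (\<xi> p) = 0"
  unfolding horiz_def
  by (simp add: g_diff_left g_scale_left tangent_scale_closed xi_tangent xi_unit)

lemma horiz_Qspace: "v \<in> tangent A p \<Longrightarrow> horiz g \<xi> p v \<in> Qspace A g \<xi> p"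
  unfolding Qspace_def using horiz_tangent horiz_perp by simp

lemma horiz_smooth:
  assumes "open W" "smooth_vf A W X"
  shows "smooth_vf A W (\<lambda>q. horiz g \<xi> q (X q))"
  unfolding horiz_def using smooth_vf_subset[OF xi_smooth subset_UNIV]
  by (intro smooth_vf_diff smooth_vf_scale g_smooth assms)

text \<open>h kills \<xi> because its value there is \<open>flow_kappa\<close>. Horizontal
  projections in front of h can thus be dropped.\<close>

lemma h_horiz:
  assumes "v \<in> tangent A p"
  shows "h p (horiz g \<xi> p v) = h p v"
  unfolding horiz_def
  using h_add[OF assms tangent_scale_closed[OF xi_tangent], of "- g p v (\<xi> p)"]
    h_scale[OF xi_tangent, of p "- g p v (\<xi> p)"] by (simp add: h_xi)

lemma g_horiz:
  assumes "v \<in> tangent A p" "w \<in> tangent A p"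
  shows "g p (horiz g \<xi> p v) (horiz g \<xi> p w) = g p v w - g p v (\<xi> p) * g p w (\<xi> p)"
proof -
  have "g p (horiz g \<xi> p v) (horiz g \<xi> p w) = g p (horiz g \<xi> p v) w - g p w (\<xi> p) * 0"
    using assms horiz_perp[of v p]
    by (simp add: horiz_def[of _ _ _ w] g_diff_right g_scale_right horiz_tangent
        tangent_scale_closed xi_tangent)
  also have "\<dots> = g p v w - g p v (\<xi> p) * g p w (\<xi> p)"
    using assms
    by (simp add: horiz_def g_diff_left g_scale_left tangent_scale_closed xi_tangent
        g_sym[OF xi_tangent])
  finally show ?thesis .
qed

text \<open>For sections of Q, vanishing torsion and metric compatibility turn the Lie derivative of
  the metric into g(h X, Y) + g(X, h Y), which is zero for a Riemannian flow. General vectors reduce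
  to Q, as h kills \<xi> and has values orthogonal to it.\<close>

lemma h_skew:
  assumes u: "u \<in> tangent A p" and v: "v \<in> tangent A p"
  shows "g p (h p u) v = - g p u (h p v)"
proof -
  have Q: "g p (h p (horiz g \<xi> p u)) (horiz g \<xi> p v) + g p (horiz g \<xi> p u) (h p (horiz g \<xi> p v)) = 0"
  proof -
    obtain P1 X where X: "open P1" "p \<in> P1" "smooth_vf A P1 X" "X p = u" using extend[OF u] by blast
    obtain P2 Y where Y: "open P2" "p \<in> P2" "smooth_vf A P2 Y" "Y p = v" using extend[OF v] by blast
    define W where "W = P1 \<inter> P2"
    have W: "open W" "p \<in> W" "W \<subseteq> P1" "W \<subseteq> P2" using X Y by (auto simp: W_def)
    \<comment> \<open>The flow condition speaks of sections of Q, so the extensions of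
      \<open>u\<close> and \<open>v\<close> are projected.\<close>
    define X' where "X' q = horiz g \<xi> q (X q)" for q
    define Y' where "Y' q = horiz g \<xi> q (Y q)" for q
    have s: "smooth_vf A W X'" "smooth_vf A W Y'"
      unfolding X'_def[abs_def] Y'_def[abs_def]
      using horiz_smooth[OF W(1)] smooth_vf_subset[OF X(3) W(3)] smooth_vf_subset[OF Y(3) W(4)]
      by blast+
    have q: "Qsection A g \<xi> W X'" "Qsection A g \<xi> W Y'"
      unfolding Qsection_def using s smooth_vf_tangent[OF smooth_vf_subset[OF X(3) W(3)]]
        smooth_vf_tangent[OF smooth_vf_subset[OF Y(3) W(4)]]
      by (auto simp: X'_def Y'_def horiz_Qspace)
    have xiW: "smooth_vf A W \<xi>" using smooth_vf_subset[OF xi_smooth] by simp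
    have L: "lie_deriv_metric A \<xi> g X' Y' p = 0"
      using conjunct1[OF sasakian[unfolded sasakian_def]] q W(1,2)
      unfolding riemannian_flow_def by simp
    have b: "lie_bracket A \<xi> X' p = nabla A g p (\<xi> p) X' - h p (X' p)"
      "lie_bracket A \<xi> Y' p = nabla A g p (\<xi> p) Y' - h p (Y' p)"
      unfolding flow_h_def using levi_civita_at_bracket[OF nabla_at W(1,2) xiW] s by simp_all
    have m: "\<xi> p (\<lambda>q. g q (X' q) (Y' q)) =
        g p (nabla A g p (\<xi> p) X') (Y' p) + g p (X' p) (nabla A g p (\<xi> p) Y')"
      using levi_civita_at_metric[OF nabla_at W(1,2) s(1) xi_tangent s(2)] .
    have t: "X' p \<in> tangent A p" "Y' p \<in> tangent A p" "nabla A g p (\<xi> p) X' \<in> tangent A p"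
      "nabla A g p (\<xi> p) Y' \<in> tangent A p"
      using smooth_vf_tangent[OF s(1) W(2)] smooth_vf_tangent[OF s(2) W(2)]
        levi_civita_at_tangent[OF nabla_at W(1,2) s(1) xi_tangent]
        levi_civita_at_tangent[OF nabla_at W(1,2) s(2) xi_tangent] by simp_all
    have "g p (h p (X' p)) (Y' p) + g p (X' p) (h p (Y' p)) = 0"
      using L unfolding lie_deriv_metric_def m b by (simp add: g_diff_left g_diff_right t h_tangent)
    then show ?thesis by (simp add: X'_def Y'_def X Y)
  qed
  have 1: "g p (h p u) (horiz g \<xi> p v) = g p (h p u) v"
    unfolding horiz_def using u v
    by (simp add: g_diff_right g_scale_right h_tangent tangent_scale_closed xi_tangent h_perp)
  have 2: "g p (horiz g \<xi> p u) (h p v) = g p u (h p v)"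
    unfolding horiz_def using u v
    by (simp add: g_diff_left g_scale_left h_tangent tangent_scale_closed xi_tangent h_perp)
  show ?thesis using Q unfolding h_horiz[OF u] h_horiz[OF v] 1 2 by simp
qed

text \<open>The condition h^2 = -1 holds on Q; off Q the horizontal projection enters, since h
  ignores the \<xi> component.\<close>

lemma h_h:
  assumes "v \<in> tangent A p"
  shows "h p (h p v) = - horiz g \<xi> p v"
  using sasakian horiz_Qspace[OF assms] h_horiz[OF assms] unfolding sasakian_def by metis

lemma flow_Omega_eq:
  assumes "v \<in> tangent A p" "w \<in> tangent A p"
  shows "flow_Omega A g \<xi> p v w = g p (h p v) w"
  unfolding flow_Omega_def h_horiz[OF assms(1)] unfolding horiz_def using assms
  by (simp add: g_diff_right g_scale_right h_tangent tangent_scale_closed xi_tangent h_perp)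

section \<open>The deformed metric and its Levi-Civita connection\<close>

context
  fixes t :: real
  assumes t: "t > 0"
begin

text \<open>Removes the horizontal projections, so that the deformed metric can be differentiated
  with the rules for \<open>g\<close> alone.\<close>

lemma dhom_metric_eq:
  assumes "v \<in> tangent A p" "w \<in> tangent A p"
  shows "dhom_metric g \<xi> t p v w = t * g p v w + (t\<^sup>2 - t) * (g p v (\<xi> p) * g p w (\<xi> p))"
  unfolding dhom_metric_def g_horiz[OF assms] by (simp add: algebra_simps)

lemma dhom_metric_riemannian: "riemannian_metric A (dhom_metric g \<xi> t)"
  unfolding riemannian_metric_def
proof (intro conjI allI ballI impI)
  fix p u v w c assume a: "u \<in> tangent A p" "v \<in> tangent A p" "w \<in> tangent A p"
  show "dhom_metric g \<xi> t p (u + v) w = dhom_metric g \<xi> t p u w + dhom_metric g \<xi> t p v w"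
    using a by (simp add: dhom_metric_eq tangent_plus_closed g_add_left xi_tangent algebra_simps)
  show "dhom_metric g \<xi> t p (c *\<^sub>R u) w = c * dhom_metric g \<xi> t p u w"
    using a by (simp add: dhom_metric_eq tangent_scale_closed g_scale_left xi_tangent algebra_simps)
  show "dhom_metric g \<xi> t p u v = dhom_metric g \<xi> t p v u"
    using a g_sym[OF a(1,2)] by (simp add: dhom_metric_eq)
next
  fix p v assume v: "v \<in> tangent A p" "v \<noteq> 0"
  have e: "dhom_metric g \<xi> t p v v =
      t\<^sup>2 * (g p v (\<xi> p))\<^sup>2 + t * g p (horiz g \<xi> p v) (horiz g \<xi> p v)"
    by (simp add: dhom_metric_def power2_eq_square)
  show "0 < dhom_metric g \<xi> t p v v"
  proof (cases "horiz g \<xi> p v = 0")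
    case True
    then have "g p v (\<xi> p) \<noteq> 0" using v(2) by (auto simp: horiz_def)
    then show ?thesis unfolding e using t True g_zero_left[OF tangent_zero] by simp
  next
    case False
    then have "g p (horiz g \<xi> p v) (horiz g \<xi> p v) > 0"
      using riem horiz_tangent[OF v(1)] unfolding riemannian_metric_def by blast
    then show ?thesis unfolding e using t by (simp add: add_nonneg_pos)
  qed
next
  fix W X Y assume W: "open W" "smooth_vf A W X" "smooth_vf A W Y"
  have x: "smooth_vf A W \<xi>" using smooth_vf_subset[OF xi_smooth] by simp
  have "smooth_fun A W (\<lambda>p. t * g p (X p) (Y p) + (t\<^sup>2 - t) * (g p (X p) (\<xi> p) * g p (Y p) (\<xi> p)))"
    by (intro smooth_fun_add smooth_fun_mult smooth_fun_const g_smooth W x)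
  then show "smooth_fun A W (\<lambda>p. dhom_metric g \<xi> t p (X p) (Y p))"
    by (rule smooth_fun_cong[OF W(1), rotated])
      (simp add: dhom_metric_eq smooth_vf_tangent[OF W(2)] smooth_vf_tangent[OF W(3)])
qed

text \<open>The correction is symmetric in the two arguments to keep the torsion zero. Its factor is
  forced: differentiating the part (t^2 - t) \<eta>(Y) \<eta>(Z) of the metric produces terms such
  as (t^2 - t) g(Y, h v) \<eta>(Z), and t times the correction has to match them.\<close>

definition dhom_conn :: "'a \<Rightarrow> 'a tvec \<Rightarrow> 'a vfield \<Rightarrow> 'a tvec"
  where "dhom_conn p v Y = nabla A g p v Y +
    (t - 1) *\<^sub>R (g p v (\<xi> p) *\<^sub>R h p (Y p) + g p (Y p) (\<xi> p) *\<^sub>R h p v)"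

lemma dhom_conn_tangent:
  assumes W: "open W" "p \<in> W" "smooth_vf A W Y" "v \<in> tangent A p"
  shows "dhom_conn p v Y \<in> tangent A p"
  unfolding dhom_conn_def
  by (intro tangent_plus_closed tangent_scale_closed h_tangent smooth_vf_tangent[OF W(3,2)] W(4)
      levi_civita_at_tangent[OF nabla_at W])

lemma dhom_conn_levi_civita: "levi_civita A (dhom_metric g \<xi> t) dhom_conn"
  unfolding levi_civita_iff
proof (intro conjI allI impI)
  fix W X Y assume W: "open W" "smooth_vf A W X" "smooth_vf A W Y"
  have x: "smooth_vf A W \<xi>" using smooth_vf_subset[OF xi_smooth] by simp
  show "smooth_vf A W (\<lambda>p. dhom_conn p (X p) Y)"
    unfolding dhom_conn_def flow_h_def
    by (intro smooth_vf_add smooth_vf_scale smooth_fun_const nabla_smooth g_smooth W x)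
next
  fix p
  show "levi_civita_at A (dhom_metric g \<xi> t) p (dhom_conn p)"
    unfolding levi_civita_at_def
  proof (intro allI impI)
    fix W X Y Z f
    assume W: "open W" "p \<in> W" and X: "smooth_vf A W X" and Y: "smooth_vf A W Y"
      and Z: "smooth_vf A W Z" and f: "smooth_fun A W f"
    have Xp: "X p \<in> tangent A p" and Yp: "Y p \<in> tangent A p" and Zp: "Z p \<in> tangent A p"
      using smooth_vf_tangent[OF _ W(2)] X Y Z by auto
    have xi: "smooth_vf A W \<xi>" using smooth_vf_subset[OF xi_smooth] by simp
    have tors: "dhom_conn p (X p) Y - dhom_conn p (Y p) X = lie_bracket A X Y p"
      unfolding levi_civita_at_bracket[OF nabla_at W X Y, symmetric] dhom_conn_def
      by (simp add: add.commute)
    show "dhom_conn p (X p) Y - dhom_conn p (Y p) X = lie_bracket A X Y p \<and>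
      (\<forall>v\<in>tangent A p. \<forall>w\<in>tangent A p. \<forall>c.
        dhom_conn p v Y \<in> tangent A p \<and>
        dhom_conn p (v + w) Y = dhom_conn p v Y + dhom_conn p w Y \<and>
        dhom_conn p (c *\<^sub>R v) Y = c *\<^sub>R dhom_conn p v Y \<and>
        dhom_conn p v (\<lambda>q. Y q + Z q) = dhom_conn p v Y + dhom_conn p v Z \<and>
        dhom_conn p v (\<lambda>q. f q *\<^sub>R Y q) = v f *\<^sub>R Y p + f p *\<^sub>R dhom_conn p v Y \<and>
        v (\<lambda>q. dhom_metric g \<xi> t q (Y q) (Z q)) =
          dhom_metric g \<xi> t p (dhom_conn p v Y) (Z p) + dhom_metric g \<xi> t p (Y p) (dhom_conn p v Z))"
    proof (intro conjI tors ballI allI)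
      fix v w c assume v: "v \<in> tangent A p" and w: "w \<in> tangent A p"
      note NY = levi_civita_at_tangent[OF nabla_at W Y v]
      note NZ = levi_civita_at_tangent[OF nabla_at W Z v]
      note closed = tangent_plus_closed tangent_scale_closed h_tangent xi_tangent v w Xp Yp Zp NY NZ
      note g_simps = g_add_left g_add_right g_scale_left g_scale_right
      show "dhom_conn p v Y \<in> tangent A p" using dhom_conn_tangent[OF W Y v] .
      show "dhom_conn p (v + w) Y = dhom_conn p v Y + dhom_conn p w Y"
        unfolding dhom_conn_def levi_civita_at_add[OF nabla_at W Y v w]
        by (simp add: closed g_simps h_add algebra_simps)
      show "dhom_conn p (c *\<^sub>R v) Y = c *\<^sub>R dhom_conn p v Y"
        unfolding dhom_conn_def levi_civita_at_scale[OF nabla_at W Y v]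
        by (simp add: closed g_simps h_scale algebra_simps)
      show "dhom_conn p v (\<lambda>q. Y q + Z q) = dhom_conn p v Y + dhom_conn p v Z"
        unfolding dhom_conn_def levi_civita_at_add_field[OF nabla_at W Y v Z]
        by (simp add: closed g_simps h_add algebra_simps)
      show "dhom_conn p v (\<lambda>q. f q *\<^sub>R Y q) = v f *\<^sub>R Y p + f p *\<^sub>R dhom_conn p v Y"
        unfolding dhom_conn_def levi_civita_at_Leibniz[OF nabla_at W Y v f]
        by (simp add: closed g_simps h_scale algebra_simps)
      have Yq: "q \<in> W \<Longrightarrow> Y q \<in> tangent A q" and Zq: "q \<in> W \<Longrightarrow> Z q \<in> tangent A q" for q
        using smooth_vf_tangent Y Z by blast+
      have near: "smooth_near A p (\<lambda>q. g q (Y q) (Z q))" "smooth_near A p (\<lambda>q. g q (Y q) (\<xi> q))"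
        "smooth_near A p (\<lambda>q. g q (Z q) (\<xi> q))"
        by (rule smooth_nearI[OF W g_smooth[OF W(1)]], fact, fact)+
      have "v (\<lambda>q. dhom_metric g \<xi> t q (Y q) (Z q)) =
          v (\<lambda>q. t * g q (Y q) (Z q) + (t\<^sup>2 - t) * (g q (Y q) (\<xi> q) * g q (Z q) (\<xi> q)))"
        by (rule tangent_germ[OF v W]) (simp add: dhom_metric_eq Yq Zq)
      also have "\<dots> = t * (g p (nabla A g p v Y) (Z p) + g p (Y p) (nabla A g p v Z)) +
          (t\<^sup>2 - t) * ((g p (nabla A g p v Y) (\<xi> p) + g p (Y p) (h p v)) * g p (Z p) (\<xi> p) +
           g p (Y p) (\<xi> p) * (g p (nabla A g p v Z) (\<xi> p) + g p (Z p) (h p v)))"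
        using near
        by (simp add: tangent_add[OF v] tangent_cmul[OF v] tangent_mult[OF v] smooth_near_mult
            smooth_near_const flow_h_def levi_civita_at_metric[OF nabla_at W Y v]
            levi_civita_at_metric[OF nabla_at W Z v] Y Z xi)
      also have "\<dots> = dhom_metric g \<xi> t p (dhom_conn p v Y) (Z p) +
          dhom_metric g \<xi> t p (Y p) (dhom_conn p v Z)"
      proof -
        \<comment> \<open>Skewness of h gives the terms with \<eta>(v) opposite signs in the two
          products, so they cancel in the sum.\<close>
        have 1: "g p (h p v) (Z p) = g p (Z p) (h p v)" "g p (h p (Y p)) (Z p) = - g p (Y p) (h p (Z p))"
          using g_sym[OF h_tangent[OF v] Zp] h_skew[OF Yp Zp] by auto
        have 2: "g p (dhom_conn p v Y) (Z p) = g p (nabla A g p v Y) (Z p) +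
            (t - 1) * (g p (Y p) (\<xi> p) * g p (Z p) (h p v) - g p v (\<xi> p) * g p (Y p) (h p (Z p)))"
          "g p (Y p) (dhom_conn p v Z) = g p (Y p) (nabla A g p v Z) +
            (t - 1) * (g p (Z p) (\<xi> p) * g p (Y p) (h p v) + g p v (\<xi> p) * g p (Y p) (h p (Z p)))"
          "g p (dhom_conn p v Y) (\<xi> p) = g p (nabla A g p v Y) (\<xi> p)"
          "g p (dhom_conn p v Z) (\<xi> p) = g p (nabla A g p v Z) (\<xi> p)"
          unfolding dhom_conn_def by (simp_all add: closed g_simps 1 h_perp)
        show ?thesis
          unfolding dhom_metric_eq[OF dhom_conn_tangent[OF W Y v] Zp]
            dhom_metric_eq[OF Yp dhom_conn_tangent[OF W Z v]] 2
          by (simp add: algebra_simps power2_eq_square)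
      qed
      finally show "v (\<lambda>q. dhom_metric g \<xi> t q (Y q) (Z q)) =
          dhom_metric g \<xi> t p (dhom_conn p v Y) (Z p) + dhom_metric g \<xi> t p (Y p) (dhom_conn p v Z)" .
    qed
  qed
qed

text \<open>The explicit connection shows that the choice in \<open>nabla\<close> is a proper one
  for the deformed metric, and uniqueness identifies the two. Extending tangent vectors to fields
  does not involve the metric, so the frames for \<open>g\<close> serve here.\<close>

lemma nabla_dhom:
  assumes "open W" "p \<in> W" "smooth_vf A W Y" "v \<in> tangent A p"
  shows "nabla A (dhom_metric g \<xi> t) p v Y = dhom_conn p v Y"
proof -
  interpret dhom: riemannian_manifold A "dhom_metric g \<xi> t"
    by unfold_locales (rule dhom_metric_riemannian)
  have "levi_civita A (dhom_metric g \<xi> t) (nabla A (dhom_metric g \<xi> t))"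
    unfolding nabla_def using someI[of "levi_civita A (dhom_metric g \<xi> t)", OF dhom_conn_levi_civita] .
  then have "levi_civita_at A (dhom_metric g \<xi> t) p (nabla A (dhom_metric g \<xi> t) p)"
    "levi_civita_at A (dhom_metric g \<xi> t) p (dhom_conn p)"
    using dhom_conn_levi_civita unfolding levi_civita_iff by simp_all
  from dhom.levi_civita_at_unique[OF extend this assms] show ?thesis .
qed

section \<open>Connection coefficients in the deformed frame\<close>

lemma dhom_isom_eq:
  "dhom_isom g \<xi> t p v = (1 / sqrt t) *\<^sub>R v + ((1 / t - 1 / sqrt t) * g p v (\<xi> p)) *\<^sub>R \<xi> p"
  by (simp add: dhom_isom_def dhom_field_def horiz_def algebra_simps)

lemma dhom_isom_tangent: "v \<in> tangent A p \<Longrightarrow> dhom_isom g \<xi> t p v \<in> tangent A p"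
  unfolding dhom_isom_eq by (intro tangent_plus_closed tangent_scale_closed xi_tangent)

lemma dhom_metric_isom:
  assumes "v \<in> tangent A p" "w \<in> tangent A p"
  shows "dhom_metric g \<xi> t p v (dhom_isom g \<xi> t p w) =
    sqrt t * g p v w + (t - sqrt t) * (g p v (\<xi> p) * g p w (\<xi> p))"
proof -
  \<comment> \<open>Writing t as the square of \<open>s\<close> makes the claim an identity of
    rational functions.\<close>
  define s where "s = sqrt t"
  have s: "s > 0" "t = s\<^sup>2" using t by (simp_all add: s_def)
  note cl = assms tangent_plus_closed tangent_scale_closed xi_tangent
  have 1: "g p v (dhom_isom g \<xi> t p w) = (1 / s) * g p v w + (1 / t - 1 / s) * g p w (\<xi> p) * g p v (\<xi> p)"
    unfolding dhom_isom_eq s_def by (simp add: cl g_add_right g_scale_right)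
  have 2: "g p (dhom_isom g \<xi> t p w) (\<xi> p) = (1 / t) * g p w (\<xi> p)"
    unfolding dhom_isom_eq s_def
    by (simp add: cl g_add_left g_scale_left xi_unit left_diff_distrib)
  show ?thesis
    unfolding dhom_metric_eq[OF assms(1) dhom_isom_tangent[OF assms(2)]] 1 2 s_def[symmetric]
    using s(1) unfolding s(2) by (simp add: field_simps power2_eq_square)
qed

text \<open>With frame fields for \<open>Y\<close> and \<open>w\<close> these are the coefficients
  in the spin connection. The change is skew in Y and w, as it must be between two orthonormal
  frames.\<close>

lemma dhom_conn_coeff:
  assumes W: "open W" "p \<in> W" "smooth_vf A W Y" "v \<in> tangent A p" and w: "w \<in> tangent A p"
  shows "dhom_metric g \<xi> t p (nabla A (dhom_metric g \<xi> t) p v (\<lambda>q. dhom_isom g \<xi> t q (Y q)))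
      (dhom_isom g \<xi> t p w) =
    g p (nabla A g p v Y) w + (t - 1) * g p v (\<xi> p) * g p (h p (Y p)) w +
    (sqrt t - 1) * (g p (Y p) (\<xi> p) * g p (h p v) w - g p w (\<xi> p) * g p (h p v) (Y p))"
proof -
  define s where "s = sqrt t"
  have s: "s > 0" "t = s\<^sup>2" using t by (simp_all add: s_def)
  have xi: "smooth_vf A W \<xi>" using smooth_vf_subset[OF xi_smooth] by simp
  have Yp: "Y p \<in> tangent A p" using smooth_vf_tangent[OF W(3,2)] .
  have hv: "h p v \<in> tangent A p" using h_tangent[OF W(4)] .
  have NY: "nabla A g p v Y \<in> tangent A p" using levi_civita_at_tangent[OF nabla_at W] .
  note cl = W(4) w Yp hv NY h_tangent[OF Yp] tangent_plus_closed tangent_scale_closed xi_tangent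
  note gs = g_add_left g_scale_left h_add h_scale h_xi h_perp xi_unit
  \<comment> \<open>\<xi> is scaled by 1 / t and Q by 1 / sqrt t; \<open>f\<close> carries the
    discrepancy. Its derivative yields the term with g(h v, Y) and removes the \<xi> component of
    the derivative of \<open>Y\<close>.\<close>
  define f where "f q = (1 / t - 1 / s) * g q (Y q) (\<xi> q)" for q
  have fY: "smooth_fun A W (\<lambda>q. g q (Y q) (\<xi> q))" by (rule g_smooth[OF W(1,3) xi])
  have f: "smooth_fun A W f"
    unfolding f_def[abs_def] by (intro smooth_fun_mult W(1) smooth_fun_const fY)
  have sY: "smooth_vf A W (\<lambda>q. (1 / s) *\<^sub>R Y q)" and sxi: "smooth_vf A W (\<lambda>q. f q *\<^sub>R \<xi> q)"
    by (intro smooth_vf_scale smooth_fun_const W f xi)+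
  have I: "dhom_isom g \<xi> t q (Y q) = (1 / s) *\<^sub>R Y q + f q *\<^sub>R \<xi> q" for q
    by (simp add: dhom_isom_eq s_def f_def)
  have vf: "v f = (1 / t - 1 / s) * (g p (nabla A g p v Y) (\<xi> p) + g p (h p v) (Y p))"
    unfolding f_def[abs_def] tangent_cmul[OF W(4) smooth_nearI[OF W(1,2) fY]]
      levi_civita_at_metric[OF nabla_at W xi] flow_h_def[symmetric] g_sym[OF Yp hv] ..
  have N: "nabla A g p v (\<lambda>q. (1 / s) *\<^sub>R Y q + f q *\<^sub>R \<xi> q) =
      (1 / s) *\<^sub>R nabla A g p v Y + (v f *\<^sub>R \<xi> p + f p *\<^sub>R h p v)"
    using levi_civita_at_add_field[OF nabla_at W(1,2) sY W(4) sxi]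
      levi_civita_at_Leibniz[OF nabla_at W smooth_fun_const, of "1 / s"]
      levi_civita_at_Leibniz[OF nabla_at W(1,2) xi W(4) f] tangent_const[OF W(4)]
    by (simp add: flow_h_def)
  have C: "nabla A (dhom_metric g \<xi> t) p v (\<lambda>q. dhom_isom g \<xi> t q (Y q)) =
      dhom_conn p v (\<lambda>q. (1 / s) *\<^sub>R Y q + f q *\<^sub>R \<xi> q)"
    unfolding I by (rule nabla_dhom[OF W(1,2) smooth_vf_add[OF sY sxi] W(4)])
  have y: "g p ((1 / s) *\<^sub>R Y p + f p *\<^sub>R \<xi> p) (\<xi> p) = (1 / t) * g p (Y p) (\<xi> p)"
    "h p ((1 / s) *\<^sub>R Y p + f p *\<^sub>R \<xi> p) = (1 / s) *\<^sub>R h p (Y p)"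
    by (simp_all add: cl gs f_def left_diff_distrib)
  have c1: "g p (dhom_conn p v (\<lambda>q. (1 / s) *\<^sub>R Y q + f q *\<^sub>R \<xi> q)) u =
      (1 / s) * g p (nabla A g p v Y) u + v f * g p (\<xi> p) u + f p * g p (h p v) u +
      (t - 1) * (g p v (\<xi> p) * (1 / s) * g p (h p (Y p)) u + (1 / t) * g p (Y p) (\<xi> p) * g p (h p v) u)"
    if "u \<in> tangent A p" for u
    unfolding dhom_conn_def N y using that by (simp add: cl g_add_left g_scale_left)
  have c2: "g p (dhom_conn p v (\<lambda>q. (1 / s) *\<^sub>R Y q + f q *\<^sub>R \<xi> q)) (\<xi> p) =
      (1 / s) * g p (nabla A g p v Y) (\<xi> p) + v f"
    unfolding c1[OF xi_tangent] by (simp add: h_perp W(4) Yp xi_unit)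
  have ct: "dhom_conn p v (\<lambda>q. (1 / s) *\<^sub>R Y q + f q *\<^sub>R \<xi> q) \<in> tangent A p"
    by (rule dhom_conn_tangent[OF W(1,2) smooth_vf_add[OF sY sxi] W(4)])
  show ?thesis
    unfolding C dhom_metric_isom[OF ct w] c1[OF w] c2
    unfolding vf f_def s_def[symmetric] g_sym[OF xi_tangent w]
    using s(1) unfolding s(2) by (simp add: field_simps power2_eq_square)
qed

end

end

section \<open>Clifford multiplication on the extreme eigenspaces\<close>

text \<open>Metric coefficients enter as \<open>*\<^sub>R\<close> and eigenvalues as
  \<open>*s\<close>; these rules let the two kinds of scalars be mixed.\<close>

lemma vector_smult_simps:
  fixes \<phi> \<eta> :: "complex^'s"
  shows "c *s (r *\<^sub>R \<phi>) = r *\<^sub>R (c *s \<phi>)" "c *s (\<phi> + \<eta>) = c *s \<phi> + c *s \<eta>"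
    "(r *\<^sub>R c) *s \<phi> = r *\<^sub>R (c *s \<phi>)" "c *s (d *s \<phi>) = (c * d) *s \<phi>"
    "of_real r *s \<phi> = r *\<^sub>R \<phi>"
  by (simp_all add: vec_eq_iff algebra_simps scaleR_conv_of_real[where 'a=complex])

lemma norm_vector_smult: "norm (c *s \<phi>) = cmod c * norm \<phi>" for \<phi> :: "complex^'s"
  by (simp add: norm_vec_def norm_mult L2_set_right_distrib)

locale clifford =
  fixes \<gamma> :: "'e::euclidean_space \<Rightarrow> complex^'s^'s"
  assumes rep: "clifford_rep \<gamma>"
begin

definition act :: "'e \<Rightarrow> complex^'s \<Rightarrow> complex^'s" where "act x \<phi> = \<gamma> x *v \<phi>"

lemma act_add: "act (x + y) \<phi> = act x \<phi> + act y \<phi>"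
  and act_scale: "act (r *\<^sub>R x) \<phi> = r *\<^sub>R act x \<phi>"
proof -
  have l: "linear \<gamma>" using rep unfolding clifford_rep_def by simp
  show "act (x + y) \<phi> = act x \<phi> + act y \<phi>"
    by (simp add: act_def linear_add[OF l] matrix_vector_mult_add_rdistrib)
  show "act (r *\<^sub>R x) \<phi> = r *\<^sub>R act x \<phi>"
    by (simp add: act_def linear_scale[OF l] matrix_vector_mult_def vec_eq_iff scaleR_sum_right)
qed

lemma act_zero: "act 0 \<phi> = 0"
  using act_scale[of 0 0 \<phi>] by simp

lemma act_sum: "act (\<Sum>i\<in>I. f i) \<phi> = (\<Sum>i\<in>I. act (f i) \<phi>)"
  by (induction I rule: infinite_finite_induct) (simp_all add: act_zero act_add)

lemma act_add_right: "act x (\<phi> + \<eta>) = act x \<phi> + act x \<eta>"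
  and act_smult_right: "act x (c *s \<phi>) = c *s act x \<phi>"
  and act_scale_right: "act x (r *\<^sub>R \<phi>) = r *\<^sub>R act x \<phi>"
proof -
  show "act x (\<phi> + \<eta>) = act x \<phi> + act x \<eta>"
    by (simp add: act_def matrix_vector_right_distrib)
  show *: "act x (c *s \<phi>) = c *s act x \<phi>" for c
    by (simp add: act_def vector_scalar_commute)
  show "act x (r *\<^sub>R \<phi>) = r *\<^sub>R act x \<phi>"
    using *[of "of_real r"] by (simp add: vector_smult_simps)
qed

lemma act_minus_right: "act x (- \<phi>) = - act x \<phi>"
  using act_scale_right[of x "-1" \<phi>] by simp

lemma act_diff_right: "act x (\<phi> - \<eta>) = act x \<phi> - act x \<eta>"
  using act_add_right[of x \<phi> "- \<eta>"] by (simp add: act_minus_right)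

lemma act_zero_right: "act x 0 = 0"
  using act_scale_right[of x 0 0] by simp

lemma act_sum_right: "act x (\<Sum>i\<in>I. f i) = (\<Sum>i\<in>I. act x (f i))"
  by (induction I rule: infinite_finite_induct) (simp_all add: act_zero_right act_add_right)

lemma act_square: "act x (act x \<phi>) = - (x \<bullet> x) *\<^sub>R \<phi>"
proof -
  have "act x (act x \<phi>) = mat (- of_real ((norm x)\<^sup>2)) *v \<phi>"
    using rep unfolding clifford_rep_def act_def matrix_vector_mul_assoc by simp
  also have "\<dots> = of_real (- (x \<bullet> x)) *s \<phi>"
    by (simp add: vec_eq_iff mat_def matrix_vector_mult_def if_distrib if_distribR power2_norm_eq_inner
        cong: if_cong)
  finally show ?thesis unfolding vector_smult_simps .
qed

text \<open>Polarization of \<open>act_square\<close>.\<close>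

lemma act_anticommute: "act x (act y \<phi>) = - act y (act x \<phi>) - (2 * (x \<bullet> y)) *\<^sub>R \<phi>"
proof -
  have "act (x + y) (act (x + y) \<phi>) =
      act x (act x \<phi>) + act x (act y \<phi>) + act y (act x \<phi>) + act y (act y \<phi>)"
    by (simp add: act_add act_add_right)
  then have "act x (act y \<phi>) + act y (act x \<phi>) = - (2 * (x \<bullet> y)) *\<^sub>R \<phi>"
    unfolding act_square by (simp add: inner_add_left inner_add_right inner_commute algebra_simps)
  then have "act x (act y \<phi>) = - (2 * (x \<bullet> y)) *\<^sub>R \<phi> - act y (act x \<phi>)"
    by (simp only: eq_diff_eq)
  then show ?thesis by simp
qed

text \<open>The inner product here is the real part of the Hermitian one, for which the Clifford
  matrices are skew.\<close>

lemma act_skew: "act x \<phi> \<bullet> \<eta> = - (\<phi> \<bullet> act x \<eta>)"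
proof -
  have g: "\<gamma> x $ i $ j = - cnj (\<gamma> x $ j $ i)" for i j
    using rep unfolding clifford_rep_def by blast
  have i: "a \<bullet> b = Re (a * cnj b)" for a b :: complex
    by (simp add: inner_complex_def)
  have "act x \<phi> \<bullet> \<eta> = Re (\<Sum>i\<in>UNIV. \<Sum>j\<in>UNIV. \<gamma> x $ i $ j * \<phi> $ j * cnj (\<eta> $ i))"
    by (simp add: inner_vec_def i act_def matrix_vector_mult_def sum_distrib_right)
  also have "\<dots> = Re (\<Sum>i\<in>UNIV. \<Sum>j\<in>UNIV. - (\<phi> $ i * cnj (\<gamma> x $ i $ j * \<eta> $ j)))"
    by (subst sum.swap, subst g) (simp add: mult_ac)
  also have "\<dots> = - (\<phi> \<bullet> act x \<eta>)"
    by (simp add: inner_vec_def i act_def matrix_vector_mult_def sum_distrib_left sum_negf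
        cnj_sum)
  finally show ?thesis .
qed

text \<open>A skew map with square -|x|^2 is |x| times an isometry; this is the input for the
  operator norm estimate.\<close>

lemma norm_act: "norm (act x \<phi>) = norm x * norm \<phi>"
proof -
  have "act x \<phi> \<bullet> act x \<phi> = (x \<bullet> x) * (\<phi> \<bullet> \<phi>)"
    unfolding act_skew act_square by simp
  then show ?thesis by (simp add: norm_eq_sqrt_inner real_sqrt_mult)
qed

text \<open>The action of the two-form \<open>(x, y) \<mapsto> H x \<bullet> y\<close>.\<close>

definition form_act :: "('e \<Rightarrow> 'e) \<Rightarrow> complex^'s \<Rightarrow> complex^'s"
  where "form_act H \<phi> = (1/2) *\<^sub>R (\<Sum>i\<in>Basis. act i (act (H i) \<phi>))"

lemma form_act_add: "form_act H (\<phi> + \<eta>) = form_act H \<phi> + form_act H \<eta>"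
  by (simp add: form_act_def act_add_right sum.distrib algebra_simps)

lemma form_act_smult: "form_act H (c *s \<phi>) = c *s form_act H \<phi>"
  by (simp add: form_act_def act_smult_right vector_smult_simps vec.scale_sum_right)

text \<open>A two-form acts on vectors by an infinitesimal rotation. Moving \<open>act y\<close>
  past the two factors of each summand leaves two corrections, and after the factor 1/2 in
  \<open>form_act\<close> each of them sums to \<open>act (H y)\<close>.\<close>

lemma form_act_commute:
  assumes skew: "\<And>x y. H x \<bullet> y = - (x \<bullet> H y)"
  shows "form_act H (act y \<phi>) = act y (form_act H \<phi>) + 2 *\<^sub>R act (H y) \<phi>"
proof -
  have e: "act i (act (H i) (act y \<phi>)) =
      act y (act i (act (H i) \<phi>)) + (2 * (y \<bullet> i)) *\<^sub>R act (H i) \<phi> + (2 * (H y \<bullet> i)) *\<^sub>R act i \<phi>" for i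
  proof -
    have "act i (act (H i) (act y \<phi>)) = - act i (act y (act (H i) \<phi>)) - (2 * (H i \<bullet> y)) *\<^sub>R act i \<phi>"
      unfolding act_anticommute[of "H i" y]
      unfolding act_diff_right act_minus_right act_scale_right ..
    also have "H i \<bullet> y = - (H y \<bullet> i)" using skew[of i y] by (simp add: inner_commute)
    finally show ?thesis
      unfolding act_anticommute[of i y] by (simp add: inner_commute algebra_simps)
  qed
  have s: "(\<Sum>i\<in>Basis. (2 * (H y \<bullet> i)) *\<^sub>R act i \<phi>) = 2 *\<^sub>R act (H y) \<phi>"
    by (subst (2) euclidean_representation[symmetric])
      (simp add: act_sum act_scale scaleR_sum_right)
  have s': "(\<Sum>i\<in>Basis. (2 * (y \<bullet> i)) *\<^sub>R act (H i) \<phi>) = 2 *\<^sub>R act (H y) \<phi>"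
  proof -
    \<comment> \<open>Linearity of \<open>H\<close> comes from skewness: pairing with
      \<open>b\<close> moves \<open>H\<close> to the other side, where the inner product is
      linear.\<close>
    have "H y = (\<Sum>i\<in>Basis. (y \<bullet> i) *\<^sub>R H i)"
    proof (rule euclidean_eqI)
      fix b :: 'e assume "b \<in> Basis"
      have "H y \<bullet> b = - ((\<Sum>i\<in>Basis. (y \<bullet> i) *\<^sub>R i) \<bullet> H b)"
        using skew by (simp add: euclidean_representation)
      also have "\<dots> = (\<Sum>i\<in>Basis. (y \<bullet> i) *\<^sub>R H i) \<bullet> b"
        by (simp add: inner_sum_left skew sum_negf)
      finally show "H y \<bullet> b = (\<Sum>i\<in>Basis. (y \<bullet> i) *\<^sub>R H i) \<bullet> b" .
    qed
    then show ?thesis by (simp add: act_sum act_scale scaleR_sum_right)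
  qed
  show ?thesis
    unfolding form_act_def e sum.distrib s s'
    by (simp add: act_scale_right act_sum_right algebra_simps)
qed

text \<open>The triangle inequality over an orthonormal basis. In dimension 2m + 1 the bound is m +
  1/2, enough to exclude an eigenvalue of modulus m + 2.\<close>

lemma norm_form_act:
  assumes "\<And>x. norm (H x) \<le> norm x"
  shows "norm (form_act H \<phi>) \<le> DIM('e) / 2 * norm \<phi>"
proof -
  have "norm (\<Sum>i\<in>Basis. act i (act (H i) \<phi>)) \<le> (\<Sum>i\<in>(Basis::'e set). norm \<phi>)"
  proof (rule order_trans[OF norm_sum], rule sum_mono)
    fix i :: 'e assume "i \<in> Basis"
    then show "norm (act i (act (H i) \<phi>)) \<le> norm \<phi>"
      using assms[of i] by (simp add: norm_act mult_left_le_one_le)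
  qed
  then show ?thesis by (simp add: form_act_def)
qed

text \<open>For a complex structure \<open>H\<close>, the vector \<open>act y \<phi> + \<i>\<tau> act (H y) \<phi>\<close> would be an eigenvector
  for the eigenvalue \<open>- \<i>\<tau> (m + 2)\<close>, which exceeds the norm of the operator.\<close>

lemma extreme_eigenvector:
  assumes dim: "DIM('e) = 2 * m + 1"
    and skew: "\<And>x y. H x \<bullet> y = - (x \<bullet> H y)" and bound: "\<And>x. norm (H x) \<le> norm x"
    and HH: "H (H y) = - y"
    and \<tau>: "\<tau> = 1 \<or> \<tau> = -1"
    and eig: "form_act H \<phi> = (- \<i> * \<tau> * of_nat m) *s \<phi>"
  shows "act (H y) \<phi> = (\<i> * \<tau>) *s act y \<phi>"
proof -
  \<comment> \<open>The commutator of the two-form sends y to 2 H y and H y to -2 y, so it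
    multiplies y + \<i> \<tau> H y by -2 \<i> \<tau>. This combination is a ladder operator that
    moves the extreme eigenvalue outward.\<close>
  define w where "w = act y \<phi> + (\<i> * \<tau>) *s act (H y) \<phi>"
  have tt: "\<tau> * \<tau> = 1" "cmod \<tau> = 1" using \<tau> by auto
  have m: "act (- y) \<phi> = - act y \<phi>" using act_scale[of "-1" y \<phi>] by simp
  have 2: "2 *\<^sub>R \<eta> = 2 *s \<eta>" for \<eta> :: "complex^'s"
    using vector_smult_simps(5)[of 2 \<eta>] by simp
  have "form_act H w = (- \<i> * \<tau> * of_nat m) *s act y \<phi> + 2 *s act (H y) \<phi> +
      (\<i> * \<tau>) *s ((- \<i> * \<tau> * of_nat m) *s act (H y) \<phi> - 2 *s act y \<phi>)"
    unfolding w_def form_act_add form_act_smult form_act_commute[OF skew] eig act_smult_right HH m 2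
    by simp
  also have "\<dots> = (- \<i> * \<tau> * (of_nat m + 2)) *s w"
    unfolding w_def using tt(1)
    by (simp add: vec_eq_iff algebra_simps)
  finally have e: "form_act H w = (- \<i> * \<tau> * (of_nat m + 2)) *s w" .
  have "cmod (of_nat m + 2) = real m + 2"
    by (metis norm_of_nat of_nat_add of_nat_numeral)
  then have "norm (form_act H w) = (real m + 2) * norm w"
    unfolding e norm_vector_smult using tt(2) by (simp add: norm_mult)
  moreover have "norm (form_act H w) \<le> (real m + 1/2) * norm w"
    using norm_form_act[OF bound, of w] by (simp add: dim field_simps)
  ultimately have "3 / 2 * norm w \<le> 0" by (simp add: algebra_simps)
  then have w: "act y \<phi> = - (\<i> * \<tau>) *s act (H y) \<phi>"
    by (simp add: w_def eq_neg_iff_add_eq_0)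
  show ?thesis
    unfolding w using tt(1) by (simp add: vec_eq_iff algebra_simps)
qed

end

section \<open>Killing spinors and transversal Killing spinors\<close>

lemma cderiv_add: "cderiv (v + w) f = cderiv v f + cderiv w f"
  by (simp add: cderiv_def vec_eq_iff complex_eq_iff)

lemma cderiv_scale: "cderiv (c *\<^sub>R v) f = c *\<^sub>R cderiv v f"
  by (simp add: cderiv_def vec_eq_iff complex_eq_iff scaleR_tvec_apply)

locale spin_sasakian_manifold =
  fixes A :: "('a::{t2_space,second_countable_topology}, 'e::euclidean_space) atlas"
    and g :: "'a metric" and \<xi> :: "'a vfield"
    and \<gamma> :: "'e \<Rightarrow> complex^'s^'s" and S :: "('j, 'a, 'e, 's::finite) spin_data" and m :: nat
  assumes spin_sasakian: "spin_sasakian A g \<xi> \<gamma> S m"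
begin

lemma flow: "riemannian_flow A g \<xi>" and spin: "spin_structure A g \<gamma> S"
  and dim: "DIM('e) = 2 * m + 1"
  using spin_sasakian unfolding spin_sasakian_def sasakian_def by simp_all

lemma spin_frame: "orthonormal_frame A g (patch S a) (frame S a)"
  using spin unfolding spin_structure_def orthonormal_frame_def by simp

end

sublocale spin_sasakian_manifold \<subseteq> clifford \<gamma>
  by unfold_locales (use spin_sasakian in \<open>simp add: spin_sasakian_def\<close>)

sublocale spin_sasakian_manifold \<subseteq> sasakian_manifold A g \<xi>
proof unfold_locales
  show "smooth_atlas A" "riemannian_metric A g" using flow unfolding riemannian_flow_def by simp_all
  show "sasakian A g \<xi>" using spin_sasakian unfolding spin_sasakian_def by simp
  fix p
  have "p \<in> (\<Union>a. patch S a)" using spin unfolding spin_structure_def by simp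
  then obtain a where "p \<in> patch S a" by blast
  then show "\<exists>P e. p \<in> P \<and> orthonormal_frame A g P e" using spin_frame by blast
qed

context spin_sasakian_manifold
begin

section \<open>Tangent vectors, h and Clifford multiplication in a frame of the spin
  structure\<close>

definition coord :: "'j \<Rightarrow> 'a \<Rightarrow> 'a tvec \<Rightarrow> 'e"
  where "coord a p = inv (frame S a p)"

definition hmap :: "'j \<Rightarrow> 'a \<Rightarrow> 'e \<Rightarrow> 'e"
  where "hmap a p x = coord a p (h p (frame S a p x))"

text \<open>The transversal connection in a tangent direction \<open>v\<close> that need not lie in \<open>\<real>\<xi>\<close> or \<open>Q\<close>.\<close>

definition trans_spin_conn :: "'j \<Rightarrow> 'a \<Rightarrow> 'a tvec \<Rightarrow> ('j, 'a, 's) spinor \<Rightarrow> complex^'s"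
  where "trans_spin_conn a p v \<psi> = spin_conn A g \<gamma> S a p v \<psi> -
    (g p v (\<xi> p) / 2) *\<^sub>R form_act (hmap a p) (\<psi> a p) -
    (1/2) *\<^sub>R act (coord a p (\<xi> p)) (act (coord a p (h p v)) (\<psi> a p))"

context
  fixes a :: 'j and p :: 'a
  assumes p: "p \<in> patch S a"
begin

lemmas frame_facts = frame_inner[OF spin_frame p] frame_tangent[OF spin_frame p]

lemma coord_frame: "coord a p (frame S a p x) = x"
proof -
  have "inj (frame S a p)"
    by (rule injI) (metis frame_facts(1) inner_commute vector_eq_rdot)
  then show ?thesis by (simp add: coord_def)
qed

lemma frame_coord: "v \<in> tangent A p \<Longrightarrow> frame S a p (coord a p v) = v"
  unfolding coord_def by (rule f_inv_into_f) (simp add: frame_range[OF spin_frame p])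

lemma frame_coeff_coord: "v \<in> tangent A p \<Longrightarrow> g p v (frame S a p x) = coord a p v \<bullet> x"
  using frame_facts(1)[of "coord a p v" x] by (simp add: frame_coord)

lemma coord_inner:
  "v \<in> tangent A p \<Longrightarrow> w \<in> tangent A p \<Longrightarrow> coord a p v \<bullet> coord a p w = g p v w"
  using frame_coeff_coord[of v "coord a p w"] by (simp add: frame_coord)

lemma coord_add: "v \<in> tangent A p \<Longrightarrow> w \<in> tangent A p \<Longrightarrow>
    coord a p (v + w) = coord a p v + coord a p w"
  using linear_add[OF frame_linear[OF spin_frame p], of "coord a p v" "coord a p w"]
  by (metis coord_frame frame_coord)

lemma coord_scale: "v \<in> tangent A p \<Longrightarrow> coord a p (c *\<^sub>R v) = c *\<^sub>R coord a p v"
  using linear_scale[OF frame_linear[OF spin_frame p], of c "coord a p v"]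
  by (metis coord_frame frame_coord)

lemma cliff_eq: "cliff \<gamma> S a p v \<phi> = act (coord a p v) \<phi>"
  by (simp add: cliff_def act_def coord_def)

lemma hmap_skew: "hmap a p x \<bullet> y = - (x \<bullet> hmap a p y)"
proof -
  have "hmap a p x \<bullet> y = g p (h p (frame S a p x)) (frame S a p y)"
    unfolding hmap_def by (simp add: frame_coeff_coord h_tangent frame_facts)
  also have "\<dots> = - g p (h p (frame S a p y)) (frame S a p x)"
    by (simp add: h_skew[of "frame S a p x"] g_sym[of "frame S a p x"] h_tangent frame_facts)
  also have "\<dots> = - (x \<bullet> hmap a p y)"
    unfolding hmap_def by (simp add: frame_coeff_coord h_tangent frame_facts inner_commute)
  finally show ?thesis .
qed

lemma hmap_coord: "v \<in> tangent A p \<Longrightarrow> hmap a p (coord a p v) = coord a p (h p v)"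
  by (simp add: hmap_def frame_coord)

lemma hmap_hmap:
  assumes "v \<in> tangent A p"
  shows "hmap a p (hmap a p (coord a p v)) = - coord a p (horiz g \<xi> p v)"
  using coord_scale[OF horiz_tangent[OF assms], of "-1"] assms
  by (simp add: hmap_coord h_tangent h_h)

text \<open>By skewness and h^2 = -1 on Q, h is isometric on Q, and it kills \<xi>; so |h v|^2 =
  |v|^2 - \<eta>(v)^2.\<close>

lemma norm_hmap: "norm (hmap a p x) \<le> norm x"
proof -
  define v where "v = frame S a p x"
  have v: "v \<in> tangent A p" "x = coord a p v" by (simp_all add: v_def frame_facts coord_frame)
  have "hmap a p (hmap a p x) = - coord a p (horiz g \<xi> p v)"
    using hmap_hmap[OF v(1)] v(2) by simp
  then have "hmap a p x \<bullet> hmap a p x = x \<bullet> coord a p (horiz g \<xi> p v)"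
    unfolding hmap_skew[of x] by simp
  also have "\<dots> = g p v v - (g p v (\<xi> p))\<^sup>2"
    unfolding v(2) coord_inner[OF v(1) horiz_tangent[OF v(1)]]
    by (simp add: horiz_def g_diff_right g_scale_right v(1) xi_tangent tangent_scale_closed
        power2_eq_square)
  also have "\<dots> \<le> x \<bullet> x" unfolding v(2) coord_inner[OF v(1) v(1)] by simp
  finally show ?thesis by (simp add: norm_le)
qed

text \<open>Links the eigenbundle condition to the operator on the model space for which the
  Clifford estimates are available.\<close>

lemma cliff2_Omega: "cliff2 \<gamma> S a p (flow_Omega A g \<xi> p) \<phi> = form_act (hmap a p) \<phi>"
proof -
  have "(\<Sum>j\<in>Basis. flow_Omega A g \<xi> p (frame S a p i) (frame S a p j) *\<^sub>R act i (act j \<phi>)) =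
      act i (act (hmap a p i) \<phi>)" for i
  proof -
    have "act i (act (hmap a p i) \<phi>) = act i (act (\<Sum>j\<in>Basis. (hmap a p i \<bullet> j) *\<^sub>R j) \<phi>)"
      by (simp add: euclidean_representation)
    then show ?thesis
      by (simp add: act_sum act_scale act_sum_right act_scale_right flow_Omega_eq frame_facts hmap_def
          frame_coeff_coord h_tangent)
  qed
  then show ?thesis by (simp add: cliff2_def form_act_def cliff_eq coord_frame)
qed

lemma spin_conn_add:
  assumes "v \<in> tangent A p" "w \<in> tangent A p"
  shows "spin_conn A g \<gamma> S a p (v + w) \<psi> = spin_conn A g \<gamma> S a p v \<psi> + spin_conn A g \<gamma> S a p w \<psi>"
  unfolding spin_conn_def cderiv_add
    levi_civita_at_add[OF nabla_at frame_open[OF spin_frame] p frame_smooth[OF spin_frame] assms]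
  by (simp add: g_add_left frame_facts assms levi_civita_at_tangent[OF nabla_at
      frame_open[OF spin_frame] p frame_smooth[OF spin_frame]] sum.distrib algebra_simps)

lemma spin_conn_scale:
  assumes "v \<in> tangent A p"
  shows "spin_conn A g \<gamma> S a p (c *\<^sub>R v) \<psi> = c *\<^sub>R spin_conn A g \<gamma> S a p v \<psi>"
  unfolding spin_conn_def cderiv_scale
    levi_civita_at_scale[OF nabla_at frame_open[OF spin_frame] p frame_smooth[OF spin_frame] assms]
  by (simp add: g_scale_left frame_facts assms levi_civita_at_tangent[OF nabla_at
      frame_open[OF spin_frame] p frame_smooth[OF spin_frame]] scaleR_sum_right algebra_simps)

lemma trans_spin_conn_add:
  assumes "v \<in> tangent A p" "w \<in> tangent A p"
  shows "trans_spin_conn a p (v + w) \<psi> = trans_spin_conn a p v \<psi> + trans_spin_conn a p w \<psi>"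
  unfolding trans_spin_conn_def spin_conn_add[OF assms]
  by (simp add: assms g_add_left xi_tangent h_add h_tangent coord_add act_add act_add_right
      add_divide_distrib algebra_simps)

lemma trans_spin_conn_scale:
  assumes "v \<in> tangent A p"
  shows "trans_spin_conn a p (c *\<^sub>R v) \<psi> = c *\<^sub>R trans_spin_conn a p v \<psi>"
  unfolding trans_spin_conn_def spin_conn_scale[OF assms]
  by (simp add: assms g_scale_left xi_tangent h_scale h_tangent coord_scale act_scale act_scale_right
      algebra_simps)

lemma coord_zero: "coord a p 0 = 0"
  using coord_scale[OF tangent_zero, of 0] by simp

lemma trans_spin_conn_xi_eq: "trans_spin_conn_xi A g \<xi> \<gamma> S a p \<psi> = trans_spin_conn a p (\<xi> p) \<psi>"
  by (simp add: trans_spin_conn_xi_def trans_spin_conn_def xi_unit h_xi coord_zero act_zero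
      act_zero_right cliff2_Omega)

lemma trans_spin_conn_Q_eq:
  "Z \<in> Qspace A g \<xi> p \<Longrightarrow> trans_spin_conn_Q A g \<xi> \<gamma> S a p Z \<psi> = trans_spin_conn a p Z \<psi>"
  by (simp add: trans_spin_conn_Q_def trans_spin_conn_def Qspace_def cliff_eq)

text \<open>Both sides are linear in the direction, so the equations for \<xi> and for Q merge into
  one that can be compared with the Killing equation vector by vector.\<close>

lemma transversal_killing_at_iff:
  "trans_spin_conn_xi A g \<xi> \<gamma> S a p \<psi> = \<alpha> *s cliff \<gamma> S a p (\<xi> p) (\<psi> a p) \<and>
    (\<forall>Z\<in>Qspace A g \<xi> p. trans_spin_conn_Q A g \<xi> \<gamma> S a p Z \<psi> =
      0 *s cliff \<gamma> S a p (\<xi> p) (cliff \<gamma> S a p Z (\<psi> a p))) \<longleftrightarrow>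
   (\<forall>v\<in>tangent A p. trans_spin_conn a p v \<psi> =
      g p v (\<xi> p) *\<^sub>R (\<alpha> *s act (coord a p (\<xi> p)) (\<psi> a p)))" (is "?L \<longleftrightarrow> ?R")
proof
  assume L: ?L
  show ?R
  proof
    fix v assume v: "v \<in> tangent A p"
    have "v = horiz g \<xi> p v + g p v (\<xi> p) *\<^sub>R \<xi> p" by (simp add: horiz_def)
    then have "trans_spin_conn a p v \<psi> =
        trans_spin_conn a p (horiz g \<xi> p v) \<psi> + g p v (\<xi> p) *\<^sub>R trans_spin_conn a p (\<xi> p) \<psi>"
      using trans_spin_conn_add[OF horiz_tangent[OF v] tangent_scale_closed[OF xi_tangent]]
        trans_spin_conn_scale[OF xi_tangent] by metis
    then show "trans_spin_conn a p v \<psi> =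
        g p v (\<xi> p) *\<^sub>R (\<alpha> *s act (coord a p (\<xi> p)) (\<psi> a p))"
      using L horiz_Qspace[OF v]
      by (simp add: trans_spin_conn_xi_eq trans_spin_conn_Q_eq cliff_eq)
  qed
next
  assume R: ?R
  have "Z \<in> Qspace A g \<xi> p \<Longrightarrow> trans_spin_conn a p Z \<psi> = 0" for Z
    using R by (simp add: Qspace_def)
  then show ?L
    using R[rule_format, OF xi_tangent]
    by (simp add: trans_spin_conn_xi_eq trans_spin_conn_Q_eq cliff_eq xi_unit)
qed

section \<open>Spin connection and Clifford multiplication of the deformed metric\<close>

text \<open>Spinor components and Clifford matrices are the same in the deformed frame, so only the
  coefficients from \<open>dhom_conn_coeff\<close> change. The skew part of that change contracts to
  z x - x z, which is 2 z x because \<xi> is orthogonal to h v; this and the prefactor 1/4 give the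
  halves.\<close>

lemma spin_conn_dhom:
  assumes t: "t > 0" and v: "v \<in> tangent A p"
  shows "spin_conn A (dhom_metric g \<xi> t) \<gamma> (dhom_spin g \<xi> t S) a p v (dhom_spinor t \<psi>) =
    spin_conn A g \<gamma> S a p v \<psi> +
    ((t - 1) / 2 * g p v (\<xi> p)) *\<^sub>R form_act (hmap a p) (\<psi> a p) +
    ((sqrt t - 1) / 2) *\<^sub>R act (coord a p (\<xi> p)) (act (coord a p (h p v)) (\<psi> a p))"
proof -
  define \<phi> where "\<phi> = \<psi> a p"
  define z where "z = coord a p (\<xi> p)"
  define x where "x = coord a p (h p v)"
  have c: "cliff \<gamma> (dhom_spin g \<xi> t S) a p (dhom_isom g \<xi> t p (frame S a p i)) \<eta> = act i \<eta>" for i \<eta>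
    using dhom_cliff[OF flow spin t p frame_facts(2), of i \<eta>] by (simp add: cliff_eq coord_frame)
  have k: "dhom_metric g \<xi> t p
      (nabla A (dhom_metric g \<xi> t) p v (\<lambda>q. dhom_isom g \<xi> t q (frame S a q i)))
      (dhom_isom g \<xi> t p (frame S a p j)) =
    g p (nabla A g p v (\<lambda>q. frame S a q i)) (frame S a p j) +
    (t - 1) * g p v (\<xi> p) * (hmap a p i \<bullet> j) +
    (sqrt t - 1) * ((z \<bullet> i) * (x \<bullet> j) - (z \<bullet> j) * (x \<bullet> i))" for i j
    unfolding dhom_conn_coeff[OF t frame_open[OF spin_frame] p frame_smooth[OF spin_frame] v
        frame_facts(2)] hmap_def z_def x_def
    by (simp add: frame_coeff_coord h_tangent frame_facts v xi_tangent g_sym[OF frame_facts(2) xi_tangent])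
  have 1: "(\<Sum>i\<in>Basis. \<Sum>j\<in>Basis. (hmap a p i \<bullet> j) *\<^sub>R act i (act j \<phi>)) =
      2 *\<^sub>R form_act (hmap a p) \<phi>"
  proof -
    have "(\<Sum>j\<in>Basis. (hmap a p i \<bullet> j) *\<^sub>R act i (act j \<phi>)) =
        act i (act (\<Sum>j\<in>Basis. (hmap a p i \<bullet> j) *\<^sub>R j) \<phi>)" for i
      by (simp only: act_sum act_scale act_sum_right act_scale_right)
    then show ?thesis by (simp add: euclidean_representation form_act_def)
  qed
  have 2: "(\<Sum>i\<in>Basis. \<Sum>j\<in>Basis. ((y \<bullet> i) * (w \<bullet> j)) *\<^sub>R act i (act j \<phi>)) = act y (act w \<phi>)" for y w
  proof -
    have "act y (act w \<phi>) =
        act (\<Sum>i\<in>Basis. (y \<bullet> i) *\<^sub>R i) (act (\<Sum>j\<in>Basis. (w \<bullet> j) *\<^sub>R j) \<phi>)"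
      by (simp add: euclidean_representation)
    also have "\<dots> = (\<Sum>i\<in>Basis. \<Sum>j\<in>Basis. ((y \<bullet> i) * (w \<bullet> j)) *\<^sub>R act i (act j \<phi>))"
      by (simp only: act_sum act_scale act_sum_right act_scale_right scaleR_sum_right scaleR_scaleR)
        (subst sum.swap, simp only: mult.commute)
    finally show ?thesis by simp
  qed
  have zx: "z \<bullet> x = 0"
    unfolding z_def x_def by (simp add: coord_inner xi_tangent h_tangent v h_perp)
  have 3: "act x (act z \<phi>) = - act z (act x \<phi>)"
    using act_anticommute[of x z \<phi>] zx by (simp add: inner_commute)
  define N where "N i j = g p (nabla A g p v (\<lambda>q. frame S a q i)) (frame S a p j)" for i j
  have "(\<Sum>i\<in>Basis. \<Sum>j\<in>Basis. (N i j + (t - 1) * g p v (\<xi> p) * (hmap a p i \<bullet> j) +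
      (sqrt t - 1) * ((z \<bullet> i) * (x \<bullet> j) - (z \<bullet> j) * (x \<bullet> i))) *\<^sub>R act i (act j \<phi>)) =
    (\<Sum>i\<in>Basis. \<Sum>j\<in>Basis. N i j *\<^sub>R act i (act j \<phi>)) +
    ((t - 1) * g p v (\<xi> p)) *\<^sub>R
      (\<Sum>i\<in>Basis. \<Sum>j\<in>Basis. (hmap a p i \<bullet> j) *\<^sub>R act i (act j \<phi>)) +
    (sqrt t - 1) *\<^sub>R ((\<Sum>i\<in>Basis. \<Sum>j\<in>Basis. ((z \<bullet> i) * (x \<bullet> j)) *\<^sub>R act i (act j \<phi>)) -
      (\<Sum>i\<in>Basis. \<Sum>j\<in>Basis. ((x \<bullet> i) * (z \<bullet> j)) *\<^sub>R act i (act j \<phi>)))"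
    by (simp add: scaleR_sum_right scaleR_left_distrib scaleR_right_diff_distrib sum.distrib
        sum_subtractf scaleR_left_diff_distrib right_diff_distrib left_diff_distrib mult_ac)
  also have "\<dots> = (\<Sum>i\<in>Basis. \<Sum>j\<in>Basis. N i j *\<^sub>R act i (act j \<phi>)) +
      (2 * ((t - 1) * g p v (\<xi> p))) *\<^sub>R form_act (hmap a p) \<phi> +
      (2 * (sqrt t - 1)) *\<^sub>R act z (act x \<phi>)"
    unfolding 1 2 3 by (simp add: scaleR_2[symmetric] algebra_simps)
  finally show ?thesis
    unfolding spin_conn_def
    by (simp add: dhom_spin_def[of g \<xi> t S, THEN arg_cong[where f = frame], simplified]
        c k dhom_spinor_def cliff_eq coord_frame N_def
        \<phi>_def[symmetric] z_def[symmetric] x_def[symmetric] scaleR_right_distrib)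
qed

lemma cliff_dhom:
  assumes t: "t > 0" and v: "v \<in> tangent A p"
  shows "cliff \<gamma> (dhom_spin g \<xi> t S) a p v \<phi> =
    (t * g p v (\<xi> p)) *\<^sub>R act (coord a p (\<xi> p)) \<phi> + sqrt t *\<^sub>R act (coord a p (horiz g \<xi> p v)) \<phi>"
proof -
  \<comment> \<open>The preimage of \<open>v\<close> under \<open>dhom_isom\<close>, with the
    inverse factors t along \<xi> and sqrt t on Q.\<close>
  define w where "w = (t * g p v (\<xi> p)) *\<^sub>R \<xi> p + sqrt t *\<^sub>R horiz g \<xi> p v"
  have w: "w \<in> tangent A p"
    unfolding w_def by (intro tangent_plus_closed tangent_scale_closed xi_tangent horiz_tangent v)
  have e: "g p w (\<xi> p) = t * g p v (\<xi> p)"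
    unfolding w_def using v
    by (simp add: g_add_left g_scale_left tangent_scale_closed xi_tangent horiz_tangent xi_unit horiz_perp)
  have "dhom_isom g \<xi> t p w = v"
    unfolding dhom_isom_def horiz_def[of _ _ _ w] e unfolding w_def
    using t by (simp add: dhom_field_def horiz_def algebra_simps)
  then show ?thesis
    using dhom_cliff[OF flow spin t p w, of \<phi>]
    by (simp add: cliff_eq w_def coord_add coord_scale tangent_scale_closed xi_tangent horiz_tangent v
        act_add act_scale)
qed

text \<open>The two extreme eigenbundles are \<open>r = 0\<close> with \<open>\<tau> = 1\<close> and \<open>r = m\<close> with \<open>\<tau> = -1\<close>.\<close>

lemma extreme_spinor:
  assumes r: "r = 0 \<and> \<tau> = 1 \<or> r = m \<and> \<tau> = -1"
    and \<phi>: "\<phi> \<in> Sigma_fibre A g \<xi> \<gamma> S m r a p"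
    and \<mu>: "\<mu> = - \<tau> * (-1) ^ r / 2"
  shows "form_act (hmap a p) \<phi> = (- 2 * \<mu> * of_nat m) *s act (coord a p (\<xi> p)) \<phi>"
    and "v \<in> tangent A p \<Longrightarrow> act (coord a p (\<xi> p)) (act (coord a p (h p v)) \<phi>) =
      (2 * \<mu>) *s act (coord a p (horiz g \<xi> p v)) \<phi>"
proof -
  define c :: complex where "c = (-1) ^ r"
  have cc: "c * c = 1" by (simp add: c_def power_mult_distrib[symmetric])
  have tt: "\<tau> * \<tau> = 1" "\<tau> = 1 \<or> \<tau> = -1" using r by auto
  have eig: "form_act (hmap a p) \<phi> = (- \<i> * \<tau> * of_nat m) *s \<phi>"
    using \<phi> r unfolding Sigma_fibre_def cliff2_Omega by auto
  have "r \<le> m" using r by auto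
  \<comment> \<open>The normalization of Clifford multiplication makes \<xi> act as the scalar -
    \<i> c, and this fixes the sign of \<mu>.\<close>
  then have "\<i> *s act (coord a p (\<xi> p)) \<phi> = c *s \<phi>"
    using spin_sasakian p \<phi> unfolding spin_sasakian_def c_def cliff_eq[symmetric] by blast
  then have "(- \<i>) *s (\<i> *s act (coord a p (\<xi> p)) \<phi>) = (- \<i>) *s (c *s \<phi>)" by simp
  then have z: "act (coord a p (\<xi> p)) \<phi> = (- \<i> * c) *s \<phi>" by (simp add: vector_smult_simps)
  show "form_act (hmap a p) \<phi> = (- 2 * \<mu> * of_nat m) *s act (coord a p (\<xi> p)) \<phi>"
    unfolding eig z \<mu> c_def[symmetric] vector_smult_simps using cc
    by (simp add: algebra_simps)
  assume v: "v \<in> tangent A p"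
  \<comment> \<open>The eigenvector argument needs H (H x) = - x, which is available for the
    horizontal part.\<close>
  define x where "x = coord a p (horiz g \<xi> p v)"
  have hx: "coord a p (h p v) = hmap a p x"
    by (simp add: x_def hmap_coord horiz_tangent v h_horiz)
  have HH: "hmap a p (hmap a p x) = - x"
    unfolding x_def hmap_hmap[OF horiz_tangent[OF v]]
    by (simp add: horiz_def[of _ _ _ "horiz g \<xi> p v"] horiz_perp v)
  have ext: "act (hmap a p x) \<phi> = (\<i> * \<tau>) *s act x \<phi>"
    by (rule extreme_eigenvector[OF dim hmap_skew norm_hmap HH tt(2) eig])
  have "coord a p (\<xi> p) \<bullet> hmap a p x = 0"
    unfolding hx[symmetric] by (simp add: coord_inner xi_tangent h_tangent v h_perp)
  then have "act (coord a p (\<xi> p)) (act (hmap a p x) \<phi>) =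
      - act (hmap a p x) (act (coord a p (\<xi> p)) \<phi>)"
    using act_anticommute[of "coord a p (\<xi> p)" "hmap a p x" \<phi>] by simp
  also have "\<dots> = (2 * \<mu>) *s act x \<phi>"
    unfolding z act_smult_right ext \<mu> c_def[symmetric] by (simp add: vec_eq_iff mult_ac)
  finally show "act (coord a p (\<xi> p)) (act (coord a p (h p v)) \<phi>) = (2 * \<mu>) *s act x \<phi>"
    unfolding hx .
qed

text \<open>The case s = t = 1 is the original metric and s = sqrt t the deformed one. On extreme
  spinors all terms besides the spin connection are multiples of \<xi>\<cdot>\<psi> or of the
  product of the horizontal part with \<psi>. The latter cancel for every s; the former add up to
  \<mu> t from Clifford multiplication and \<mu> t m from \<Omega>.\<close>

lemma killing_at_iff:
  fixes s t :: real
  assumes r: "r = 0 \<and> \<tau> = 1 \<or> r = m \<and> \<tau> = -1"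
    and \<phi>: "\<psi> a p \<in> Sigma_fibre A g \<xi> \<gamma> S m r a p"
    and \<mu>: "\<mu> = - \<tau> * (-1) ^ r / 2" and v: "v \<in> tangent A p"
  shows "spin_conn A g \<gamma> S a p v \<psi> +
      ((t - 1) / 2 * g p v (\<xi> p)) *\<^sub>R form_act (hmap a p) (\<psi> a p) +
      ((s - 1) / 2) *\<^sub>R act (coord a p (\<xi> p)) (act (coord a p (h p v)) (\<psi> a p)) =
      \<mu> *s ((t * g p v (\<xi> p)) *\<^sub>R act (coord a p (\<xi> p)) (\<psi> a p) +
        s *\<^sub>R act (coord a p (horiz g \<xi> p v)) (\<psi> a p)) \<longleftrightarrow>
    trans_spin_conn a p v \<psi> =
      g p v (\<xi> p) *\<^sub>R ((\<mu> * of_real t * (of_nat m + 1)) *s act (coord a p (\<xi> p)) (\<psi> a p))"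
  unfolding trans_spin_conn_def extreme_spinor(1)[OF r \<phi> \<mu>] extreme_spinor(2)[OF r \<phi> \<mu> v]
  \<comment> \<open>The difference of the two sides is the same for both equations.\<close>
  by (rule diff_eq_diff_eq) (simp add: vec_eq_iff scaleR_conv_of_real[where 'a=complex] field_simps)

end

lemma spinor_field_dhom: "spinor_field A (dhom_spin g \<xi> t S) (dhom_spinor t \<psi>) \<longleftrightarrow> spinor_field A S \<psi>"
  by (simp add: spinor_field_def dhom_spin_def dhom_spinor_def)

lemma transversal_killing_iff:
  "transversal_killing A g \<xi> \<gamma> S \<alpha> 0 \<psi> \<longleftrightarrow> spinor_field A S \<psi> \<and>
    (\<forall>a. \<forall>p\<in>patch S a. \<forall>v\<in>tangent A p. trans_spin_conn a p v \<psi> =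
      g p v (\<xi> p) *\<^sub>R (\<alpha> *s act (coord a p (\<xi> p)) (\<psi> a p)))"
  unfolding transversal_killing_def using transversal_killing_at_iff by simp

lemma killing_iff:
  assumes r: "r = 0 \<and> \<tau> = 1 \<or> r = m \<and> \<tau> = -1"
    and \<psi>: "\<psi> \<in> Sigma_sections A g \<xi> \<gamma> S m r" and \<mu>: "\<mu> = - \<tau> * (-1) ^ r / 2"
  shows "killing_spinor A g \<gamma> S \<mu> \<psi> \<longleftrightarrow> transversal_killing A g \<xi> \<gamma> S (\<mu> * (of_nat m + 1)) 0 \<psi>"
    and "t > 0 \<Longrightarrow>
      killing_spinor A (dhom_metric g \<xi> t) \<gamma> (dhom_spin g \<xi> t S) \<mu> (dhom_spinor t \<psi>) \<longleftrightarrow>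
      transversal_killing A g \<xi> \<gamma> S (\<mu> * of_real t * (of_nat m + 1)) 0 \<psi>"
proof -
  have fib: "\<psi> a p \<in> Sigma_fibre A g \<xi> \<gamma> S m r a p" if "p \<in> patch S a" for a p
    using \<psi> that by (simp add: Sigma_sections_def)
  \<comment> \<open>The undeformed counterpart of \<open>cliff_dhom\<close>, which brings the
    Killing equation for \<open>g\<close> into the form with s = t = 1.\<close>
  have "cliff \<gamma> S a p v \<phi> = g p v (\<xi> p) *\<^sub>R act (coord a p (\<xi> p)) \<phi> + act (coord a p (horiz g \<xi> p v)) \<phi>"
    if p: "p \<in> patch S a" and v: "v \<in> tangent A p" for a p v \<phi>
  proof -
    have "v = g p v (\<xi> p) *\<^sub>R \<xi> p + horiz g \<xi> p v" by (simp add: horiz_def)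
    then have "coord a p v = g p v (\<xi> p) *\<^sub>R coord a p (\<xi> p) + coord a p (horiz g \<xi> p v)"
      using coord_add[OF p tangent_scale_closed[OF xi_tangent] horiz_tangent[OF v]]
        coord_scale[OF p xi_tangent] by metis
    then show ?thesis by (simp add: cliff_eq[OF p] act_add act_scale)
  qed
  then show "killing_spinor A g \<gamma> S \<mu> \<psi> \<longleftrightarrow> transversal_killing A g \<xi> \<gamma> S (\<mu> * (of_nat m + 1)) 0 \<psi>"
    using killing_at_iff[where \<psi> = \<psi> and s = 1 and t = 1, OF _ r fib \<mu>]
    unfolding killing_spinor_def transversal_killing_iff by simp
  assume t: "t > 0"
  have "patch (dhom_spin g \<xi> t S) = patch S" by (simp add: dhom_spin_def)
  then show "killing_spinor A (dhom_metric g \<xi> t) \<gamma> (dhom_spin g \<xi> t S) \<mu> (dhom_spinor t \<psi>) \<longleftrightarrow>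
      transversal_killing A g \<xi> \<gamma> S (\<mu> * of_real t * (of_nat m + 1)) 0 \<psi>"
    using killing_at_iff[where \<psi> = \<psi> and s = "sqrt t" and t = t, OF _ r fib \<mu>]
    unfolding killing_spinor_def transversal_killing_iff spinor_field_dhom
    by (simp add: spin_conn_dhom[OF _ t, unfolded dhom_spinor_def] cliff_dhom[OF _ t] dhom_spinor_def[of t \<psi>])
qed

text \<open>\<open>\<mu> * \<alpha> > 0\<close> is the common form of the two sign conditions on
  \<alpha>. The map from t to \<mu> t (m + 1) takes the positive reals onto the reals with the sign
  of \<mu>.\<close>

lemma dhom_killing_iff:
  fixes \<mu> :: real and \<tau> :: complex
  assumes r: "r = 0 \<and> \<tau> = 1 \<or> r = m \<and> \<tau> = -1"
    and \<psi>: "\<psi> \<in> Sigma_sections A g \<xi> \<gamma> S m r" and \<mu>: "of_real \<mu> = - \<tau> * (-1) ^ r / 2"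
  shows "(\<exists>\<alpha>::real. \<mu> * \<alpha> > 0 \<and> transversal_killing A g \<xi> \<gamma> S (of_real \<alpha>) 0 \<psi>) \<longleftrightarrow>
    (\<exists>t>0. killing_spinor A (dhom_metric g \<xi> t) \<gamma> (dhom_spin g \<xi> t S) (of_real \<mu>) (dhom_spinor t \<psi>))"
proof -
  have "(of_real (\<mu> * \<mu>) :: complex) = (\<tau> * \<tau>) * ((-1) ^ r * (-1) ^ r) / 4"
    unfolding of_real_mult \<mu> by simp
  also have "\<dots> = of_real (1/4)"
    using r by (auto simp: power_mult_distrib[symmetric])
  finally have mm: "\<mu> * \<mu> = 1 / 4" unfolding of_real_eq_iff .
  then have \<mu>0: "\<mu> \<noteq> 0" by auto
  have k: "killing_spinor A (dhom_metric g \<xi> t) \<gamma> (dhom_spin g \<xi> t S) (of_real \<mu>) (dhom_spinor t \<psi>) \<longleftrightarrow>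
      transversal_killing A g \<xi> \<gamma> S (of_real (\<mu> * t * (real m + 1))) 0 \<psi>" if "t > 0" for t
    using killing_iff(2)[OF r \<psi> \<mu> that] by simp
  show ?thesis
  proof safe
    fix \<alpha> assume \<alpha>: "\<mu> * \<alpha> > 0" "transversal_killing A g \<xi> \<gamma> S (of_real \<alpha>) 0 \<psi>"
    \<comment> \<open>The solution of \<mu> t (m + 1) = \<alpha>, with 1 / \<mu> = 4 \<mu> since
      \<mu> is 1/2 up to sign.\<close>
    define t where "t = 4 * (\<mu> * \<alpha>) / (real m + 1)"
    have "\<mu> * t * (real m + 1) = 4 * (\<mu> * \<mu>) * \<alpha>" by (simp add: t_def)
    then have "\<mu> * t * (real m + 1) = \<alpha>" by (simp add: mm)
    moreover have "t > 0" using \<alpha>(1) by (simp add: t_def)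
    ultimately show "\<exists>t>0. killing_spinor A (dhom_metric g \<xi> t) \<gamma> (dhom_spin g \<xi> t S) (of_real \<mu>)
        (dhom_spinor t \<psi>)"
      using k \<alpha>(2) by metis
  next
    fix t :: real
    assume t: "t > 0"
      "killing_spinor A (dhom_metric g \<xi> t) \<gamma> (dhom_spin g \<xi> t S) (of_real \<mu>) (dhom_spinor t \<psi>)"
    have "\<mu> * (\<mu> * t * (real m + 1)) = (\<mu> * \<mu>) * t * (real m + 1)" by simp
    also have "\<dots> > 0" unfolding mm using t(1) by simp
    finally have "\<mu> * (\<mu> * t * (real m + 1)) > 0" .
    then show "\<exists>\<alpha>::real. \<mu> * \<alpha> > 0 \<and> transversal_killing A g \<xi> \<gamma> S (of_real \<alpha>) 0 \<psi>"
      using k[OF t(1)] t(2) by blast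
  qed
qed

end

theorem proposition5p3:
  fixes A :: "('a::{t2_space,second_countable_topology}, 'e::euclidean_space) atlas"
    and g :: "'a metric" and \<xi> :: "'a vfield"
    and \<gamma> :: "'e \<Rightarrow> complex^'s^'s" and S :: "('j, 'a, 'e, 's::finite) spin_data" and m :: nat
  assumes "spin_sasakian A g \<xi> \<gamma> S m"
  shows
    "{\<psi> \<in> Sigma_sections A g \<xi> \<gamma> S m 0. killing_spinor A g \<gamma> S (-1/2) \<psi>} =
     {\<psi> \<in> Sigma_sections A g \<xi> \<gamma> S m 0.
        transversal_killing A g \<xi> \<gamma> S (- (of_nat m + 1) / 2) 0 \<psi>}
     \<and>
     (\<forall>\<psi>\<in>Sigma_sections A g \<xi> \<gamma> S m 0.
        (\<exists>\<alpha>::real. \<alpha> < 0 \<and> transversal_killing A g \<xi> \<gamma> S (of_real \<alpha>) 0 \<psi>) \<longleftrightarrow>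
        (\<exists>t>0. killing_spinor A (dhom_metric g \<xi> t) \<gamma> (dhom_spin g \<xi> t S) (-1/2)
                 (dhom_spinor t \<psi>)))
     \<and>
     {\<psi> \<in> Sigma_sections A g \<xi> \<gamma> S m m. killing_spinor A g \<gamma> S ((-1) ^ m / 2) \<psi>} =
     {\<psi> \<in> Sigma_sections A g \<xi> \<gamma> S m m.
        transversal_killing A g \<xi> \<gamma> S ((-1) ^ m * (of_nat m + 1) / 2) 0 \<psi>}
     \<and>
     (\<forall>\<psi>\<in>Sigma_sections A g \<xi> \<gamma> S m m.
        (\<exists>\<alpha>::real. (-1) ^ m * \<alpha> > 0 \<and> transversal_killing A g \<xi> \<gamma> S (of_real \<alpha>) 0 \<psi>) \<longleftrightarrow>
        (\<exists>t>0. killing_spinor A (dhom_metric g \<xi> t) \<gamma> (dhom_spin g \<xi> t S) ((-1) ^ m / 2)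
                 (dhom_spinor t \<psi>)))"
proof -
  interpret spin_sasakian_manifold A g \<xi> \<gamma> S m
    using assms by unfold_locales
  have 0: "killing_spinor A g \<gamma> S (-1/2) \<psi> \<longleftrightarrow>
      transversal_killing A g \<xi> \<gamma> S (- (of_nat m + 1) / 2) 0 \<psi>"
    if "\<psi> \<in> Sigma_sections A g \<xi> \<gamma> S m 0" for \<psi>
  proof -
    have e: "- 1 / 2 * (of_nat m + 1) = - (of_nat m + 1) / (2 :: complex)" by (simp add: field_simps)
    show ?thesis using killing_iff(1)[of 0 1 \<psi> "-1/2", unfolded e] that by simp
  qed
  \<comment> \<open>For r = m, the value \<tau> = -1 turns - \<tau> (-1)^r / 2 into (-1)^m /
    2.\<close>
  have 1: "\<psi> \<in> Sigma_sections A g \<xi> \<gamma> S m m \<Longrightarrow> killing_spinor A g \<gamma> S ((-1) ^ m / 2) \<psi> \<longleftrightarrow>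
      transversal_killing A g \<xi> \<gamma> S ((-1) ^ m * (of_nat m + 1) / 2) 0 \<psi>" for \<psi>
    using killing_iff(1)[of m "-1" \<psi> "(-1) ^ m / 2"] by simp
  have 2: "\<psi> \<in> Sigma_sections A g \<xi> \<gamma> S m 0 \<Longrightarrow>
      (\<exists>\<alpha>::real. \<alpha> < 0 \<and> transversal_killing A g \<xi> \<gamma> S (of_real \<alpha>) 0 \<psi>) \<longleftrightarrow>
      (\<exists>t>0. killing_spinor A (dhom_metric g \<xi> t) \<gamma> (dhom_spin g \<xi> t S) (-1/2) (dhom_spinor t \<psi>))"
    for \<psi>
    using dhom_killing_iff[of 0 1 \<psi> "-1/2"] by simp
  have 3: "\<psi> \<in> Sigma_sections A g \<xi> \<gamma> S m m \<Longrightarrow>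
      (\<exists>\<alpha>::real. (-1) ^ m * \<alpha> > 0 \<and> transversal_killing A g \<xi> \<gamma> S (of_real \<alpha>) 0 \<psi>) \<longleftrightarrow>
      (\<exists>t>0. killing_spinor A (dhom_metric g \<xi> t) \<gamma> (dhom_spin g \<xi> t S) ((-1) ^ m / 2)
        (dhom_spinor t \<psi>))" for \<psi>
    using dhom_killing_iff[of m "-1" \<psi> "(-1) ^ m / 2"] by simp
  show ?thesis using 0 1 2 3 by blast
qed

end
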